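(* Let $\Omega\subset\mathbb{R}^d$ be a bounded domain, $T\in L^2(\Omega)$, and let $V$, $\mathcal V=L^2([0,1],V)$, $Y$, $K$, $\mathcal D$, $\mathcal E_1$, $\mathcal E_2$ be as in the context, satisfying assumptions (A1)--(A6) listed there. Then for any $\lambda_1,\lambda_2>0$ and any $g\in Y$, the problem $$\min_{(v,z)\in\mathcal V\times L^2(\Omega)} J_{\lambda,g}(v,z),\qquad J_{\lambda,g}(v,z)=\mathcal D\bigl(K(R_{v,z}),g\bigr)+\lambda_1\mathcal E_1(v)+\lambda_2\mathcal E_2(z),$$ has a minimizer.
   Context: **Setting.** $\Omega\subset\mathbb{R}^d$ is a bounded domain and $T\in L^2(\Omega)$ is a fixed template image. For $0<\alpha\le 1$, $C_0^{1,\alpha}(\Omega,\mathbb{R}^d)$ denotes the closure of $C_c^\infty(\Omega,\mathbb{R}^d)$ with respect to the Hölder norm $\|\cdot\|_{C^{1,\alpha}}$. $V$ is an admissible vector space, meaning that it embeds continuously into $C_0^{1,\alpha}(\Omega,\mathbb{R}^d)$ for some $0<\alpha\le1$, and $\mathcal V:=L^2([0,1],V)$ is the set of admissible velocity fields. $Y$ is a Banach space. **Flow and reconstruction.** For $v\in\mathcal V$, let $\varphi_v$ be the unique global solution (it exists and lies in $C([0,1],C^1(\overline\Omega,\mathbb{R}^d))$) of $\tfrac{\mathrm d}{\mathrm dt}\varphi_v(t,x)=v(t,\varphi_v(t,x))$ for $(t,x)\in[0,1]\times\Omega$, $\varphi_v(0,x)=x$ for $x\in\Omega$. Each $\varphi_v(t,\cdot)$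 is a diffeomorphism; $\varphi_v^{-1}(1,\cdot)$ denotes the inverse of $\varphi_v(1,\cdot)$ with respect to the spatial variable. For $(v,z)\in\mathcal V\times L^2(\Omega)$ define $R_{v,z}:=T\circ\varphi_v^{-1}(1,\cdot)+z\in L^2(\Omega)$. **Data.** $K\colon L^2(\Omega)\to Y$ is a (not necessarily linear) operator, $\mathcal D\colon Y\times Y\to\mathbb{R}_{\ge0}$, $\mathcal E_1\colon\mathcal V\to\mathbb{R}_{\ge0}$, $\mathcal E_2\colon L^2(\Omega)\to\mathbb{R}_{\ge0}$. **Assumptions.** - (A1) $K$ is continuous and weak-weak-continuous: $x_n\rightharpoonup x$ in $L^2(\Omega)$ implies $K(x_n)\rightharpoonup K(x)$ in $Y$. - (A2) $\mathcal D(\cdot,g)$ is weakly lower semicontinuous for all $g\in Y$, and $\mathcal D(f,\cdot)$ is continuous for all $f\in Y$. - (A3) If $\mathcal D(f,g)=0$, then $f=g$. - (A4) There exists $C>0$ such that $|\mathcal D(f,h)-\mathcal D(f,g)|\le C\,\mathcal D(g,h)$ for all $f,g,h\in Y$. - (A5) For fixed $g\in Y$, any bounded sequence $\{f_n\}\subset L^2(\Omega)$ and any sequence $\{z_n\}\subset L^2(\Omega)$ with $\|z_n\|_2\to\infty$, one has $\mathcal D(K(f_n+z_n),g)+\mathcal E_2(z_n)\to\infty$. Further, for $\{v_n\}\subset\mathcal V$ with $\|v_n\|_{\mathcal V}\to\infty$, one has $\mathcal E_1(v_n)\to\infty$. - (A6) $\mathcal E_1$ and $\mathcal E_2$ are weakly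 lower semicontinuous.
   Formalization: The admissible vector space V is additionally assumed to be a reflexive Banach space; without reflexivity a weakly lower semicontinuous coercive E_1 built from a non-norm-attaining functional on L^2([0,1],V) gives a problem with no minimizer. *)

theory Defs
  imports "HOL-Analysis.Analysis"
begin

section \<open>Square-integrable functions and weak convergence\<close>

text \<open>
  Elements of \<open>L\<^sup>2\<close> are represented by functions rather than by classes modulo almost everywhere
  equality.  Maps out of \<open>L\<^sup>2\<close> that are continuous for the seminorm \<open>L2_norm\<close>, or weakly (lower
  semi)continuous in the sense below, automatically factor through the classes, because a constant
  sequence converges to every representative of its class.

  Measurability is strong (Bochner) measurability: almost everywhere limits of simple functions.
  The library's Bochner integral is not used for this because it needs a separable target type.
  The measures used below are complete, so for real-valued \<open>f\<close> this is \<open>f \<in> borel_measurable M\<close>.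
\<close>

definition strongly_measurable :: "'s measure \<Rightarrow> ('s \<Rightarrow> 'b::topological_space) \<Rightarrow> bool" where
  "strongly_measurable M f \<longleftrightarrow>
     (\<exists>s. (\<forall>i. simple_function M (s i)) \<and> (AE x in M. (\<lambda>i::nat. s i x) \<longlonglongrightarrow> f x))"

definition L2 :: "'s measure \<Rightarrow> ('s \<Rightarrow> 'b::real_normed_vector) set" where
  "L2 M = {f. strongly_measurable M f \<and> integrable M (\<lambda>x. (norm (f x))\<^sup>2)}"

definition L2_norm :: "'s measure \<Rightarrow> ('s \<Rightarrow> 'b::real_normed_vector) \<Rightarrow> real" where
  "L2_norm M f = sqrt (\<integral>x. (norm (f x))\<^sup>2 \<partial>M)"

definition L2_dual :: "'s measure \<Rightarrow> (('s \<Rightarrow> 'b::real_normed_vector) \<Rightarrow> real) set" where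
  "L2_dual M = {\<Lambda>.
     (\<forall>f\<in>L2 M. \<forall>h\<in>L2 M. \<Lambda> (\<lambda>x. f x + h x) = \<Lambda> f + \<Lambda> h) \<and>
     (\<forall>c. \<forall>f\<in>L2 M. \<Lambda> (\<lambda>x. c *\<^sub>R f x) = c * \<Lambda> f) \<and>
     (\<exists>C. \<forall>f\<in>L2 M. \<bar>\<Lambda> f\<bar> \<le> C * L2_norm M f)}"

definition L2_weakly_tendsto ::
    "'s measure \<Rightarrow> (nat \<Rightarrow> 's \<Rightarrow> 'b::real_normed_vector) \<Rightarrow> ('s \<Rightarrow> 'b) \<Rightarrow> bool" where
  "L2_weakly_tendsto M fs f \<longleftrightarrow>
     range fs \<subseteq> L2 M \<and> f \<in> L2 M \<and> (\<forall>\<Lambda>\<in>L2_dual M. (\<lambda>n. \<Lambda> (fs n)) \<longlonglongrightarrow> \<Lambda> f)"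

definition L2_weakly_lsc :: "'s measure \<Rightarrow> (('s \<Rightarrow> 'b::real_normed_vector) \<Rightarrow> real) \<Rightarrow> bool" where
  "L2_weakly_lsc M E \<longleftrightarrow>
     (\<forall>fs f. L2_weakly_tendsto M fs f \<longrightarrow> ereal (E f) \<le> liminf (\<lambda>n. ereal (E (fs n))))"

definition L2_continuous ::
    "'s measure \<Rightarrow> (('s \<Rightarrow> 'b::real_normed_vector) \<Rightarrow> 'y::metric_space) \<Rightarrow> bool" where
  "L2_continuous M K \<longleftrightarrow>
     (\<forall>f\<in>L2 M. \<forall>\<epsilon>>0. \<exists>\<delta>>0. \<forall>h\<in>L2 M. L2_norm M (\<lambda>x. h x - f x) < \<delta> \<longrightarrow> dist (K h) (K f) < \<epsilon>)"

definition weakly_tendsto :: "(nat \<Rightarrow> 'y::real_normed_vector) \<Rightarrow> 'y \<Rightarrow> bool" where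
  "weakly_tendsto ys y \<longleftrightarrow>
     (\<forall>l :: 'y \<Rightarrow>\<^sub>L real. (\<lambda>n. blinfun_apply l (ys n)) \<longlonglongrightarrow> blinfun_apply l y)"

definition weakly_lsc :: "('y::real_normed_vector \<Rightarrow> real) \<Rightarrow> bool" where
  "weakly_lsc F \<longleftrightarrow>
     (\<forall>ys y. weakly_tendsto ys y \<longrightarrow> ereal (F y) \<le> liminf (\<lambda>n. ereal (F (ys n))))"

definition reflexive_space :: "'v::real_normed_vector itself \<Rightarrow> bool" where
  "reflexive_space _ \<longleftrightarrow>
     (\<forall>F :: ('v \<Rightarrow>\<^sub>L real) \<Rightarrow>\<^sub>L real. \<exists>x. \<forall>l. blinfun_apply F l = blinfun_apply l x)"


section \<open>Admissible spaces of vector fields\<close>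

primrec Ck :: "nat \<Rightarrow> ('a::euclidean_space \<Rightarrow> 'b::euclidean_space) \<Rightarrow> bool" where
  "Ck 0 f \<longleftrightarrow> continuous_on UNIV f"
| "Ck (Suc k) f \<longleftrightarrow>
     (\<forall>x. f differentiable (at x)) \<and> (\<forall>h. Ck k (\<lambda>x. frechet_derivative f (at x) h))"

definition test_functions :: "'a::euclidean_space set \<Rightarrow> ('a \<Rightarrow> 'a) set" where
  "test_functions \<Omega> =
     {f. (\<forall>k. Ck k f) \<and> compact (closure {x. f x \<noteq> 0}) \<and> closure {x. f x \<noteq> 0} \<subseteq> \<Omega>}"

definition holder_norm :: "'a::euclidean_space set \<Rightarrow> real \<Rightarrow> ('a \<Rightarrow> 'a) \<Rightarrow> ennreal" where
  "holder_norm \<Omega> \<alpha> f =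
     (SUP x\<in>\<Omega>. ennreal (norm (f x))) +
     (SUP x\<in>\<Omega>. ennreal (onorm (frechet_derivative f (at x)))) +
     (SUP (x, y)\<in>{(x, y). x \<in> \<Omega> \<and> y \<in> \<Omega> \<and> x \<noteq> y}.
        ennreal (onorm (\<lambda>h. frechet_derivative f (at x) h - frechet_derivative f (at y) h)
                 / norm (x - y) powr \<alpha>))"

text \<open>
  The closure of the test functions for the norm \<open>holder_norm\<close>.  Vector fields on \<open>\<Omega>\<close> are
  total functions that are extended by zero outside \<open>\<Omega>\<close>.
\<close>

definition C0_holder :: "'a::euclidean_space set \<Rightarrow> real \<Rightarrow> ('a \<Rightarrow> 'a) set" where
  "C0_holder \<Omega> \<alpha> =
     {f. (\<forall>x. x \<notin> \<Omega> \<longrightarrow> f x = 0) \<and> (\<forall>x\<in>\<Omega>. f differentiable (at x)) \<and>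
         (\<forall>\<epsilon>>0. \<exists>\<phi>\<in>test_functions \<Omega>. holder_norm \<Omega> \<alpha> (\<lambda>x. f x - \<phi> x) < ennreal \<epsilon>)}"

text \<open>
  The space \<open>V\<close> is an abstract Banach space, given as a type, and \<open>\<iota>\<close> is its embedding: \<open>\<iota> u\<close> is the
  vector field on \<open>\<Omega>\<close> that the element \<open>u\<close> of \<open>V\<close> stands for.
\<close>

definition admissible ::
    "'a::euclidean_space set \<Rightarrow> ('v::real_normed_vector \<Rightarrow> 'a \<Rightarrow> 'a) \<Rightarrow> bool" where
  "admissible \<Omega> \<iota> \<longleftrightarrow>
     (\<forall>u w x. \<iota> (u + w) x = \<iota> u x + \<iota> w x) \<and>
     (\<forall>c u x. \<iota> (c *\<^sub>R u) x = c *\<^sub>R \<iota> u x) \<and>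
     inj \<iota> \<and>
     (\<exists>\<alpha> C. 0 < \<alpha> \<and> \<alpha> \<le> 1 \<and> 0 \<le> C \<and>
        (\<forall>u. \<iota> u \<in> C0_holder \<Omega> \<alpha> \<and> holder_norm \<Omega> \<alpha> (\<iota> u) \<le> ennreal (C * norm u)))"

abbreviation velocity_fields :: "(real \<Rightarrow> 'v::real_normed_vector) set" where
  "velocity_fields \<equiv> L2 (lebesgue_on {0..1})"


section \<open>Flow, reconstruction and objective\<close>

text \<open>
  Velocity fields are only square-integrable in time, so the differential equation is understood
  in the sense of Caratheodory, that is, in integrated form.
\<close>

definition is_trajectory ::
    "(real \<Rightarrow> 'a::euclidean_space \<Rightarrow> 'a) \<Rightarrow> 'a \<Rightarrow> (real \<Rightarrow> 'a) \<Rightarrow> bool" where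
  "is_trajectory u x \<gamma> \<longleftrightarrow>
     continuous_on {0..1} \<gamma> \<and>
     (\<forall>t\<in>{0..1}. set_integrable lebesgue {0..t} (\<lambda>s. u s (\<gamma> s)) \<and>
                 \<gamma> t = x + (LINT s:{0..t}|lebesgue. u s (\<gamma> s)))"

definition flow ::
    "(real \<Rightarrow> 'a::euclidean_space \<Rightarrow> 'a) \<Rightarrow> real \<Rightarrow> 'a \<Rightarrow> 'a" where
  "flow u t x = (THE y. \<exists>\<gamma>. is_trajectory u x \<gamma> \<and> \<gamma> t = y)"

definition reconstruction ::
    "'a::euclidean_space set \<Rightarrow> ('a \<Rightarrow> real) \<Rightarrow> ('v \<Rightarrow> 'a \<Rightarrow> 'a) \<Rightarrow>
     (real \<Rightarrow> 'v) \<Rightarrow> ('a \<Rightarrow> real) \<Rightarrow> 'a \<Rightarrow> real" where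
  "reconstruction \<Omega> T \<iota> v z =
     (\<lambda>x. T (inv_into \<Omega> (flow (\<lambda>t. \<iota> (v t)) 1) x) + z x)"

definition objective ::
    "'a::euclidean_space set \<Rightarrow> ('a \<Rightarrow> real) \<Rightarrow> ('v \<Rightarrow> 'a \<Rightarrow> 'a) \<Rightarrow>
     (('a \<Rightarrow> real) \<Rightarrow> 'y) \<Rightarrow> ('y \<Rightarrow> 'y \<Rightarrow> real) \<Rightarrow>
     ((real \<Rightarrow> 'v) \<Rightarrow> real) \<Rightarrow> (('a \<Rightarrow> real) \<Rightarrow> real) \<Rightarrow>
     real \<Rightarrow> real \<Rightarrow> 'y \<Rightarrow> (real \<Rightarrow> 'v) \<Rightarrow> ('a \<Rightarrow> real) \<Rightarrow> real" where
  "objective \<Omega> T \<iota> K D E1 E2 lam1 lam2 g v z =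
     D (K (reconstruction \<Omega> T \<iota> v z)) g + lam1 * E1 v + lam2 * E2 z"

end

theory Submission imports Defs "HOL-Library.Diagonal_Subsequence" begin

text \<open>
  The theorem is an instance of the direct method; two facts carry the proof.

  First, bounded sequences in \<open>L\<^sup>2([0,1], V)\<close> and \<open>L\<^sup>2(\<Omega>)\<close> have weakly convergent subsequences.  Point
  evaluations span a dense subspace of \<open>V\<^sup>*\<close>, because \<open>V\<close> is reflexive and embeds into continuous
  fields; hence \<open>V\<^sup>*\<close> and \<open>V\<close> are separable.  For a Banach space \<open>X\<close> such that \<open>X\<close> and \<open>X\<^sup>*\<close> are separable,
  the dual of \<open>L\<^sup>2(X)\<close> is \<open>L\<^sup>2(X\<^sup>*)\<close>: the Riesz densities of \<open>\<phi> \<mapsto> \<Lambda> (\<phi> x)\<close> are almost everywhere additive and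
  bounded on a countable dense rational subspace of \<open>X\<close>, so they extend to elements of \<open>X\<^sup>*\<close>.  A diagonal
  subsequence makes the pairings with \<open>L\<^sup>2(V\<^sup>*)\<close> converge, and the limit functional is represented by an
  element of \<open>L\<^sup>2(V\<^sup>*\<^sup>*) = L\<^sup>2(V)\<close>.

  Second, \<open>v \<mapsto> T \<circ> \<phi>\<^sub>v\<^sup>-\<^sup>1(1, \<cdot>)\<close> maps weakly convergent sequences to norm convergent ones.  Along a
  fixed trajectory, weak convergence of the fields gives convergence of the driving integrals, and
  Gronwall's inequality turns this into pointwise convergence of the flows.  The flows and their inverses
  are uniformly Lipschitz, so composition with the inverses is uniformly bounded on \<open>L\<^sup>2\<close>, and it
  suffices to treat bounded continuous templates, where dominated convergence applies.
\<close>

section \<open>Hahn--Banach and separability\<close>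

text \<open>A velocity field is only square-integrable in time, so its Lipschitz weight
  \<open>m\<close> is not a constant, and the distance of two trajectories obeys a Gronwall
  inequality with kernel \<open>m\<close>. Squaring the distance and applying Cauchy-Schwarz trades
  \<open>m\<close> for a number \<open>A\<close> that bounds its square integral: the squared
  distance satisfies an inequality with the constant kernel \<open>2 * A\<close>. The Lipschitz
  constants of the flows and of their inverses then depend on \<open>A\<close> alone, so one
  \<open>A\<close> serves a bounded sequence together with its weak limit. Weak convergence of
  fields need not give convergence of \<open>v n t\<close> at any time \<open>t\<close>. What
  survives are functionals linear in the field, and the driving integral is linear in the field once
  the curve is fixed; this forces the comparison along the trajectory of the limit. Fields are
  extended by zero beyond \<Omega>, so flows are bijections of the whole space that fix the
  complement of \<Omega>; invariance of \<Omega> follows without following trajectories up to the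
  boundary.\<close>

lemma hahn_banach_step:
  fixes G :: "('a::real_normed_vector \<times> real) set" and x0 :: 'a
  assumes G: "subspace G" and bd: "\<And>x r. (x, r) \<in> G \<Longrightarrow> r \<le> C * norm x" and C: "0 \<le> C"
  obtains a where "subspace {u + c *\<^sub>R (x0, a) | u c. u \<in> G}"
    and "\<And>x r. (x, r) \<in> {u + c *\<^sub>R (x0, a) | u c. u \<in> G} \<Longrightarrow> r \<le> C * norm x"
proof -
  \<comment> \<open>The value at \<open>x0\<close> has to satisfy
    \<open>r - C * norm (y - x0) \<le> a \<le> C * norm (y + x0) - r\<close> for every
    \<open>(y, r)\<close> in \<open>G\<close>. By \<open>ub\<close> every lower bound lies below
    every upper bound, so the supremum of the lower bounds qualifies.\<close>
  define a where "a = (SUP (y, r)\<in>G. r - C * norm (y - x0))"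
  have ub: "r - C * norm (y - x0) \<le> C * norm (y' + x0) - r'" if "(y, r) \<in> G" "(y', r') \<in> G" for y r y' r'
  proof -
    have "(y + y', r + r') \<in> G"
      using subspace_add[OF G that] by simp
    then have "r + r' \<le> C * norm (y + y')"
      by (rule bd)
    also have "\<dots> \<le> C * (norm (y - x0) + norm (y' + x0))"
      using norm_triangle_ineq[of "y - x0" "y' + x0"] C by (intro mult_left_mono) (auto simp: algebra_simps)
    finally show ?thesis
      by (simp add: algebra_simps)
  qed
  have ne: "(0, 0) \<in> G"
    using subspace_0[OF G] by (simp add: zero_prod_def)
  have bdd: "bdd_above ((\<lambda>(y, r). r - C * norm (y - x0)) ` G)"
    by (rule bdd_aboveI[of _ "C * norm (0 + x0) - 0"]) (use ub[OF _ ne] in auto)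
  have low: "r - C * norm (y - x0) \<le> a" if "(y, r) \<in> G" for y r
    unfolding a_def using cSUP_upper[OF that bdd] by simp
  have upp: "a \<le> C * norm (y + x0) - r" if "(y, r) \<in> G" for y r
    unfolding a_def using ne ub that by (intro cSUP_least) auto
  show ?thesis
  proof
    show "subspace {u + c *\<^sub>R (x0, a) | u c. u \<in> G}"
    proof (rule subspaceI)
      show "0 \<in> {u + c *\<^sub>R (x0, a) | u c. u \<in> G}"
        using subspace_0[OF G] by (intro CollectI exI[of _ 0]) (auto simp: zero_prod_def)
    next
      fix p q assume "p \<in> {u + c *\<^sub>R (x0, a) | u c. u \<in> G}" "q \<in> {u + c *\<^sub>R (x0, a) | u c. u \<in> G}"
      then obtain u c u' c' where "p = u + c *\<^sub>R (x0, a)" "u \<in> G" "q = u' + c' *\<^sub>R (x0, a)" "u' \<in> G"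
        by auto
      then show "p + q \<in> {u + c *\<^sub>R (x0, a) | u c. u \<in> G}"
        using subspace_add[OF G, of u u']
        by (intro CollectI exI[of _ "u + u'"] exI[of _ "c + c'"]) (auto simp: algebra_simps)
    next
      fix k p assume "p \<in> {u + c *\<^sub>R (x0, a) | u c. u \<in> G}"
      then obtain u c where "p = u + c *\<^sub>R (x0, a)" "u \<in> G"
        by auto
      then show "k *\<^sub>R p \<in> {u + c *\<^sub>R (x0, a) | u c. u \<in> G}"
        using subspace_scale[OF G, of u k]
        by (intro CollectI exI[of _ "k *\<^sub>R u"] exI[of _ "k * c"]) (auto simp: algebra_simps)
    qed
  next
    fix x r assume "(x, r) \<in> {u + c *\<^sub>R (x0, a) | u c. u \<in> G}"
    then obtain y s c where ys: "(y, s) \<in> G" and x: "x = y + c *\<^sub>R x0" and r: "r = s + c * a"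
      by auto
    have sc: "((1 / k) *\<^sub>R y, s / k) \<in> G" for k
      using subspace_scale[OF G ys, of "1 / k"] by simp
    \<comment> \<open>Dividing by \<open>\<bar>c\<bar>\<close> reduces the claim to the upper bound
      on \<open>a\<close> for positive \<open>c\<close> and to the lower bound for negative
      \<open>c\<close>.\<close>
    consider "c = 0" | "c > 0" | "c < 0" by linarith
    then show "r \<le> C * norm x"
    proof cases
      case 1 then show ?thesis using bd ys x r by auto
    next
      case 2
      have "x = c *\<^sub>R ((1 / c) *\<^sub>R y + x0)"
        using 2 x by (simp add: algebra_simps)
      then have "norm x = c * norm ((1 / c) *\<^sub>R y + x0)"
        using 2 by (metis abs_of_pos norm_scaleR)
      moreover have "c * a \<le> c * (C * norm ((1 / c) *\<^sub>R y + x0) - s / c)"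
        using upp[OF sc, of c] 2 by (intro mult_left_mono) auto
      ultimately show ?thesis
        using 2 r by (simp add: algebra_simps)
    next
      case 3
      have "x = (-c) *\<^sub>R ((1 / (-c)) *\<^sub>R y - x0)"
        using 3 x by (simp add: algebra_simps)
      then have "norm x = (-c) * norm ((1 / (-c)) *\<^sub>R y - x0)"
        using 3 by (metis abs_of_pos neg_0_less_iff_less norm_scaleR)
      moreover have "(-c) * (s / (-c) - C * norm ((1 / (-c)) *\<^sub>R y - x0)) \<le> (-c) * a"
        using low[OF sc, of "-c"] 3 by (intro mult_left_mono) auto
      ultimately show ?thesis
        using 3 r by (simp add: algebra_simps)
    qed
  qed
qed

text \<open>A linear functional on a subspace is encoded by its graph, a subspace of the product with \<open>\<real>\<close>.\<close>

theorem hahn_banach_graph: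
  fixes G :: "('a::real_normed_vector \<times> real) set"
  assumes G: "subspace G" and bd: "\<And>x r. (x, r) \<in> G \<Longrightarrow> r \<le> C * norm x" and C: "0 \<le> C"
  obtains l :: "'a \<Rightarrow>\<^sub>L real" where "norm l \<le> C" "\<And>x r. (x, r) \<in> G \<Longrightarrow> blinfun_apply l x = r"
proof -
  define A where "A = {H. subspace H \<and> G \<subseteq> H \<and> (\<forall>x r. (x, r) \<in> H \<longrightarrow> r \<le> C * norm x)}"
  have "\<exists>M\<in>A. \<forall>X\<in>A. M \<subseteq> X \<longrightarrow> X = M"
  proof (rule Zorn_Lemma2, rule ballI)
    fix c assume c: "c \<in> chains A"
    show "\<exists>U\<in>A. \<forall>X\<in>c. X \<subseteq> U"
    proof (cases "c = {}")
      case True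
      then show ?thesis using G bd by (auto simp: A_def)
    next
      case False
      have cA: "c \<subseteq> A" using c by (rule chainsD2)
      have "subspace (\<Union>c)"
      proof (rule subspaceI)
        show "0 \<in> \<Union>c" using False cA subspace_0 unfolding A_def by blast
      next
        fix p q assume "p \<in> \<Union>c" "q \<in> \<Union>c"
        then obtain X Y where XY: "X \<in> c" "p \<in> X" "Y \<in> c" "q \<in> Y" by auto
        then obtain Z where "Z \<in> c" "p \<in> Z" "q \<in> Z"
          using chainsD[OF c XY(1,3)] by auto
        then show "p + q \<in> \<Union>c"
          using cA subspace_add[of Z p q] unfolding A_def by blast
      next
        fix k p assume "p \<in> \<Union>c"
        then show "k *\<^sub>R p \<in> \<Union>c"
          using cA subspace_scale[of _ p k] unfolding A_def by blast
      qed
      moreover have "G \<subseteq> \<Union>c" using False cA by (auto simp: A_def)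
      moreover have "\<forall>x r. (x, r) \<in> \<Union>c \<longrightarrow> r \<le> C * norm x" using cA by (auto simp: A_def)
      ultimately have "\<Union>c \<in> A" by (simp add: A_def)
      then show ?thesis by (intro bexI[of _ "\<Union>c"]) auto
    qed
  qed
  then obtain M where "M \<in> A" and max: "\<And>X. X \<in> A \<Longrightarrow> M \<subseteq> X \<Longrightarrow> X = M" by auto
  then have M: "subspace M" and GM: "G \<subseteq> M" and bM: "\<And>x r. (x, r) \<in> M \<Longrightarrow> r \<le> C * norm x"
    by (auto simp: A_def)
  have ex: "\<exists>r. (x, r) \<in> M" for x
  proof -
    obtain a where a: "subspace {u + c *\<^sub>R (x, a) | u c. u \<in> M}"
      "\<And>y r. (y, r) \<in> {u + c *\<^sub>R (x, a) | u c. u \<in> M} \<Longrightarrow> r \<le> C * norm y"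
      using hahn_banach_step[OF M bM C] by blast
    have sub: "M \<subseteq> {u + c *\<^sub>R (x, a) | u c. u \<in> M}"
    proof
      fix u assume "u \<in> M"
      then show "u \<in> {u + c *\<^sub>R (x, a) | u c. u \<in> M}"
        by (intro CollectI exI[of _ u] exI[of _ 0]) (auto simp: zero_prod_def[symmetric])
    qed
    then have "{u + c *\<^sub>R (x, a) | u c. u \<in> M} \<in> A"
      using a GM unfolding A_def mem_Collect_eq by blast
    then have "{u + c *\<^sub>R (x, a) | u c. u \<in> M} = M"
      using max sub by blast
    moreover have "(x, a) \<in> {u + c *\<^sub>R (x, a) | u c. u \<in> M}"
      using subspace_0[OF M] by (intro CollectI exI[of _ 0] exI[of _ 1]) auto
    ultimately show ?thesis by blast
  qed
  have abs: "\<bar>r\<bar> \<le> C * norm x" if "(x, r) \<in> M" for x r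
  proof -
    have "(-x, -r) \<in> M" using subspace_scale[OF M that, of "-1"] by simp
    then show ?thesis using bM that by (fastforce simp: abs_le_iff)
  qed
  \<comment> \<open>The one-sided bound, used for \<open>(x, r)\<close> and \<open>(-x, -r)\<close>,
    controls the absolute value; over the zero vector it forces the value 0, so the maximal subspace
    is single-valued, that is, a graph.\<close>
  have uniq: "r = s" if "(x, r) \<in> M" "(x, s) \<in> M" for x r s
    using abs[of 0 "r - s"] subspace_diff[OF M that] by simp
  define f where "f x = (SOME r. (x, r) \<in> M)" for x
  have fM: "(x, f x) \<in> M" for x
    unfolding f_def by (rule someI_ex) (rule ex)
  have "bounded_linear f"
  proof (rule bounded_linear_intro)
    show "f (x + y) = f x + f y" for x y
      using uniq[OF fM] subspace_add[OF M fM[of x] fM[of y]] by simp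
    show "f (c *\<^sub>R x) = c *\<^sub>R f x" for c x
      using uniq[OF fM] subspace_scale[OF M fM[of x], of c] by simp
    show "norm (f x) \<le> norm x * C" for x
      using abs[OF fM] by (simp add: mult.commute)
  qed
  then have app: "blinfun_apply (Blinfun f) = f" by (rule bounded_linear_Blinfun_apply)
  show ?thesis
  proof
    show "norm (Blinfun f) \<le> C"
      using C abs[OF fM] by (intro norm_blinfun_bound) (auto simp: app)
    show "blinfun_apply (Blinfun f) x = r" if "(x, r) \<in> G" for x r
      using uniq[OF fM, of x r] that GM by (auto simp: app)
  qed
qed

text \<open>Hahn-Banach on the line through \<open>x\<close>, with \<open>c *\<^sub>R x\<close> sent
  to \<open>c * norm x\<close>. In the graph encoding the case \<open>x = 0\<close> needs no
  separate treatment: the graph is then the zero subspace.\<close>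

lemma norming_functional:
  fixes x :: "'a::real_normed_vector"
  obtains l :: "'a \<Rightarrow>\<^sub>L real" where "norm l \<le> 1" "blinfun_apply l x = norm x"
proof -
  define G where "G = range (\<lambda>c::real. c *\<^sub>R (x, norm x))"
  have "subspace G"
    unfolding G_def using subspace_span[of "{(x, norm x)}"] span_singleton by metis
  moreover have "r \<le> 1 * norm y" if "(y, r) \<in> G" for y r
    using that by (auto simp: G_def mult_right_mono)
  ultimately obtain l :: "'a \<Rightarrow>\<^sub>L real" where "norm l \<le> 1" "\<And>y r. (y, r) \<in> G \<Longrightarrow> blinfun_apply l y = r"
    using hahn_banach_graph[of G 1] by auto
  moreover have "(x, norm x) \<in> G" unfolding G_def by (rule image_eqI[of _ _ 1]) auto
  ultimately show ?thesis using that by blast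
qed

text \<open>Take \<open>x\<close> at distance at least \<open>e\<close> from the span. On the span
  enlarged by \<open>x\<close>, the functional that reads off the coefficient \<open>c\<close> of
  \<open>x\<close> is bounded by \<open>1 / e\<close>, because \<open>w + c *\<^sub>R x\<close> has
  norm at least \<open>e * \<bar>c\<bar>\<close>. Its extension vanishes on \<open>B\<close> and
  takes the value 1 at \<open>x\<close>.\<close>

lemma annihilating_functional:
  fixes B :: "'a::real_normed_vector set"
  assumes "closure (span B) \<noteq> UNIV"
  obtains l :: "'a \<Rightarrow>\<^sub>L real" where "l \<noteq> 0" "\<And>x. x \<in> B \<Longrightarrow> blinfun_apply l x = 0"
proof -
  obtain x where x: "x \<notin> closure (span B)" using assms by auto
  then obtain e where e: "0 < e" and far: "\<And>w. w \<in> span B \<Longrightarrow> e \<le> dist w x"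
    by (auto simp: closure_approachable not_less)
  define G where "G = {(w + c *\<^sub>R x, c) | w c. w \<in> span B}"
  have "subspace G"
  proof (rule subspaceI)
    show "0 \<in> G"
      unfolding G_def zero_prod_def by (intro CollectI exI[of _ 0]) (auto simp: span_zero)
  next
    fix p q assume "p \<in> G" "q \<in> G"
    then obtain u c u' c' where "p = (u + c *\<^sub>R x, c)" "u \<in> span B" "q = (u' + c' *\<^sub>R x, c')" "u' \<in> span B"
      by (auto simp: G_def)
    then show "p + q \<in> G"
      unfolding G_def by (intro CollectI exI[of _ "u + u'"] exI[of _ "c + c'"]) (auto simp: algebra_simps span_add)
  next
    fix k p assume "p \<in> G"
    then obtain u c where "p = (u + c *\<^sub>R x, c)" "u \<in> span B"
      by (auto simp: G_def)
    then show "k *\<^sub>R p \<in> G"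
      unfolding G_def by (intro CollectI exI[of _ "k *\<^sub>R u"] exI[of _ "k * c"]) (auto simp: algebra_simps span_scale)
  qed
  moreover have "r \<le> (1 / e) * norm y" if yr: "(y, r) \<in> G" for y r
  proof (cases "r = 0")
    case True then show ?thesis using e by auto
  next
    case False
    obtain w where w: "w \<in> span B" "y = w + r *\<^sub>R x" using yr by (auto simp: G_def)
    have "e \<le> dist ((-(1 / r)) *\<^sub>R w) x" by (intro far span_scale w)
    also have "(-(1 / r)) *\<^sub>R w - x = (-(1 / r)) *\<^sub>R y"
      using False by (simp add: w algebra_simps)
    then have "dist ((-(1 / r)) *\<^sub>R w) x = norm ((-(1 / r)) *\<^sub>R y)"
      by (simp only: dist_norm)
    also have "\<dots> = norm y / \<bar>r\<bar>" by simp
    finally have "e * \<bar>r\<bar> \<le> norm y" using False by (simp add: field_simps)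
    then have "e * r \<le> norm y"
      using e by (smt (verit) mult_left_mono)
    then show ?thesis using e by (simp add: field_simps)
  qed
  moreover have "0 \<le> 1 / e" using e by simp
  ultimately obtain l :: "'a \<Rightarrow>\<^sub>L real" where l: "\<And>y r. (y, r) \<in> G \<Longrightarrow> blinfun_apply l y = r"
    using hahn_banach_graph[of G "1 / e"] by metis
  have "(0 + 1 *\<^sub>R x, 1) \<in> G" unfolding G_def using span_zero by blast
  then have "blinfun_apply l x = 1" using l by auto
  then have "l \<noteq> 0" by auto
  moreover have "blinfun_apply l y = 0" if "y \<in> B" for y
  proof (rule l)
    show "(y, 0) \<in> G"
      unfolding G_def using that by (intro CollectI exI[of _ y] exI[of _ 0]) (auto simp: span_base)
  qed
  ultimately show ?thesis using that by blast
qed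

text \<open>A nonzero real subspace is uncountable. Rational combinations are the linear structure
  that a countable dense set can carry, so that countably many almost everywhere identities share a
  single exceptional null set.\<close>

definition rational_subspace :: "'a::real_normed_vector set \<Rightarrow> bool" where
  "rational_subspace P \<longleftrightarrow> 0 \<in> P \<and> (\<forall>x\<in>P. \<forall>y\<in>P. x + y \<in> P) \<and> (\<forall>c\<in>\<rat>. \<forall>x\<in>P. c *\<^sub>R x \<in> P)"

lemma rational_sequence:
  fixes c :: real
  obtains q where "range q \<subseteq> \<rat>" "q \<longlonglongrightarrow> c"
proof -
  have "c \<in> closure \<rat>" by (simp add: Rats_closure_real)
  then obtain q where "\<forall>n. q n \<in> \<rat>" "q \<longlonglongrightarrow> c" unfolding closure_sequential by blast
  then show ?thesis using that[of q] by auto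
qed

text \<open>\<open>P\<close> consists of the finite rational combinations of \<open>B\<close>;
  encoding them by lists of pairs makes countability immediate. The closure of \<open>P\<close> is a
  real subspace, since real scalars are limits of rational ones, and hence contains the span of
  \<open>B\<close>.\<close>

lemma countable_dense_rational_subspace:
  fixes B :: "'a::real_normed_vector set"
  assumes "countable B" "closure (span B) = UNIV"
  obtains P :: "'a set" where "countable P" "closure P = UNIV" "rational_subspace P"
proof -
  define S where "S xs = (\<Sum>(c, b)\<leftarrow>xs. c *\<^sub>R b)" for xs :: "(real \<times> 'a) list"
  define P where "P = S ` lists (\<rat> \<times> B)"
  have cP: "countable P"
    unfolding P_def using assms by (intro countable_image countable_lists countable_SIGMA countable_rat)
  have S_scale: "S (map (\<lambda>(d, b). (c * d, b)) xs) = c *\<^sub>R S xs" for c :: real and xs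
    by (induction xs) (auto simp: S_def algebra_simps)
  have P: "rational_subspace P"
    unfolding rational_subspace_def
  proof (intro conjI ballI)
    show "0 \<in> P" unfolding P_def by (rule image_eqI[of _ _ "[]"]) (auto simp: S_def)
  next
    fix x y assume "x \<in> P" "y \<in> P"
    then obtain xs ys where "x = S xs" "y = S ys" "xs \<in> lists (\<rat> \<times> B)" "ys \<in> lists (\<rat> \<times> B)"
      by (auto simp: P_def)
    then show "x + y \<in> P"
      unfolding P_def by (intro image_eqI[of _ _ "xs @ ys"]) (auto simp: S_def)
  next
    fix c :: real and x assume "c \<in> \<rat>" "x \<in> P"
    then obtain xs where "x = S xs" "xs \<in> lists (\<rat> \<times> B)"
      by (auto simp: P_def)
    then show "c *\<^sub>R x \<in> P"
      unfolding P_def using \<open>c \<in> \<rat>\<close>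
      by (intro image_eqI[of _ _ "map (\<lambda>(d, b). (c * d, b)) xs"]) (force simp: S_scale)+
  qed
  have "B \<subseteq> P"
  proof
    fix b assume "b \<in> B"
    then show "b \<in> P"
      unfolding P_def by (intro image_eqI[of _ _ "[(1, b)]"]) (auto simp: S_def)
  qed
  have "subspace (closure P)"
  proof (rule subspaceI)
    show "0 \<in> closure P" using P closure_subset by (auto simp: rational_subspace_def)
  next
    fix x y assume "x \<in> closure P" "y \<in> closure P"
    then obtain f g where "\<And>n. f n \<in> P" "f \<longlonglongrightarrow> x" "\<And>n. g n \<in> P" "g \<longlonglongrightarrow> y"
      unfolding closure_sequential by blast
    then show "x + y \<in> closure P"
      unfolding closure_sequential using P
      by (intro exI[of _ "\<lambda>n. f n + g n"]) (auto simp: rational_subspace_def intro: tendsto_add)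
  next
    fix c :: real and x assume "x \<in> closure P"
    then obtain f where "\<And>n. f n \<in> P" "f \<longlonglongrightarrow> x"
      unfolding closure_sequential by blast
    moreover obtain q where "range q \<subseteq> \<rat>" "q \<longlonglongrightarrow> c" by (rule rational_sequence)
    ultimately show "c *\<^sub>R x \<in> closure P"
      unfolding closure_sequential using P
      by (intro exI[of _ "\<lambda>n. q n *\<^sub>R f n"]) (auto simp: rational_subspace_def image_subset_iff intro: tendsto_scaleR)
  qed
  then have "span B \<subseteq> closure P"
    using \<open>B \<subseteq> P\<close> closure_subset by (intro span_minimal) auto
  then have "closure (span B) \<subseteq> closure P" by (simp add: closure_minimal)
  then have cl: "closure P = UNIV" using assms by auto
  show ?thesis using cP cl P by (rule that)
qed

text \<open>Differences of elements of \<open>P\<close> stay in \<open>P\<close>, so the bound makes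
  \<open>f\<close> Lipschitz there and \<open>f\<close> extends continuously to the closure.
  Linearity and the bound pass to the limit, with real scalars approximated by rational sequences.
  As \<open>m\<close> carries no sign condition, the Lipschitz constant uses
  \<open>\<bar>m\<bar>\<close>.\<close>

lemma extend_rational_functional:
  fixes P :: "'a::real_normed_vector set" and f :: "'a \<Rightarrow> real"
  assumes dense: "closure P = UNIV" and P: "rational_subspace P"
    and add: "\<And>x y. x \<in> P \<Longrightarrow> y \<in> P \<Longrightarrow> f (x + y) = f x + f y"
    and scale: "\<And>c x. c \<in> \<rat> \<Longrightarrow> x \<in> P \<Longrightarrow> f (c *\<^sub>R x) = c * f x"
    and bd: "\<And>x. x \<in> P \<Longrightarrow> \<bar>f x\<bar> \<le> m * norm x"
  obtains l :: "'a \<Rightarrow>\<^sub>L real" where "\<And>x. x \<in> P \<Longrightarrow> blinfun_apply l x = f x"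
proof -
  have diff: "\<bar>f x - f y\<bar> \<le> \<bar>m\<bar> * norm (x - y)" if "x \<in> P" "y \<in> P" for x y
  proof -
    have m: "(-1) *\<^sub>R y \<in> P" using P that unfolding rational_subspace_def by (metis Rats_1 Rats_minus_iff)
    then have "x + (-1) *\<^sub>R y \<in> P" using P that by (auto simp: rational_subspace_def)
    moreover have "f (x + (-1) *\<^sub>R y) = f x - f y"
      using add[OF that(1) m] scale[of "-1" y] that by simp
    ultimately have "\<bar>f x - f y\<bar> \<le> m * norm (x - y)"
      using bd[of "x + (-1) *\<^sub>R y"] by simp
    also have "\<dots> \<le> \<bar>m\<bar> * norm (x - y)" by (intro mult_right_mono) auto
    finally show ?thesis .
  qed
  have "(\<bar>m\<bar> + 1)-lipschitz_on P f"
  proof (rule lipschitz_onI)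
    fix x y assume "x \<in> P" "y \<in> P"
    then show "dist (f x) (f y) \<le> (\<bar>m\<bar> + 1) * dist x y"
      using diff[of x y] by (simp add: dist_norm algebra_simps) (smt (verit) norm_ge_zero)
  qed auto
  then have "uniformly_continuous_on P f" by (rule lipschitz_on_uniformly_continuous)
  then obtain g where "uniformly_continuous_on (closure P) g" and fg: "\<And>x. x \<in> P \<Longrightarrow> f x = g x"
    using uniformly_continuous_on_extension_on_closure by metis
  then have cont: "continuous_on UNIV g" using dense uniformly_continuous_imp_continuous by auto
  have lim: "(\<lambda>n. g (s n)) \<longlonglongrightarrow> g x" if "s \<longlonglongrightarrow> x" for s x
    by (rule continuous_on_tendsto_compose[OF cont that]) auto
  have seq: "\<exists>s. (\<forall>n. s n \<in> P) \<and> s \<longlonglongrightarrow> x" for x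
    using dense unfolding closure_sequential[symmetric] by auto
  have "bounded_linear g"
  proof (rule bounded_linear_intro)
    fix x y
    obtain s t where s: "\<And>n. s n \<in> P" "s \<longlonglongrightarrow> x" and t: "\<And>n. t n \<in> P" "t \<longlonglongrightarrow> y" using seq by metis
    have "(\<lambda>n. g (s n + t n)) \<longlonglongrightarrow> g (x + y)" by (intro lim tendsto_add s t)
    moreover have "(\<lambda>n. g (s n) + g (t n)) \<longlonglongrightarrow> g x + g y" by (intro lim tendsto_add s t)
    moreover have "g (s n + t n) = g (s n) + g (t n)" for n
      using add[OF s(1)[of n] t(1)[of n]] fg[of "s n"] fg[of "t n"] fg[of "s n + t n"] s(1)[of n] t(1)[of n] P
      unfolding rational_subspace_def by metis
    ultimately show "g (x + y) = g x + g y" by (simp only:) (rule LIMSEQ_unique)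
  next
    fix c :: real and x
    obtain s where s: "\<And>n. s n \<in> P" "s \<longlonglongrightarrow> x" using seq by metis
    obtain q where q: "range q \<subseteq> \<rat>" "q \<longlonglongrightarrow> c" by (rule rational_sequence)
    have "(\<lambda>n. g (q n *\<^sub>R s n)) \<longlonglongrightarrow> g (c *\<^sub>R x)" by (intro lim tendsto_scaleR s q)
    moreover have "(\<lambda>n. q n * g (s n)) \<longlonglongrightarrow> c * g x" by (intro lim tendsto_mult s q)
    moreover have "g (q n *\<^sub>R s n) = q n * g (s n)" for n
      using scale[of "q n" "s n"] fg[of "s n"] fg[of "q n *\<^sub>R s n"] s(1)[of n] q(1) P
      unfolding rational_subspace_def by (metis rangeI subsetD)
    ultimately show "g (c *\<^sub>R x) = c *\<^sub>R g x" by (simp only: real_scaleR_def) (rule LIMSEQ_unique)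
  next
    fix x
    obtain s where s: "\<And>n. s n \<in> P" "s \<longlonglongrightarrow> x" using seq by metis
    have "(\<lambda>n. \<bar>g (s n)\<bar>) \<longlonglongrightarrow> \<bar>g x\<bar>" by (intro tendsto_rabs lim s)
    moreover have "(\<lambda>n. norm (s n) * m) \<longlonglongrightarrow> norm x * m" by (intro tendsto_intros s)
    moreover have "\<bar>g (s n)\<bar> \<le> norm (s n) * m" for n using bd[OF s(1)[of n]] fg[OF s(1)[of n]] by (simp add: mult.commute)
    ultimately show "norm (g x) \<le> norm x * m" unfolding real_norm_def by (intro LIMSEQ_le) auto
  qed
  then show ?thesis using that[of "Blinfun g"] fg by (simp add: bounded_linear_Blinfun_apply)
qed

text \<open>To each functional in \<open>D\<close> assign a vector of the unit ball at which it
  attains at least half its norm. A functional that vanishes at all these vectors is approximated by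
  members \<open>k\<close> of \<open>D\<close> with \<open>norm k \<le> 2 * norm (k - l)\<close>,
  hence is zero, and \<open>annihilating_functional\<close> turns this into density of the
  span.\<close>

lemma separable_predual:
  fixes D :: "('a::real_normed_vector \<Rightarrow>\<^sub>L real) set"
  assumes "countable D" "closure D = UNIV"
  obtains B :: "'a set" where "countable B" "closure (span B) = UNIV"
proof -
  have "\<exists>x::'a. norm x \<le> 1 \<and> norm l \<le> 2 * \<bar>blinfun_apply l x\<bar>" for l :: "'a \<Rightarrow>\<^sub>L real"
  proof (rule ccontr)
    assume "\<not> ?thesis"
    then have small: "2 * \<bar>blinfun_apply l x\<bar> < norm l" if "norm x \<le> 1" for x
      using that by (meson not_le)
    have pos: "0 < norm l" using small[of 0] by simp
    have "norm l \<le> norm l / 2"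
    proof (rule norm_blinfun_bound)
      fix x :: 'a
      show "norm (blinfun_apply l x) \<le> norm l / 2 * norm x"
      proof (cases "x = 0")
        case False
        then have "2 * \<bar>blinfun_apply l ((1 / norm x) *\<^sub>R x)\<bar> < norm l" by (intro small) auto
        then show ?thesis using False by (simp add: blinfun.scaleR_right field_simps)
      qed auto
    qed (use pos in auto)
    then show False using pos by auto
  qed
  then obtain p where p: "\<And>l :: 'a \<Rightarrow>\<^sub>L real. norm (p l) \<le> 1" "\<And>l. norm l \<le> 2 * \<bar>blinfun_apply l (p l)\<bar>"
    by metis
  have "closure (span (p ` D)) = UNIV"
  proof (rule ccontr)
    assume "closure (span (p ` D)) \<noteq> UNIV"
    then obtain l :: "'a \<Rightarrow>\<^sub>L real" where l: "l \<noteq> 0" "\<And>x. x \<in> p ` D \<Longrightarrow> blinfun_apply l x = 0"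
      using annihilating_functional by blast
    have "l \<in> closure D" using assms by auto
    then obtain k where k: "k \<in> D" "dist k l < norm l / 4"
      using l(1) unfolding closure_approachable by (metis divide_pos_pos zero_less_norm_iff zero_less_numeral)
    have "blinfun_apply l (p k) = 0" using l(2) k(1) by simp
    then have "\<bar>blinfun_apply k (p k)\<bar> = norm (blinfun_apply (k - l) (p k))"
      by (simp add: blinfun.diff_left)
    also have "\<dots> \<le> norm (k - l) * norm (p k)" by (rule norm_blinfun)
    also have "\<dots> \<le> norm (k - l)" using p(1)[of k] by (simp add: mult_left_le)
    finally have "norm k \<le> 2 * norm (k - l)" using p(2)[of k] by simp
    moreover have "norm l \<le> norm k + norm (k - l)" by (metis norm_minus_commute norm_triangle_sub)
    ultimately show False using k(2) by (simp add: dist_norm) (smt (verit) norm_ge_zero)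
  qed
  then show ?thesis using that[of "p ` D"] assms(1) by auto
qed

text \<open>For countable \<open>P\<close> this turns a condition on an operator norm into countably
  many scalar inequalities, which is how norms of functional-valued maps are shown to be
  measurable.\<close>

lemma norm_blinfun_le_iff_dense:
  fixes l :: "'a::real_normed_vector \<Rightarrow>\<^sub>L real"
  assumes "closure P = UNIV" "0 \<le> c"
  shows "norm l \<le> c \<longleftrightarrow> (\<forall>x\<in>P. \<bar>blinfun_apply l x\<bar> \<le> c * norm x)"
proof
  assume "norm l \<le> c"
  then show "\<forall>x\<in>P. \<bar>blinfun_apply l x\<bar> \<le> c * norm x"
    using norm_blinfun[of l] by (metis mult_right_mono norm_ge_zero order_trans real_norm_def)
next
  assume *: "\<forall>x\<in>P. \<bar>blinfun_apply l x\<bar> \<le> c * norm x"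
  show "norm l \<le> c"
  proof (rule norm_blinfun_bound[OF assms(2)])
    fix x
    have "closed {x. norm (blinfun_apply l x) \<le> c * norm x}"
      by (intro closed_Collect_le continuous_intros)
    then have "closure P \<subseteq> {x. norm (blinfun_apply l x) \<le> c * norm x}"
      using * by (intro closure_minimal) auto
    then show "norm (blinfun_apply l x) \<le> c * norm x" using assms(1) by auto
  qed
qed

section \<open>Strong measurability and square-integrable functions\<close>

text \<open>Composing simple functions with an arbitrary \<open>h\<close> again gives simple
  functions, so joint sequential continuity of \<open>h\<close> is all that the passage to the limit
  requires.\<close>

lemma strongly_measurable_compose2:
  assumes f: "strongly_measurable M f" and g: "strongly_measurable M g"
    and h: "\<And>u x w y. u \<longlonglongrightarrow> x \<Longrightarrow> w \<longlonglongrightarrow> y \<Longrightarrow> (\<lambda>n::nat. h (u n) (w n)) \<longlonglongrightarrow> h x y"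
  shows "strongly_measurable M (\<lambda>t. h (f t) (g t))"
proof -
  obtain u w where u: "\<And>i. simple_function M (u i)" "AE t in M. (\<lambda>i::nat. u i t) \<longlonglongrightarrow> f t"
    and w: "\<And>i. simple_function M (w i)" "AE t in M. (\<lambda>i::nat. w i t) \<longlonglongrightarrow> g t"
    using f g by (auto simp: strongly_measurable_def)
  have "simple_function M (\<lambda>t. h (u i t) (w i t))" for i
    by (rule simple_function_compose2[OF u(1) w(1)])
  moreover have "AE t in M. (\<lambda>i. h (u i t) (w i t)) \<longlonglongrightarrow> h (f t) (g t)"
    using u(2) w(2) by eventually_elim (rule h)
  ultimately show ?thesis
    unfolding strongly_measurable_def by (intro exI[of _ "\<lambda>i t. h (u i t) (w i t)"]) simp
qed

lemma strongly_measurable_simple: "simple_function M f \<Longrightarrow> strongly_measurable M f"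
  unfolding strongly_measurable_def by (intro exI[of _ "\<lambda>_. f"]) auto

lemma strongly_measurable_const: "strongly_measurable M (\<lambda>_. c)"
  by (intro strongly_measurable_simple simple_function_const)

lemma strongly_measurable_compose:
  assumes "strongly_measurable M f" and "\<And>u x. u \<longlonglongrightarrow> x \<Longrightarrow> (\<lambda>n::nat. h (u n)) \<longlonglongrightarrow> h x"
  shows "strongly_measurable M (\<lambda>t. h (f t))"
  using strongly_measurable_compose2[OF assms(1) assms(1), of "\<lambda>x _. h x"] assms(2) by blast

lemma strongly_measurable_scaleR:
  "strongly_measurable M f \<Longrightarrow> strongly_measurable M g \<Longrightarrow> strongly_measurable M (\<lambda>t. f t *\<^sub>R g t :: 'b::real_normed_vector)"
  by (erule (1) strongly_measurable_compose2) (rule tendsto_scaleR)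

lemma strongly_measurable_add:
  "strongly_measurable M f \<Longrightarrow> strongly_measurable M g \<Longrightarrow> strongly_measurable M (\<lambda>t. f t + g t :: 'b::real_normed_vector)"
  by (erule (1) strongly_measurable_compose2) (rule tendsto_add)

lemma strongly_measurable_diff:
  "strongly_measurable M f \<Longrightarrow> strongly_measurable M g \<Longrightarrow> strongly_measurable M (\<lambda>t. f t - g t :: 'b::real_normed_vector)"
  by (erule (1) strongly_measurable_compose2) (rule tendsto_diff)

lemma strongly_measurable_blinfun:
  "strongly_measurable M f \<Longrightarrow> strongly_measurable M g \<Longrightarrow>
   strongly_measurable M (\<lambda>t. blinfun_apply (f t) (g t) :: 'b::real_normed_vector)"
  by (erule (1) strongly_measurable_compose2) (rule blinfun.tendsto)

lemma strongly_measurable_norm: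
  "strongly_measurable M f \<Longrightarrow> strongly_measurable M (\<lambda>t. norm (f t))"
  by (erule strongly_measurable_compose) (rule tendsto_norm)

lemma borel_measurable_imp_strongly_measurable:
  fixes f :: "'s \<Rightarrow> 'b::{metric_space, second_countable_topology}"
  assumes "f \<in> borel_measurable M" shows "strongly_measurable M f"
proof -
  obtain s where "\<And>i. simple_function M (s i)" "\<And>x. x \<in> space M \<Longrightarrow> (\<lambda>i. s i x) \<longlonglongrightarrow> f x"
    using borel_measurable_implies_sequence_metric[OF assms, of undefined] by blast
  then show ?thesis unfolding strongly_measurable_def by (intro exI[of _ s]) auto
qed

lemma (in complete_measure) borel_measurable_AE_eq:
  fixes f g :: "'a \<Rightarrow> 'b::topological_space"
  assumes f: "f \<in> borel_measurable M" and eq: "AE x in M. f x = g x"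
  shows "g \<in> borel_measurable M"
proof (rule measurableI)
  fix A :: "'b set" assume A: "A \<in> sets borel"
  show "g -` A \<inter> space M \<in> sets M"
  proof (rule in_sets_AE)
    show "AE x in M. x \<in> f -` A \<inter> space M \<longleftrightarrow> x \<in> g -` A \<inter> space M"
      using eq by eventually_elim auto
    show "f -` A \<inter> space M \<in> sets M" using f A by (rule measurable_sets)
  qed auto
qed auto

lemma (in complete_measure) borel_measurable_AE_LIMSEQ:
  fixes f :: "'a \<Rightarrow> 'b::metric_space"
  assumes s: "\<And>i. s i \<in> borel_measurable M" and lim: "AE t in M. (\<lambda>i::nat. s i t) \<longlonglongrightarrow> f t"
  shows "f \<in> borel_measurable M"
proof -
  from lim obtain N where N: "N \<in> null_sets M" "{t \<in> space M. \<not> (\<lambda>i::nat. s i t) \<longlonglongrightarrow> f t} \<subseteq> N"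
    by (auto elim!: AE_E simp: null_sets_def)
  \<comment> \<open>An abstract metric space has no zero, so \<open>undefined\<close> serves as the
    common value of the limit and of all approximants on the exceptional set.\<close>
  define g where "g t = (if t \<in> N then undefined else f t)" for t
  define r where "r i t = (if t \<in> N then undefined else s i t)" for i t
  have "g \<in> borel_measurable M"
  proof (rule borel_measurable_LIMSEQ_metric)
    fix i
    have "N \<inter> space M \<in> sets M" using N(1) by auto
    then show "r i \<in> borel_measurable M"
      unfolding r_def[abs_def] by (intro measurable_If_set s) auto
  next
    fix t assume "t \<in> space M"
    then show "(\<lambda>i. r i t) \<longlonglongrightarrow> g t" using N(2) by (auto simp: r_def g_def)
  qed
  moreover have "AE t in M. g t = f t"
    using AE_not_in[OF N(1)] by eventually_elim (simp add: g_def)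
  ultimately show ?thesis by (rule borel_measurable_AE_eq)
qed

lemma (in complete_measure) strongly_measurable_imp_borel_measurable:
  fixes f :: "'a \<Rightarrow> 'b::metric_space"
  assumes "strongly_measurable M f" shows "f \<in> borel_measurable M"
proof -
  obtain s where s: "\<And>i. simple_function M (s i)" and lim: "AE t in M. (\<lambda>i::nat. s i t) \<longlonglongrightarrow> f t"
    using assms by (auto simp: strongly_measurable_def)
  show ?thesis by (rule borel_measurable_AE_LIMSEQ[OF borel_measurable_simple_function[OF s] lim])
qed

lemma complete_measure_lebesgue_on:
  assumes "S \<in> sets lebesgue" shows "complete_measure (lebesgue_on S)"
proof
  fix A B assume "B \<subseteq> A" "A \<in> null_sets (lebesgue_on S)"
  then have "A \<in> null_sets lebesgue" "A \<subseteq> S" using assms by (auto simp: null_sets_restrict_space)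
  then have "B \<in> null_sets lebesgue" "B \<subseteq> S" using completion.complete2 \<open>B \<subseteq> A\<close> by auto
  then have "B \<in> null_sets (lebesgue_on S)" using assms by (auto simp: null_sets_restrict_space)
  then show "B \<in> sets (lebesgue_on S)" by auto
qed

lemma finite_measure_lebesgue_on:
  assumes "S \<in> lmeasurable" shows "finite_measure (lebesgue_on S)"
proof
  show "emeasure (lebesgue_on S) (space (lebesgue_on S)) \<noteq> \<infinity>"
    using assms by (auto simp: emeasure_restrict_space space_restrict_space fmeasurable_def)
qed

lemma
  fixes f g :: "'a \<Rightarrow> real"
  assumes [measurable]: "f \<in> borel_measurable M" "g \<in> borel_measurable M"
    and f: "integrable M (\<lambda>x. (f x)\<^sup>2)" and g: "integrable M (\<lambda>x. (g x)\<^sup>2)"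
  shows integrable_mult_L2: "integrable M (\<lambda>x. f x * g x)"
    and Cauchy_Schwarz_integral: "\<bar>\<integral>x. f x * g x \<partial>M\<bar> \<le> sqrt (\<integral>x. (f x)\<^sup>2 \<partial>M) * sqrt (\<integral>x. (g x)\<^sup>2 \<partial>M)"
proof -
  have bd: "\<bar>a * b\<bar> \<le> a\<^sup>2 + b\<^sup>2" for a b :: real
  proof -
    have "2 * (\<bar>a\<bar> * \<bar>b\<bar>) \<le> \<bar>a\<bar>\<^sup>2 + \<bar>b\<bar>\<^sup>2" using sum_squares_bound[of "\<bar>a\<bar>" "\<bar>b\<bar>"] by (simp add: mult.assoc)
    moreover have "0 \<le> \<bar>a\<bar> * \<bar>b\<bar>" by simp
    ultimately show ?thesis unfolding abs_mult power2_abs by linarith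
  qed
  show int: "integrable M (\<lambda>x. f x * g x)"
    by (rule Bochner_Integration.integrable_bound[OF Bochner_Integration.integrable_add[OF f g]])
      (use bd in auto)
  have "ennreal ((\<integral>x. \<bar>f x * g x\<bar> \<partial>M)\<^sup>2) = (\<integral>\<^sup>+x. ennreal \<bar>f x\<bar> * ennreal \<bar>g x\<bar> \<partial>M)\<^sup>2"
    using int by (subst ennreal_power[symmetric])
      (auto simp: nn_integral_eq_integral ennreal_mult'[symmetric] abs_mult[symmetric] integrable_abs)
  also have "\<dots> \<le> (\<integral>\<^sup>+x. (ennreal \<bar>f x\<bar>)\<^sup>2 \<partial>M) * (\<integral>\<^sup>+x. (ennreal \<bar>g x\<bar>)\<^sup>2 \<partial>M)"
    by (rule Cauchy_Schwarz_nn_integral) auto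
  also have "\<dots> = ennreal ((\<integral>x. (f x)\<^sup>2 \<partial>M) * (\<integral>x. (g x)\<^sup>2 \<partial>M))"
    by (simp add: ennreal_power nn_integral_eq_integral f g ennreal_mult'')
  finally have "(\<integral>x. \<bar>f x * g x\<bar> \<partial>M)\<^sup>2 \<le> (\<integral>x. (f x)\<^sup>2 \<partial>M) * (\<integral>x. (g x)\<^sup>2 \<partial>M)"
    by (subst (asm) ennreal_le_iff) auto
  then have "(\<integral>x. \<bar>f x * g x\<bar> \<partial>M) \<le> sqrt (\<integral>x. (f x)\<^sup>2 \<partial>M) * sqrt (\<integral>x. (g x)\<^sup>2 \<partial>M)"
    by (metis real_le_rsqrt real_sqrt_mult)
  then show "\<bar>\<integral>x. f x * g x \<partial>M\<bar> \<le> sqrt (\<integral>x. (f x)\<^sup>2 \<partial>M) * sqrt (\<integral>x. (g x)\<^sup>2 \<partial>M)"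
    using integral_abs_bound[of M "\<lambda>x. f x * g x"] by linarith
qed

text \<open>Finiteness puts bounded strongly measurable functions into \<open>L2\<close>;
  completeness keeps almost everywhere limits measurable. Lebesgue measure on a set of finite
  measure has both properties.\<close>

locale finite_complete_measure = finite_measure M + complete_measure M for M :: "'s measure"

lemma finite_complete_measure_lebesgue_on:
  assumes "S \<in> lmeasurable" shows "finite_complete_measure (lebesgue_on S)"
  using assms complete_measure_lebesgue_on[of S] finite_measure_lebesgue_on[of S]
  by (simp add: finite_complete_measure_def fmeasurableD)

section \<open>Calculus of square-integrable functions and their seminorm\<close>

lemma L2_norm_nonneg [simp]: "0 \<le> L2_norm M f"
  by (simp add: L2_norm_def)

lemma L2_norm_power2: "(L2_norm M f)\<^sup>2 = (\<integral>x. (norm (f x))\<^sup>2 \<partial>M)"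
  by (simp add: L2_norm_def)

lemma L2_norm_norm [simp]: "L2_norm M (\<lambda>x. norm (f x)) = L2_norm M f"
  by (simp add: L2_norm_def)

lemma L2_norm_scaleR: "L2_norm M (\<lambda>x. c *\<^sub>R f x) = \<bar>c\<bar> * L2_norm M f"
  by (simp add: L2_norm_def power_mult_distrib real_sqrt_mult)

lemma L2_norm_scaleR_right: "L2_norm M (\<lambda>t. \<phi> t *\<^sub>R x) = norm x * L2_norm M \<phi>" for \<phi> :: "'s \<Rightarrow> real"
  by (simp add: L2_norm_def power_mult_distrib real_sqrt_mult mult.commute)

lemma L2_norm_minus [simp]: "L2_norm M (\<lambda>x. - f x) = L2_norm M f"
  by (simp add: L2_norm_def)

lemma L2_norm_diff_commute: "L2_norm M (\<lambda>x. f x - g x) = L2_norm M (\<lambda>x. g x - f x)"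
  by (simp add: L2_norm_def norm_minus_commute)

lemma L2D: "f \<in> L2 M \<Longrightarrow> strongly_measurable M f" "f \<in> L2 M \<Longrightarrow> integrable M (\<lambda>x. (norm (f x))\<^sup>2)"
  by (simp_all add: L2_def)

lemma L2_zero [simp]: "(\<lambda>_. 0) \<in> L2 M"
  by (simp add: L2_def strongly_measurable_const)

context finite_complete_measure
begin

lemma L2_norm_measurable: "f \<in> L2 M \<Longrightarrow> (\<lambda>x. norm (f x)) \<in> borel_measurable M"
  by (intro strongly_measurable_imp_borel_measurable strongly_measurable_norm L2D)

lemma L2_real_measurable: "f \<in> L2 M \<Longrightarrow> f \<in> borel_measurable M" for f :: "'s \<Rightarrow> real"
  by (intro strongly_measurable_imp_borel_measurable L2D)

lemma L2_realI: "f \<in> borel_measurable M \<Longrightarrow> integrable M (\<lambda>x. (f x)\<^sup>2) \<Longrightarrow> f \<in> L2 M" for f :: "'s \<Rightarrow> real"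
  by (simp add: L2_def borel_measurable_imp_strongly_measurable)

lemma L2_real_integrable: "f \<in> L2 M \<Longrightarrow> integrable M (\<lambda>x. (f x)\<^sup>2)" for f :: "'s \<Rightarrow> real"
  using L2D(2)[of f M] by simp

lemma L2_norm_in_L2: "f \<in> L2 M \<Longrightarrow> (\<lambda>x. norm (f x)) \<in> L2 M"
  by (rule L2_realI[OF L2_norm_measurable L2D(2)])

lemma L2_integrable_norm_mult:
  assumes "f \<in> L2 M" "g \<in> L2 M"
  shows "integrable M (\<lambda>x. norm (f x) * norm (g x))"
    and "(\<integral>x. norm (f x) * norm (g x) \<partial>M) \<le> L2_norm M f * L2_norm M g"
proof -
  show "integrable M (\<lambda>x. norm (f x) * norm (g x))"
    using assms by (intro integrable_mult_L2 L2_norm_measurable) (auto intro: L2D)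
  have "\<bar>\<integral>x. norm (f x) * norm (g x) \<partial>M\<bar> \<le> sqrt (\<integral>x. (norm (f x))\<^sup>2 \<partial>M) * sqrt (\<integral>x. (norm (g x))\<^sup>2 \<partial>M)"
    using assms by (intro Cauchy_Schwarz_integral L2_norm_measurable) (auto intro: L2D)
  then show "(\<integral>x. norm (f x) * norm (g x) \<partial>M) \<le> L2_norm M f * L2_norm M g"
    by (simp add: L2_norm_def)
qed

lemma L2_dominated:
  fixes g :: "'s \<Rightarrow> real"
  assumes f: "strongly_measurable M f" and g: "g \<in> L2 M" and le: "AE x in M. norm (f x) \<le> g x"
  shows "f \<in> L2 M" "L2_norm M f \<le> L2_norm M g"
proof -
  have m: "(\<lambda>x. norm (f x)) \<in> borel_measurable M"
    using f by (intro strongly_measurable_imp_borel_measurable strongly_measurable_norm)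
  have le2: "AE x in M. (norm (f x))\<^sup>2 \<le> (g x)\<^sup>2"
    using le by eventually_elim (intro power_mono, auto)
  have int: "integrable M (\<lambda>x. (norm (f x))\<^sup>2)"
    using le2 m by (intro Bochner_Integration.integrable_bound[OF L2_real_integrable[OF g]]) auto
  show "f \<in> L2 M" using f int by (simp add: L2_def)
  have "(\<integral>x. (norm (f x))\<^sup>2 \<partial>M) \<le> (\<integral>x. (g x)\<^sup>2 \<partial>M)"
    by (intro integral_mono_AE int L2_real_integrable[OF g] le2)
  then show "L2_norm M f \<le> L2_norm M g"
    by (simp add: L2_norm_def)
qed

lemma L2_scaleR: "f \<in> L2 M \<Longrightarrow> (\<lambda>x. c *\<^sub>R f x) \<in> L2 M"
  by (simp add: L2_def power_mult_distrib strongly_measurable_scaleR strongly_measurable_const)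

lemma L2_mult: "f \<in> L2 M \<Longrightarrow> (\<lambda>x. c * f x) \<in> L2 M" for c :: real
  using L2_scaleR[of f c] by simp

lemma L2_uminus: "f \<in> L2 M \<Longrightarrow> (\<lambda>x. - f x) \<in> L2 M"
  using L2_scaleR[of f "-1"] by simp

lemma
  assumes f: "f \<in> L2 M" and g: "g \<in> L2 M"
  shows L2_add: "(\<lambda>x. f x + g x) \<in> L2 M"
    and L2_norm_triangle: "L2_norm M (\<lambda>x. f x + g x) \<le> L2_norm M f + L2_norm M g"
proof -
  have int: "integrable M (\<lambda>x. (norm (f x) + norm (g x))\<^sup>2)"
    using L2_integrable_norm_mult(1)[OF f g] L2D(2)[OF f] L2D(2)[OF g]
    unfolding power2_sum by (simp add: mult.assoc)
  have sg: "(\<lambda>x. norm (f x) + norm (g x)) \<in> L2 M"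
    using int by (intro L2_realI borel_measurable_add L2_norm_measurable f g)
  have sm: "strongly_measurable M (\<lambda>x. f x + g x)"
    using f g by (intro strongly_measurable_add L2D)
  note dom = L2_dominated[OF sm sg]
  show "(\<lambda>x. f x + g x) \<in> L2 M" by (rule dom) (auto intro: norm_triangle_ineq)
  have "(L2_norm M (\<lambda>x. norm (f x) + norm (g x)))\<^sup>2
      = (\<integral>x. (norm (f x))\<^sup>2 + (norm (g x))\<^sup>2 + 2 * (norm (f x) * norm (g x)) \<partial>M)"
    unfolding L2_norm_power2 by (simp add: power2_sum mult.assoc)
  also have "\<dots> = (L2_norm M f)\<^sup>2 + (L2_norm M g)\<^sup>2 + 2 * (\<integral>x. norm (f x) * norm (g x) \<partial>M)"
    using L2_integrable_norm_mult(1)[OF f g] L2D(2)[OF f] L2D(2)[OF g]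
    by (simp add: L2_norm_power2)
  also have "\<dots> \<le> (L2_norm M f + L2_norm M g)\<^sup>2"
    using L2_integrable_norm_mult(2)[OF f g] by (simp add: power2_sum)
  finally have "L2_norm M (\<lambda>x. norm (f x) + norm (g x)) \<le> L2_norm M f + L2_norm M g"
    by (rule power2_le_imp_le) simp
  moreover have "L2_norm M (\<lambda>x. f x + g x) \<le> L2_norm M (\<lambda>x. norm (f x) + norm (g x))"
    by (rule dom) (auto intro: norm_triangle_ineq)
  ultimately show "L2_norm M (\<lambda>x. f x + g x) \<le> L2_norm M f + L2_norm M g" by simp
qed

lemma L2_diff: "f \<in> L2 M \<Longrightarrow> g \<in> L2 M \<Longrightarrow> (\<lambda>x. f x - g x) \<in> L2 M"
  using L2_add[of f "\<lambda>x. - g x"] L2_uminus[of g] by simp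

lemma L2_norm_triangle_diff:
  assumes "f \<in> L2 M" "g \<in> L2 M"
  shows "L2_norm M f \<le> L2_norm M g + L2_norm M (\<lambda>x. f x - g x)"
  using L2_norm_triangle[OF assms(2) L2_diff[OF assms]] by simp

lemma L2_norm_triangle3:
  assumes "f \<in> L2 M" "g \<in> L2 M" "h \<in> L2 M"
  shows "L2_norm M (\<lambda>x. f x - h x) \<le> L2_norm M (\<lambda>x. f x - g x) + L2_norm M (\<lambda>x. g x - h x)"
  using L2_norm_triangle[OF L2_diff[OF assms(1,2)] L2_diff[OF assms(2,3)]] by simp

lemma L2_bounded:
  assumes "strongly_measurable M f" "\<And>x. x \<in> space M \<Longrightarrow> norm (f x) \<le> B"
  shows "f \<in> L2 M"
  by (rule L2_dominated[OF assms(1), of "\<lambda>_. B"]) (use assms in \<open>auto intro!: L2_realI\<close>)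

lemma L2_simple: "simple_function M f \<Longrightarrow> f \<in> L2 M" for f :: "'s \<Rightarrow> 'b::real_normed_vector"
proof -
  assume f: "simple_function M f"
  then have "finite (norm ` f ` space M)" by (intro finite_imageI simple_functionD)
  then have "norm (f x) \<le> Max (insert 0 (norm ` f ` space M))" if "x \<in> space M" for x
    using that by (intro Max_ge) auto
  then show ?thesis by (rule L2_bounded[OF strongly_measurable_simple[OF f]])
qed

lemma L2_scaleR_const: "\<phi> \<in> L2 M \<Longrightarrow> (\<lambda>t. \<phi> t *\<^sub>R x) \<in> L2 M" for \<phi> :: "'s \<Rightarrow> real"
  by (simp add: L2_def power_mult_distrib strongly_measurable_scaleR strongly_measurable_const)

lemma L2_indicator: "A \<in> sets M \<Longrightarrow> indicator A \<in> L2 M" for A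
  by (intro L2_simple simple_function_indicator)

lemma L2_norm_indicator: "A \<in> sets M \<Longrightarrow> L2_norm M (indicator A :: 's \<Rightarrow> real) = sqrt (measure M A)"
proof -
  assume A: "A \<in> sets M"
  have "(\<integral>x. (norm (indicator A x :: real))\<^sup>2 \<partial>M) = (\<integral>x. indicator A x \<partial>M)"
    by (intro Bochner_Integration.integral_cong) (auto simp: indicator_def)
  then show ?thesis using A by (simp add: L2_norm_def)
qed

text \<open>Scalar dominated convergence is applied to the squared norms of the differences, so the
  values may lie in any normed space. The majorant controls the differences, not the functions
  themselves.\<close>

lemma L2_dominated_convergence:
  fixes g :: "'s \<Rightarrow> real"
  assumes f: "\<And>n. strongly_measurable M (f n)" and l: "strongly_measurable M l" and g: "g \<in> L2 M"
    and lim: "AE x in M. (\<lambda>n. f n x) \<longlonglongrightarrow> l x" and le: "\<And>n. AE x in M. norm (f n x - l x) \<le> g x"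
  shows "(\<lambda>n. L2_norm M (\<lambda>x. f n x - l x)) \<longlonglongrightarrow> 0"
proof -
  have m: "(\<lambda>x. norm (f n x - l x)) \<in> borel_measurable M" for n
    using f l by (intro strongly_measurable_imp_borel_measurable strongly_measurable_norm strongly_measurable_diff)
  have "(\<lambda>n. \<integral>x. (norm (f n x - l x))\<^sup>2 \<partial>M) \<longlonglongrightarrow> (\<integral>x. 0 \<partial>M)"
  proof (rule integral_dominated_convergence[OF _ _ L2_real_integrable[OF g]])
    show "AE x in M. (\<lambda>n. (norm (f n x - l x))\<^sup>2) \<longlonglongrightarrow> 0"
      using lim
    proof eventually_elim
      fix x assume "(\<lambda>n. f n x) \<longlonglongrightarrow> l x"
      then have "(\<lambda>n. (norm (f n x - l x))\<^sup>2) \<longlonglongrightarrow> (norm (l x - l x))\<^sup>2" by (intro tendsto_intros)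
      then show "(\<lambda>n. (norm (f n x - l x))\<^sup>2) \<longlonglongrightarrow> 0" by simp
    qed
    show "AE x in M. norm ((norm (f n x - l x))\<^sup>2) \<le> (g x)\<^sup>2" for n
      using le[of n] by eventually_elim (auto intro!: power_mono)
  qed (use m in auto)
  then have "(\<lambda>n. sqrt (\<integral>x. (norm (f n x - l x))\<^sup>2 \<partial>M)) \<longlonglongrightarrow> sqrt 0"
    by (intro tendsto_real_sqrt) simp
  then show ?thesis by (simp add: L2_norm_def)
qed

text \<open>Density of simple functions in the form of an induction rule. Closure under
  approximation in the seminorm also covers almost everywhere equality, as approximation at distance
  zero.\<close>

lemma L2_induct [consumes 1, case_names indicator add approx]:
  fixes f :: "'s \<Rightarrow> 'b::real_normed_vector"
  assumes f: "f \<in> L2 M"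
    and ind: "\<And>A x. A \<in> sets M \<Longrightarrow> P (\<lambda>t. indicator A t *\<^sub>R x)"
    and add: "\<And>f g. f \<in> L2 M \<Longrightarrow> g \<in> L2 M \<Longrightarrow> P f \<Longrightarrow> P g \<Longrightarrow> P (\<lambda>t. f t + g t)"
    and approx: "\<And>f. f \<in> L2 M \<Longrightarrow> (\<And>e. 0 < e \<Longrightarrow> \<exists>g\<in>L2 M. P g \<and> L2_norm M (\<lambda>t. f t - g t) < e) \<Longrightarrow> P f"
  shows "P f"
proof -
  have sum: "P (\<lambda>t. \<Sum>y\<in>F. indicator (A y) t *\<^sub>R y) \<and> (\<lambda>t. \<Sum>y\<in>F. indicator (A y) t *\<^sub>R y) \<in> L2 M"
    if "finite F" "\<And>y. A y \<in> sets M" for F :: "'b set" and A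
    using that(1)
  proof (induction F)
    case empty
    show ?case using ind[of "{}" 0] by simp
  next
    case (insert y F)
    have "(\<lambda>t. \<Sum>y\<in>insert y F. indicator (A y) t *\<^sub>R y)
        = (\<lambda>t. indicator (A y) t *\<^sub>R y + (\<Sum>y\<in>F. indicator (A y) t *\<^sub>R y))"
      using insert(1,2) by (intro ext) (rule sum.insert)
    moreover have "(\<lambda>t. indicator (A y) t *\<^sub>R y) \<in> L2 M"
      by (intro L2_scaleR_const L2_indicator that)
    ultimately show ?case
      using add[OF _ _ ind[OF that(2)]] L2_add insert(3) by (simp only:) blast
  qed
  have simple: "P s" if s: "simple_function M s" for s
  proof (rule approx[OF L2_simple[OF s]])
    fix e :: real assume "0 < e"
    \<comment> \<open>The canonical form of a simple function agrees with it only on the space of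
      the measure, so \<open>P\<close> is carried over to \<open>s\<close> through
      \<open>approx\<close> with distance 0.\<close>
    define r where "r = (\<lambda>t. \<Sum>y\<in>s ` space M. indicator (s -` {y} \<inter> space M) t *\<^sub>R y)"
    have r: "P r \<and> r \<in> L2 M" unfolding r_def using simple_functionD[OF s] by (intro sum) auto
    have "r t = s t" if t: "t \<in> space M" for t
    proof -
      have "r t = (\<Sum>y\<in>s ` space M. if y = s t then y else 0)"
        unfolding r_def using t by (intro sum.cong) (auto simp: indicator_def)
      then show ?thesis using t simple_functionD(1)[OF s] by simp
    qed
    then have "(\<integral>t. (norm (s t - r t))\<^sup>2 \<partial>M) = (\<integral>t. 0 \<partial>M)"
      by (intro Bochner_Integration.integral_cong) auto
    then show "\<exists>g\<in>L2 M. P g \<and> L2_norm M (\<lambda>t. s t - g t) < e"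
      using r \<open>0 < e\<close> by (intro bexI[of _ r]) (auto simp: L2_norm_def)
  qed
  obtain s where s: "\<And>i. simple_function M (s i)" "AE t in M. (\<lambda>i::nat. s i t) \<longlonglongrightarrow> f t"
    using L2D(1)[OF f] by (auto simp: strongly_measurable_def)
  \<comment> \<open>Truncation makes the approximants dominated: \<open>r i\<close> has norm at most
    \<open>2 * norm (f t)\<close>, hence differs from \<open>f\<close> by at most
    \<open>3 * norm (f t)\<close>. Where \<open>f t\<close> is nonzero the condition holds
    eventually because the factor 2 exceeds 1; where it is zero, \<open>r i t\<close> is
    zero.\<close>
  define r where "r i t = (if norm (s i t) \<le> 2 * norm (f t) then s i t else 0)" for i t
  have r: "simple_function M (r i)" for i
    unfolding r_def
  proof (rule simple_function_If[OF s(1) simple_function_const])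
    have [measurable]: "(\<lambda>t. norm (s i t)) \<in> borel_measurable M" "(\<lambda>t. norm (f t)) \<in> borel_measurable M"
      using L2_norm_measurable[OF L2_simple[OF s(1)]] L2_norm_measurable[OF f] by auto
    show "{t \<in> space M. norm (s i t) \<le> 2 * norm (f t)} \<in> sets M" by measurable
  qed
  have "(\<lambda>i. L2_norm M (\<lambda>t. r i t - f t)) \<longlonglongrightarrow> 0"
  proof (rule L2_dominated_convergence)
    show "AE t in M. (\<lambda>i. r i t) \<longlonglongrightarrow> f t"
      using s(2)
    proof eventually_elim
      fix t assume lim: "(\<lambda>i. s i t) \<longlonglongrightarrow> f t"
      show "(\<lambda>i. r i t) \<longlonglongrightarrow> f t"
      proof (cases "f t = 0")
        case True
        then have "r i t = 0" for i by (simp add: r_def)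
        then show ?thesis using True by simp
      next
        case False
        then have "\<forall>\<^sub>F i in sequentially. norm (s i t) < 2 * norm (f t)"
          using tendsto_norm[OF lim] by (intro order_tendstoD(2)) auto
        then have "\<forall>\<^sub>F i in sequentially. r i t = s i t" by eventually_elim (simp add: r_def)
        then show ?thesis using lim by (simp add: tendsto_cong)
      qed
    qed
    show "AE t in M. norm (r i t - f t) \<le> 3 * norm (f t)" for i
    proof (rule AE_I2)
      fix t
      have "norm (r i t) \<le> 2 * norm (f t)" by (simp add: r_def)
      then show "norm (r i t - f t) \<le> 3 * norm (f t)" using norm_triangle_ineq4[of "r i t" "f t"] by linarith
    qed
    show "(\<lambda>t. 3 * norm (f t)) \<in> L2 M" by (intro L2_mult L2_norm_in_L2 f)
  qed (use r f in \<open>auto intro: strongly_measurable_simple L2D\<close>)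
  then show "P f"
  proof (intro approx[OF f])
    fix e :: real assume "0 < e" and *: "(\<lambda>i. L2_norm M (\<lambda>t. r i t - f t)) \<longlonglongrightarrow> 0"
    obtain i where "L2_norm M (\<lambda>t. r i t - f t) < e"
      using order_tendstoD(2)[OF * \<open>0 < e\<close>] by (auto simp: eventually_sequentially)
    then show "\<exists>g\<in>L2 M. P g \<and> L2_norm M (\<lambda>t. f t - g t) < e"
      using simple[OF r] L2_simple[OF r] by (intro bexI[of _ "r i"]) (auto simp: L2_norm_diff_commute)
  qed
qed

section \<open>Pairings and bounded functionals\<close>

lemma
  fixes w :: "'s \<Rightarrow> 'b::real_normed_vector \<Rightarrow>\<^sub>L real"
  assumes w: "w \<in> L2 M" and f: "f \<in> L2 M"
  shows L2_pairing_integrable: "integrable M (\<lambda>t. blinfun_apply (w t) (f t))"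
    and L2_pairing_bound: "\<bar>\<integral>t. blinfun_apply (w t) (f t) \<partial>M\<bar> \<le> L2_norm M w * L2_norm M f"
proof -
  have m: "(\<lambda>t. blinfun_apply (w t) (f t)) \<in> borel_measurable M"
    using w f by (intro strongly_measurable_imp_borel_measurable strongly_measurable_blinfun L2D)
  show int: "integrable M (\<lambda>t. blinfun_apply (w t) (f t))"
    by (rule Bochner_Integration.integrable_bound[OF L2_integrable_norm_mult(1)[OF w f] m])
      (auto intro!: norm_blinfun[of "w _" "f _", unfolded real_norm_def])
  have "\<bar>\<integral>t. blinfun_apply (w t) (f t) \<partial>M\<bar> \<le> (\<integral>t. \<bar>blinfun_apply (w t) (f t)\<bar> \<partial>M)"
    by (rule integral_abs_bound)
  also have "\<dots> \<le> (\<integral>t. norm (w t) * norm (f t) \<partial>M)"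
    using norm_blinfun[of "w _" "f _"] by (intro integral_mono integrable_abs int L2_integrable_norm_mult w f) auto
  also have "\<dots> \<le> L2_norm M w * L2_norm M f" by (rule L2_integrable_norm_mult(2)[OF w f])
  finally show "\<bar>\<integral>t. blinfun_apply (w t) (f t) \<partial>M\<bar> \<le> L2_norm M w * L2_norm M f" .
qed

lemma L2_pairing_dual:
  fixes w :: "'s \<Rightarrow> 'b::real_normed_vector \<Rightarrow>\<^sub>L real"
  assumes w: "w \<in> L2 M"
  shows "(\<lambda>f. \<integral>t. blinfun_apply (w t) (f t) \<partial>M) \<in> L2_dual M"
  unfolding L2_dual_def
proof (intro CollectI conjI ballI allI)
  show "\<exists>C. \<forall>f\<in>L2 M. \<bar>\<integral>t. blinfun_apply (w t) (f t) \<partial>M\<bar> \<le> C * L2_norm M f"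
    using L2_pairing_bound[OF w] by blast
qed (auto simp: blinfun.add_right blinfun.scaleR_right L2_pairing_integrable[OF w])

lemma L2_dual_add: "\<Lambda> \<in> L2_dual M \<Longrightarrow> f \<in> L2 M \<Longrightarrow> g \<in> L2 M \<Longrightarrow> \<Lambda> (\<lambda>x. f x + g x) = \<Lambda> f + \<Lambda> g"
  by (simp add: L2_dual_def)

lemma L2_dual_scaleR: "\<Lambda> \<in> L2_dual M \<Longrightarrow> f \<in> L2 M \<Longrightarrow> \<Lambda> (\<lambda>x. c *\<^sub>R f x) = c * \<Lambda> f"
  by (simp add: L2_dual_def)

lemma L2_dual_bound:
  assumes "\<Lambda> \<in> L2_dual M"
  obtains C where "0 < C" "\<And>f. f \<in> L2 M \<Longrightarrow> \<bar>\<Lambda> f\<bar> \<le> C * L2_norm M f"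
proof -
  obtain C where C: "\<forall>f\<in>L2 M. \<bar>\<Lambda> f\<bar> \<le> C * L2_norm M f"
    using assms by (auto simp: L2_dual_def)
  have "\<bar>\<Lambda> f\<bar> \<le> (\<bar>C\<bar> + 1) * L2_norm M f" if "f \<in> L2 M" for f
  proof -
    have "C * L2_norm M f \<le> (\<bar>C\<bar> + 1) * L2_norm M f" by (intro mult_right_mono) auto
    then show ?thesis using C that by fastforce
  qed
  then show ?thesis using that[of "\<bar>C\<bar> + 1"] by auto
qed

lemma L2_dual_diff:
  assumes "\<Lambda> \<in> L2_dual M" "f \<in> L2 M" "g \<in> L2 M"
  shows "\<Lambda> (\<lambda>x. f x - g x) = \<Lambda> f - \<Lambda> g"
  using L2_dual_add[OF assms(1,2) L2_scaleR[OF assms(3), of "-1"]] L2_dual_scaleR[OF assms(1,3), of "-1"]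
  by simp

lemma L2_dual_eqI:
  assumes L: "\<Lambda> \<in> L2_dual M" "\<Lambda>' \<in> L2_dual M" and f: "f \<in> L2 M"
    and eq: "\<And>A x. A \<in> sets M \<Longrightarrow> \<Lambda> (\<lambda>t. indicator A t *\<^sub>R x) = \<Lambda>' (\<lambda>t. indicator A t *\<^sub>R x)"
  shows "\<Lambda> f = \<Lambda>' f"
  using f
proof (induction rule: L2_induct)
  case (indicator A x)
  then show ?case by (rule eq)
next
  case (add f g)
  then show ?case using L unfolding L2_dual_def by simp
next
  case (approx f)
  obtain C where C: "0 < C" "\<And>f. f \<in> L2 M \<Longrightarrow> \<bar>\<Lambda> f\<bar> \<le> C * L2_norm M f"
    using L2_dual_bound[OF L(1)] by metis
  obtain C' where C': "0 < C'" "\<And>f. f \<in> L2 M \<Longrightarrow> \<bar>\<Lambda>' f\<bar> \<le> C' * L2_norm M f"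
    using L2_dual_bound[OF L(2)] by metis
  have small: "\<bar>\<Lambda> f - \<Lambda>' f\<bar> \<le> e" if e: "0 < e" for e
  proof -
    obtain g where g: "g \<in> L2 M" "\<Lambda> g = \<Lambda>' g" "L2_norm M (\<lambda>t. f t - g t) < e / (C + C')"
      using approx(2)[of "e / (C + C')"] e C(1) C'(1) by auto
    note d = L2_diff[OF approx(1) g(1)]
    have "\<Lambda> f - \<Lambda>' f = \<Lambda> (\<lambda>t. f t - g t) - \<Lambda>' (\<lambda>t. f t - g t)"
      using L2_dual_diff[OF L(1) approx(1) g(1)] L2_dual_diff[OF L(2) approx(1) g(1)] g(2) by simp
    then have "\<bar>\<Lambda> f - \<Lambda>' f\<bar> \<le> (C + C') * L2_norm M (\<lambda>t. f t - g t)"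
      using C(2)[OF d] C'(2)[OF d] by (simp add: algebra_simps)
    also have "\<dots> \<le> (C + C') * (e / (C + C'))"
      using g(3) C(1) C'(1) by (intro mult_left_mono) auto
    finally show ?thesis using C(1) C'(1) by simp
  qed
  have "\<bar>\<Lambda> f - \<Lambda>' f\<bar> \<le> 0" by (rule field_le_epsilon) (use small in simp)
  then show ?case by simp
qed

end

section \<open>The dual of \<open>L\<^sup>2\<close> with values in a separable space\<close>

text \<open>Choosing, among the first points of a dense sequence, one that is nearest to
  \<open>w t\<close> gives a simple function of \<open>t\<close>, and these functions converge to
  \<open>w\<close> everywhere. Measurable distances to the dense points suffice to carry out the
  choice.\<close>

lemma strongly_measurable_separableI:
  fixes w :: "'s \<Rightarrow> 'b::real_normed_vector" and D :: "'b set"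
  assumes D: "countable D" "closure D = UNIV"
    and meas: "\<And>d. d \<in> D \<Longrightarrow> (\<lambda>t. norm (w t - d)) \<in> borel_measurable M"
  shows "strongly_measurable M w"
proof -
  have "D \<noteq> {}" using D(2) by auto
  then have rng: "range (from_nat_into D) = D" using D(1) by (rule range_from_nat_into)
  define d where "d = from_nat_into D"
  have dD: "d n \<in> D" for n using rng by (auto simp: d_def)
  define s where "s = rec_nat (\<lambda>_. d 0) (\<lambda>n sn t. if norm (w t - d (Suc n)) < norm (w t - sn t) then d (Suc n) else sn t)"
  have s0: "s 0 = (\<lambda>_. d 0)" by (simp add: s_def)
  have sS: "s (Suc n) = (\<lambda>t. if norm (w t - d (Suc n)) < norm (w t - s n t) then d (Suc n) else s n t)" for n
    unfolding s_def by simp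
  have s: "simple_function M (s n) \<and> (\<lambda>t. norm (w t - s n t)) \<in> borel_measurable M \<and>
      (\<forall>t. \<forall>j\<le>n. norm (w t - s n t) \<le> norm (w t - d j))" for n
  proof (induction n)
    case 0
    then show ?case by (simp add: s0 meas dD)
  next
    case (Suc n)
    have [measurable]: "(\<lambda>t. norm (w t - d (Suc n))) \<in> borel_measurable M" by (rule meas[OF dD])
    have [measurable]: "(\<lambda>t. norm (w t - s n t)) \<in> borel_measurable M" using Suc by simp
    have "simple_function M (s (Suc n))"
      unfolding sS using Suc by (intro simple_function_If simple_function_const) auto
    moreover have eq: "norm (w t - s (Suc n) t) = min (norm (w t - d (Suc n))) (norm (w t - s n t))" for t
      by (simp add: sS min_def)
    moreover have "(\<lambda>t. norm (w t - s (Suc n) t)) \<in> borel_measurable M"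
      unfolding eq by measurable
    moreover have "norm (w t - s (Suc n) t) \<le> norm (w t - d j)" if "j \<le> Suc n" for t j
      using Suc that unfolding eq le_Suc_eq by (auto simp: min_le_iff_disj)
    ultimately show ?case by blast
  qed
  have "(\<lambda>n. s n t) \<longlonglongrightarrow> w t" for t
  proof (rule metric_LIMSEQ_I)
    fix e :: real assume "0 < e"
    moreover have "w t \<in> closure D" using D by simp
    ultimately obtain y where "y \<in> D" and y: "dist y (w t) < e" unfolding closure_approachable by blast
    from \<open>y \<in> D\<close> obtain j where "y = d j" using rng by (metis d_def rangeE)
    then have j: "norm (w t - d j) < e" using y by (metis dist_norm norm_minus_commute)
    show "\<exists>no. \<forall>n\<ge>no. dist (s n t) (w t) < e"
    proof (intro exI allI impI)
      fix n assume "j \<le> n"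
      then have "norm (w t - s n t) \<le> norm (w t - d j)" using s[of n] by blast
      then show "dist (s n t) (w t) < e" using j by (simp add: dist_norm norm_minus_commute[of "s n t" "w t"])
    qed
  qed
  then show ?thesis
    unfolding strongly_measurable_def using s by (intro exI[of _ s]) auto
qed

section \<open>Completeness and Riesz representation for real-valued functions\<close>

context finite_complete_measure
begin

text \<open>Riesz-Fischer: along a fast subsequence the jumps are summable in the mean, so the
  subsequence converges almost everywhere; Fatou's lemma then bounds the distance of the whole
  sequence from the limit.\<close>

lemma L2_complete:
  fixes f :: "nat \<Rightarrow> 's \<Rightarrow> real"
  assumes f: "\<And>n. f n \<in> L2 M"
    and cauchy: "\<And>e. 0 < e \<Longrightarrow> \<exists>N. \<forall>m\<ge>N. \<forall>n\<ge>N. L2_norm M (\<lambda>x. f m x - f n x) < e"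
  obtains l where "l \<in> L2 M" "(\<lambda>n. L2_norm M (\<lambda>x. f n x - l x)) \<longlonglongrightarrow> 0"
proof -
  have [measurable]: "f n \<in> borel_measurable M" for n by (rule L2_real_measurable[OF f])
  have "\<exists>N. \<forall>m\<ge>N. \<forall>n\<ge>N. L2_norm M (\<lambda>x. f m x - f n x) < (1/2)^k" for k
    by (rule cauchy) simp
  then obtain N where N: "\<And>k m n. N k \<le> m \<Longrightarrow> N k \<le> n \<Longrightarrow> L2_norm M (\<lambda>x. f m x - f n x) < (1/2)^k"
    by metis
  \<comment> \<open>Taking the maximum gives \<open>N j \<le> r k\<close> for all
    \<open>j \<le> k\<close> although \<open>N\<close> need not be monotone; in particular
    \<open>r k\<close> and \<open>r (Suc k)\<close> both lie beyond \<open>N k\<close>.\<close>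
  define r where "r k = Max (N ` {..k})" for k
  have r: "N j \<le> r k" if "j \<le> k" for j k
    unfolding r_def using that by (intro Max_ge) auto
  have one: "integrable M (\<lambda>x. (1::real)\<^sup>2)" by simp
  have step: "(\<integral>\<^sup>+x. ennreal \<bar>f (r (Suc k)) x - f (r k) x\<bar> \<partial>M) \<le> ennreal (sqrt (measure M (space M)) * (1/2)^k)" for k
  proof -
    have d: "(\<lambda>x. f (r (Suc k)) x - f (r k) x) \<in> L2 M" by (intro L2_diff f)
    have m: "(\<lambda>x. \<bar>f (r (Suc k)) x - f (r k) x\<bar>) \<in> borel_measurable M" by measurable
    have i: "integrable M (\<lambda>x. \<bar>f (r (Suc k)) x - f (r k) x\<bar>\<^sup>2)" using L2_real_integrable[OF d] by simp
    have int: "integrable M (\<lambda>x. \<bar>f (r (Suc k)) x - f (r k) x\<bar> * 1)"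
      by (rule integrable_mult_L2[OF m _ i one]) simp
    have "\<bar>\<integral>x. \<bar>f (r (Suc k)) x - f (r k) x\<bar> * 1 \<partial>M\<bar>
        \<le> sqrt (\<integral>x. \<bar>f (r (Suc k)) x - f (r k) x\<bar>\<^sup>2 \<partial>M) * sqrt (\<integral>x. 1\<^sup>2 \<partial>M)"
      by (rule Cauchy_Schwarz_integral[OF m _ i one]) simp
    also have "\<dots> = L2_norm M (\<lambda>x. f (r (Suc k)) x - f (r k) x) * sqrt (measure M (space M))"
      by (simp add: L2_norm_def)
    also have "\<dots> \<le> (1/2)^k * sqrt (measure M (space M))"
      using N[of k "r (Suc k)" "r k"] r by (intro mult_right_mono) auto
    finally show ?thesis
      using int by (simp add: nn_integral_eq_integral ennreal_leI mult.commute)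
  qed
  have "(\<integral>\<^sup>+x. (\<Sum>k. ennreal \<bar>f (r (Suc k)) x - f (r k) x\<bar>) \<partial>M)
      = (\<Sum>k. \<integral>\<^sup>+x. ennreal \<bar>f (r (Suc k)) x - f (r k) x\<bar> \<partial>M)"
    by (rule nn_integral_suminf) simp
  also have "\<dots> \<le> (\<Sum>k. ennreal (sqrt (measure M (space M)) * (1/2)^k))"
    by (intro suminf_le step) auto
  also have "\<dots> = ennreal (\<Sum>k. sqrt (measure M (space M)) * (1/2)^k)"
    by (intro suminf_ennreal2 summable_mult summable_geometric) auto
  also have "\<dots> < \<infinity>" by simp
  finally have "AE x in M. (\<Sum>k. ennreal \<bar>f (r (Suc k)) x - f (r k) x\<bar>) \<noteq> \<infinity>"
    by (intro nn_integral_PInf_AE) auto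
  then have conv: "AE x in M. convergent (\<lambda>k. f (r k) x)"
  proof eventually_elim
    fix x assume "(\<Sum>k. ennreal \<bar>f (r (Suc k)) x - f (r k) x\<bar>) \<noteq> \<infinity>"
    then have "summable (\<lambda>k. \<bar>f (r (Suc k)) x - f (r k) x\<bar>)"
      by (intro summable_suminf_not_top) auto
    then have "summable (\<lambda>k. f (r (Suc k)) x - f (r k) x)"
      by (rule summable_rabs_cancel)
    then have "convergent (\<lambda>n. \<Sum>k<n. f (r (Suc k)) x - f (r k) x)"
      by (simp add: summable_iff_convergent)
    then have "convergent (\<lambda>n. f (r n) x - f (r 0) x)"
      by (simp only: sum_lessThan_telescope[of "\<lambda>k. f (r k) x"])
    then have "convergent (\<lambda>n. (f (r n) x - f (r 0) x) + f (r 0) x)"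
      by (intro convergent_add convergent_const)
    then show "convergent (\<lambda>k. f (r k) x)" by simp
  qed
  define l where "l x = lim (\<lambda>k. f (r k) x)" for x
  have [measurable]: "l \<in> borel_measurable M" unfolding l_def by measurable
  have lim: "AE x in M. (\<lambda>k. f (r k) x) \<longlonglongrightarrow> l x"
    using conv by eventually_elim (simp add: l_def convergent_LIMSEQ_iff)
  \<comment> \<open>\<open>f n - l\<close> is the almost everywhere limit of
    \<open>f n - f (r j)\<close>, whose norms are below \<open>(1/2)^k\<close> once \<open>j\<close>
    reaches \<open>k\<close>; Fatou's lemma transfers this bound.\<close>
  have near: "(\<integral>\<^sup>+x. ennreal ((f n x - l x)\<^sup>2) \<partial>M) \<le> ennreal (((1/2)^k)\<^sup>2)" if n: "N k \<le> n" for n k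
  proof -
    have "(\<integral>\<^sup>+x. ennreal ((f n x - l x)\<^sup>2) \<partial>M) = (\<integral>\<^sup>+x. liminf (\<lambda>j. ennreal ((f n x - f (r j) x)\<^sup>2)) \<partial>M)"
    proof (rule nn_integral_cong_AE)
      show "AE x in M. ennreal ((f n x - l x)\<^sup>2) = liminf (\<lambda>j. ennreal ((f n x - f (r j) x)\<^sup>2))"
        using lim
      proof eventually_elim
        fix x assume "(\<lambda>k. f (r k) x) \<longlonglongrightarrow> l x"
        then have "(\<lambda>j. ennreal ((f n x - f (r j) x)\<^sup>2)) \<longlonglongrightarrow> ennreal ((f n x - l x)\<^sup>2)"
          by (intro tendsto_ennrealI tendsto_intros)
        then show "ennreal ((f n x - l x)\<^sup>2) = liminf (\<lambda>j. ennreal ((f n x - f (r j) x)\<^sup>2))"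
          by (metis lim_imp_Liminf sequentially_bot)
      qed
    qed
    also have "\<dots> \<le> liminf (\<lambda>j. \<integral>\<^sup>+x. ennreal ((f n x - f (r j) x)\<^sup>2) \<partial>M)"
      by (rule nn_integral_liminf) measurable
    also have "\<dots> \<le> ennreal (((1/2)^k)\<^sup>2)"
    proof (rule Liminf_le, simp, rule eventually_sequentiallyI)
      fix j assume "k \<le> j"
      have d: "(\<lambda>x. f n x - f (r j) x) \<in> L2 M" by (intro L2_diff f)
      have "(L2_norm M (\<lambda>x. f n x - f (r j) x))\<^sup>2 \<le> ((1/2)^k)\<^sup>2"
        using N[OF n r[OF \<open>k \<le> j\<close>]] by (intro power_mono) auto
      then show "(\<integral>\<^sup>+x. ennreal ((f n x - f (r j) x)\<^sup>2) \<partial>M) \<le> ennreal (((1/2)^k)\<^sup>2)"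
        using L2_real_integrable[OF d] by (simp add: nn_integral_eq_integral L2_norm_power2 ennreal_leI)
    qed
    finally show ?thesis .
  qed
  have nearL2: "(\<lambda>x. f n x - l x) \<in> L2 M" if n: "N k \<le> n" for n k
    using near[OF n] by (intro L2_realI integrableI_bounded) (auto intro: le_less_trans)
  have nearn: "L2_norm M (\<lambda>x. f n x - l x) \<le> (1/2)^k" if n: "N k \<le> n" for n k
  proof -
    have "ennreal ((L2_norm M (\<lambda>x. f n x - l x))\<^sup>2) \<le> ennreal (((1/2)^k)\<^sup>2)"
      using near[OF n] L2_real_integrable[OF nearL2[OF n]] by (simp add: nn_integral_eq_integral L2_norm_power2)
    then have "(L2_norm M (\<lambda>x. f n x - l x))\<^sup>2 \<le> ((1/2)^k)\<^sup>2"
      by (subst (asm) ennreal_le_iff) auto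
    then show ?thesis by (rule power2_le_imp_le) simp
  qed
  have "(\<lambda>x. f (N 0) x - (f (N 0) x - l x)) \<in> L2 M" by (intro L2_diff f nearL2[of 0]) simp
  then have "l \<in> L2 M" by simp
  moreover have "(\<lambda>n. L2_norm M (\<lambda>x. f n x - l x)) \<longlonglongrightarrow> 0"
  proof (rule LIMSEQ_I)
    fix e :: real assume "0 < e"
    then obtain k where "(1/2)^k < e" using real_arch_pow_inv[of e "1/2"] by auto
    then show "\<exists>no. \<forall>n\<ge>no. norm (L2_norm M (\<lambda>x. f n x - l x) - 0) < e"
      using nearn by (intro exI[of _ "N k"]) (auto intro: le_less_trans)
  qed
  ultimately show ?thesis by (rule that)
qed

lemma L2_norm_add_power2:
  fixes f g :: "'s \<Rightarrow> real"
  assumes "f \<in> L2 M" "g \<in> L2 M"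
  shows "(L2_norm M (\<lambda>x. f x + g x))\<^sup>2 = (L2_norm M f)\<^sup>2 + 2 * (\<integral>x. f x * g x \<partial>M) + (L2_norm M g)\<^sup>2"
proof -
  have "integrable M (\<lambda>x. f x * g x)"
    using assms by (intro integrable_mult_L2 L2_real_measurable L2_real_integrable)
  then have "(\<integral>x. (f x)\<^sup>2 + 2 * (f x * g x) + (g x)\<^sup>2 \<partial>M)
      = (\<integral>x. (f x)\<^sup>2 \<partial>M) + 2 * (\<integral>x. f x * g x \<partial>M) + (\<integral>x. (g x)\<^sup>2 \<partial>M)"
    using L2_real_integrable[OF assms(1)] L2_real_integrable[OF assms(2)] by simp
  then show ?thesis by (simp add: L2_norm_power2 power2_sum algebra_simps)
qed

text \<open>The representing function minimises the quadratic functional \<open>J\<close>. By the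
  parallelogram law minimising sequences are Cauchy, and vanishing of the first variation at the
  minimiser is the representation formula.\<close>

theorem L2_riesz:
  fixes \<Lambda> :: "('s \<Rightarrow> real) \<Rightarrow> real"
  assumes L: "\<Lambda> \<in> L2_dual M"
  obtains h where "h \<in> L2 M" "\<And>\<phi>. \<phi> \<in> L2 M \<Longrightarrow> \<Lambda> \<phi> = (\<integral>x. \<phi> x * h x \<partial>M)"
proof -
  obtain C where C: "0 < C" "\<And>f. f \<in> L2 M \<Longrightarrow> \<bar>\<Lambda> f\<bar> \<le> C * L2_norm M f"
    using L2_dual_bound[OF L] by metis
  define J where "J f = (L2_norm M f)\<^sup>2 - 2 * \<Lambda> f" for f
  have Jlow: "- C\<^sup>2 \<le> J f" if "f \<in> L2 M" for f
  proof -
    have "0 \<le> (L2_norm M f - C)\<^sup>2" by simp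
    then show ?thesis using C(2)[OF that] by (simp add: J_def power2_diff abs_le_iff mult.commute mult.left_commute)
  qed
  define J0 where "J0 = (INF f\<in>L2 M. J f)"
  have bdd: "bdd_below (J ` L2 M)" using Jlow by (intro bdd_belowI2)
  have J0: "J0 \<le> J f" if "f \<in> L2 M" for f unfolding J0_def by (rule cINF_lower[OF bdd that])
  have "\<exists>f\<in>L2 M. J f < J0 + 1 / real (Suc n)" for n
  proof -
    have "J0 < J0 + 1 / real (Suc n)" by simp
    moreover have "L2 M \<noteq> {}" using L2_zero by blast
    ultimately show ?thesis unfolding J0_def by (subst (asm) cINF_less_iff[OF _ bdd]) auto
  qed
  then obtain f where f: "\<And>n. f n \<in> L2 M" "\<And>n. J (f n) < J0 + 1 / real (Suc n)" by metis
  \<comment> \<open>The parallelogram law applied with the midpoint \<open>w\<close> of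
    \<open>u\<close> and \<open>v\<close>: the left-hand side equals
    \<open>2 * J u + 2 * J v - 4 * J w\<close>, and \<open>J w\<close> is at least
    \<open>J0\<close>.\<close>
  have par: "(L2_norm M (\<lambda>x. u x - v x))\<^sup>2 \<le> 2 * (J u - J0) + 2 * (J v - J0)" if u: "u \<in> L2 M" and v: "v \<in> L2 M" for u v
  proof -
    have mid: "(\<lambda>x. (1/2) *\<^sub>R (u x + v x)) \<in> L2 M" by (intro L2_scaleR L2_add u v)
    have "L2_norm M (\<lambda>x. (1/2) *\<^sub>R (u x + v x)) = (1/2) * L2_norm M (\<lambda>x. u x + v x)"
      unfolding L2_norm_scaleR by simp
    moreover have "\<Lambda> (\<lambda>x. (1/2) *\<^sub>R (u x + v x)) = (1/2) * (\<Lambda> u + \<Lambda> v)"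
      using L2_dual_scaleR[OF L L2_add[OF u v], of "1/2"] L2_dual_add[OF L u v] by (simp only:)
    moreover have half: "((1/2) * a)\<^sup>2 - 2 * ((1/2) * b) = a\<^sup>2 / 4 - b" for a b :: real
      by (simp add: power2_eq_square)
    ultimately have "J (\<lambda>x. (1/2) *\<^sub>R (u x + v x)) = (L2_norm M (\<lambda>x. u x + v x))\<^sup>2 / 4 - (\<Lambda> u + \<Lambda> v)"
      unfolding J_def using half by (simp only:)
    moreover have "(L2_norm M (\<lambda>x. u x + - v x))\<^sup>2 = (L2_norm M u)\<^sup>2 + 2 * (\<integral>x. u x * - v x \<partial>M) + (L2_norm M (\<lambda>x. - v x))\<^sup>2"
      by (rule L2_norm_add_power2[OF u L2_uminus[OF v]])
    then have "(L2_norm M (\<lambda>x. u x - v x))\<^sup>2 = (L2_norm M u)\<^sup>2 - 2 * (\<integral>x. u x * v x \<partial>M) + (L2_norm M v)\<^sup>2"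
      by simp
    ultimately show ?thesis
      using L2_norm_add_power2[OF u v] J0[OF mid] unfolding J_def by argo
  qed
  have cauchy: "\<exists>N. \<forall>m\<ge>N. \<forall>n\<ge>N. L2_norm M (\<lambda>x. f m x - f n x) < e" if e: "0 < e" for e
  proof -
    from e obtain n0 where n0: "1 / real (Suc n0) < e\<^sup>2 / 4"
      using reals_Archimedean[of "e\<^sup>2 / 4"] by (auto simp: inverse_eq_divide)
    show ?thesis
    proof (intro exI allI impI)
      fix m n assume "n0 \<le> m" "n0 \<le> n"
      then have "1 / real (Suc m) \<le> 1 / real (Suc n0)" "1 / real (Suc n) \<le> 1 / real (Suc n0)"
        by (simp_all add: frac_le)
      then have "J (f m) - J0 < e\<^sup>2 / 4" "J (f n) - J0 < e\<^sup>2 / 4"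
        using f(2)[of m] f(2)[of n] n0 by linarith+
      then have "(L2_norm M (\<lambda>x. f m x - f n x))\<^sup>2 < e\<^sup>2"
        using par[OF f(1)[of m] f(1)[of n]] by argo
      then show "L2_norm M (\<lambda>x. f m x - f n x) < e" by (rule power2_less_imp_less) (use e in simp)
    qed
  qed
  obtain h where h: "h \<in> L2 M" "(\<lambda>n. L2_norm M (\<lambda>x. f n x - h x)) \<longlonglongrightarrow> 0"
    by (rule L2_complete[OF f(1) cauchy])
  have Jh: "J h \<le> J0"
  proof -
    have "\<bar>L2_norm M (f n) - L2_norm M h\<bar> \<le> L2_norm M (\<lambda>x. f n x - h x)" for n
      using L2_norm_triangle_diff[OF f(1) h(1), of n] L2_norm_triangle_diff[OF h(1) f(1), of n]
        L2_norm_diff_commute[of M h "f n"] by linarith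
    then have "(\<lambda>n. L2_norm M (f n) - L2_norm M h) \<longlonglongrightarrow> 0"
      by (intro Lim_null_comparison[OF _ h(2)]) auto
    then have n: "(\<lambda>n. L2_norm M (f n)) \<longlonglongrightarrow> L2_norm M h" by (rule LIM_zero_cancel)
    have "\<bar>\<Lambda> (f n) - \<Lambda> h\<bar> \<le> C * L2_norm M (\<lambda>x. f n x - h x)" for n
      using C(2)[OF L2_diff[OF f(1) h(1)], of n] L2_dual_diff[OF L f(1) h(1), of n] by simp
    then have "(\<lambda>n. \<Lambda> (f n) - \<Lambda> h) \<longlonglongrightarrow> 0"
      by (intro Lim_null_comparison[OF _ tendsto_mult_right_zero[OF h(2), of C]]) auto
    then have "(\<lambda>n. \<Lambda> (f n)) \<longlonglongrightarrow> \<Lambda> h" by (rule LIM_zero_cancel)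
    then have "(\<lambda>n. J (f n)) \<longlonglongrightarrow> J h" unfolding J_def by (intro tendsto_intros n)
    moreover have "(\<lambda>n. J0 + 1 / real (Suc n)) \<longlonglongrightarrow> J0 + 0"
      by (intro tendsto_add tendsto_const) (use LIMSEQ_inverse_real_of_nat in \<open>simp only: inverse_eq_divide\<close>)
    ultimately have "J h \<le> J0 + 0"
      by (rule LIMSEQ_le) (use f(2) in \<open>meson less_imp_le\<close>)
    then show ?thesis by simp
  qed
  have "\<Lambda> \<phi> = (\<integral>x. \<phi> x * h x \<partial>M)" if p: "\<phi> \<in> L2 M" for \<phi>
  proof -
    define a where "a = (\<integral>x. h x * \<phi> x \<partial>M) - \<Lambda> \<phi>"
    define b where "b = (L2_norm M \<phi>)\<^sup>2"
    have quad: "0 \<le> 2 * t * a + t\<^sup>2 * b" for t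
    proof -
      have tp: "(\<lambda>x. t * \<phi> x) \<in> L2 M" by (rule L2_mult[OF p])
      have "J (\<lambda>x. h x + t * \<phi> x) = J h + 2 * t * a + t\<^sup>2 * b"
        using L2_norm_add_power2[OF h(1) tp] L2_dual_add[OF L h(1) tp] L2_dual_scaleR[OF L p, of t]
          L2_norm_scaleR[of M t \<phi>]
        by (simp add: J_def a_def b_def power_mult_distrib algebra_simps)
      then show ?thesis using Jh J0[OF L2_add[OF h(1) tp]] by simp
    qed
    have b: "0 \<le> b" by (simp add: b_def)
    have "a = 0"
    proof (rule ccontr)
      assume "a \<noteq> 0"
      \<comment> \<open>The optimal step would be \<open>- a / b\<close>; the denominator
        \<open>b + 1\<close> avoids division by zero for a null \<open>\<phi>\<close> and still
        makes the quadratic negative.\<close>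
      have "0 \<le> 2 * (- a / (b + 1)) * a + (- a / (b + 1))\<^sup>2 * b" by (rule quad)
      also have "\<dots> = (a\<^sup>2 / (b + 1)\<^sup>2) * (b - 2 * (b + 1))"
        using b by (simp add: power2_eq_square divide_simps) (simp add: algebra_simps)
      also have "\<dots> < 0" using b \<open>a \<noteq> 0\<close> by (intro mult_pos_neg) auto
      finally show False by simp
    qed
    then show ?thesis by (simp add: a_def mult.commute)
  qed
  then show ?thesis by (rule that[OF h(1)])
qed

end

section \<open>Functionals on vector-valued square-integrable functions\<close>

context finite_complete_measure
begin

lemma L2_orthogonal_imp_AE_zero:
  fixes g :: "'s \<Rightarrow> real"
  assumes g: "g \<in> L2 M" and "\<And>\<phi>. \<phi> \<in> L2 M \<Longrightarrow> (\<integral>x. \<phi> x * g x \<partial>M) = 0"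
  shows "AE x in M. g x = 0"
proof -
  have "(\<integral>x. (g x)\<^sup>2 \<partial>M) = 0" using assms(2)[OF g] by (simp add: power2_eq_square)
  then have "AE x in M. (g x)\<^sup>2 = 0"
    using integral_nonneg_eq_0_iff_AE[OF L2_real_integrable[OF g]] by simp
  then show ?thesis by simp
qed

lemma L2_dual_bounded_linear:
  fixes \<phi> :: "'s \<Rightarrow> real" and \<Lambda> :: "('s \<Rightarrow> 'b::real_normed_vector) \<Rightarrow> real"
  assumes L: "\<Lambda> \<in> L2_dual M" and p: "\<phi> \<in> L2 M"
  shows "bounded_linear (\<lambda>x. \<Lambda> (\<lambda>t. \<phi> t *\<^sub>R x))"
proof -
  obtain C where C: "0 < C" "\<And>f. f \<in> L2 M \<Longrightarrow> \<bar>\<Lambda> f\<bar> \<le> C * L2_norm M f"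
    using L2_dual_bound[OF L] by metis
  show ?thesis
  proof (rule bounded_linear_intro)
    show "\<Lambda> (\<lambda>t. \<phi> t *\<^sub>R (x + y)) = \<Lambda> (\<lambda>t. \<phi> t *\<^sub>R x) + \<Lambda> (\<lambda>t. \<phi> t *\<^sub>R y)" for x y
      using L2_dual_add[OF L L2_scaleR_const[OF p] L2_scaleR_const[OF p]] by (simp add: scaleR_right_distrib)
    show "\<Lambda> (\<lambda>t. \<phi> t *\<^sub>R (c *\<^sub>R x)) = c *\<^sub>R \<Lambda> (\<lambda>t. \<phi> t *\<^sub>R x)" for c x
      using L2_dual_scaleR[OF L L2_scaleR_const[OF p], of c x] by (simp add: mult.commute)
    show "norm (\<Lambda> (\<lambda>t. \<phi> t *\<^sub>R x)) \<le> norm x * (C * L2_norm M \<phi>)" for x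
      using C(2)[OF L2_scaleR_const[OF p, of x]] by (simp add: L2_norm_scaleR_right mult_ac)
  qed
qed

text \<open>
  The proof constructs a field \<open>\<sigma>\<close> that selects, with a sign, a direction \<open>e j\<close> maximising \<open>\<bar>k j t\<bar>\<close>
  at each point \<open>t\<close>, so that \<open>\<Lambda> (\<psi> \<sigma>)\<close> is the integral of \<open>\<psi>\<close> against the maximum.
\<close>

lemma L2_dual_max:
  fixes \<Lambda> :: "('s \<Rightarrow> 'b::real_normed_vector) \<Rightarrow> real" and e :: "nat \<Rightarrow> 'b" and k :: "nat \<Rightarrow> 's \<Rightarrow> real"
  assumes L: "\<Lambda> \<in> L2_dual M" and e: "\<And>n. norm (e n) \<le> 1" and k: "\<And>n. k n \<in> L2 M"
    and rep: "\<And>n \<phi>. \<phi> \<in> L2 M \<Longrightarrow> \<Lambda> (\<lambda>t. \<phi> t *\<^sub>R e n) = (\<integral>t. \<phi> t * k n t \<partial>M)"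
    and C: "\<And>f. f \<in> L2 M \<Longrightarrow> \<bar>\<Lambda> f\<bar> \<le> C * L2_norm M f" "0 < C"
  shows "(\<lambda>t. Max ((\<lambda>j. \<bar>k j t\<bar>) ` {..n})) \<in> L2 M \<and> L2_norm M (\<lambda>t. Max ((\<lambda>j. \<bar>k j t\<bar>) ` {..n})) \<le> C"
proof -
  define a where "a n t = Max ((\<lambda>j. \<bar>k j t\<bar>) ` {..n})" for n t
  have a0: "a 0 t = \<bar>k 0 t\<bar>" for t by (simp add: a_def)
  have aS: "a (Suc n) t = max \<bar>k (Suc n) t\<bar> (a n t)" for n t
    by (simp add: a_def atMost_Suc)
  have [measurable]: "k n \<in> borel_measurable M" for n by (rule L2_real_measurable[OF k])
  have amult: "(\<lambda>t. \<psi> t * c t) \<in> L2 M" if "\<psi> \<in> L2 M" "c \<in> borel_measurable M" "\<And>t. \<bar>c t\<bar> \<le> 1" for \<psi> c :: "'s \<Rightarrow> real"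
  proof (rule L2_dominated)
    have [measurable]: "\<psi> \<in> borel_measurable M" "c \<in> borel_measurable M" using that L2_real_measurable by auto
    show "strongly_measurable M (\<lambda>t. \<psi> t * c t)" by (intro borel_measurable_imp_strongly_measurable) measurable
    show "(\<lambda>t. norm (\<psi> t)) \<in> L2 M" by (rule L2_norm_in_L2[OF that(1)])
    show "AE t in M. norm (\<psi> t * c t) \<le> norm (\<psi> t)" using that(3) by (auto simp: abs_mult mult_left_le)
  qed
  have "a n \<in> L2 M \<and> (\<exists>\<sigma>. strongly_measurable M \<sigma> \<and> (\<forall>t. norm (\<sigma> t) \<le> 1) \<and>
      (\<forall>\<psi>\<in>L2 M. \<Lambda> (\<lambda>t. \<psi> t *\<^sub>R \<sigma> t) = (\<integral>t. \<psi> t * a n t \<partial>M)))" for n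
  proof (induction n)
    case 0
    have s: "(\<lambda>t. sgn (k 0 t)) \<in> borel_measurable M" by measurable
    have "a 0 \<in> L2 M" using L2_norm_in_L2[OF k[of 0]] by (simp add: a0 a0[abs_def])
    moreover have "strongly_measurable M (\<lambda>t. sgn (k 0 t) *\<^sub>R e 0)"
      by (intro strongly_measurable_scaleR strongly_measurable_const borel_measurable_imp_strongly_measurable s)
    moreover have "norm (sgn (k 0 t) *\<^sub>R e 0) \<le> 1" for t
      using e[of 0] by (simp add: abs_sgn_eq)
    moreover have "\<Lambda> (\<lambda>t. \<psi> t *\<^sub>R (sgn (k 0 t) *\<^sub>R e 0)) = (\<integral>t. \<psi> t * a 0 t \<partial>M)" if "\<psi> \<in> L2 M" for \<psi>
    proof -
      have "(\<lambda>t. \<psi> t * sgn (k 0 t)) \<in> L2 M" by (rule amult[OF that s]) (simp add: abs_sgn_eq)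
      from rep[OF this, of 0] show ?thesis by (simp add: a0 abs_sgn mult.assoc mult.commute[of "k 0 _"])
    qed
    ultimately show ?case by blast
  next
    case (Suc n)
    then obtain \<sigma> where an: "a n \<in> L2 M" and \<sigma>: "strongly_measurable M \<sigma>" "\<And>t. norm (\<sigma> t) \<le> 1"
      "\<And>\<psi>. \<psi> \<in> L2 M \<Longrightarrow> \<Lambda> (\<lambda>t. \<psi> t *\<^sub>R \<sigma> t) = (\<integral>t. \<psi> t * a n t \<partial>M)" by blast
    have [measurable]: "a n \<in> borel_measurable M" by (rule L2_real_measurable[OF an])
    \<comment> \<open>Where \<open>\<bar>k (Suc n) t\<bar>\<close> strictly exceeds the old maximum,
      the new selector switches to \<open>e (Suc n)\<close> with the sign of
      \<open>k (Suc n) t\<close>; elsewhere it keeps the old direction. The coefficients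
      \<open>c\<close> and \<open>d\<close> are never both nonzero.\<close>
    define c where "c t = (if a n t < \<bar>k (Suc n) t\<bar> then sgn (k (Suc n) t) else 0)" for t
    define d where "d t = (if a n t < \<bar>k (Suc n) t\<bar> then 0 else 1 :: real)" for t
    have cm[measurable]: "c \<in> borel_measurable M" unfolding c_def[abs_def] by measurable
    have dm[measurable]: "d \<in> borel_measurable M" unfolding d_def[abs_def] by measurable
    have c1: "\<bar>c t\<bar> \<le> 1" and d1: "\<bar>d t\<bar> \<le> 1" for t by (auto simp: c_def d_def abs_sgn_eq)
    define \<tau> where "\<tau> t = c t *\<^sub>R e (Suc n) + d t *\<^sub>R \<sigma> t" for t
    have aSn: "a (Suc n) t = c t * k (Suc n) t + d t * a n t" for t
      by (auto simp: aS c_def d_def abs_sgn mult.commute)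
    have "a (Suc n) \<in> L2 M"
      unfolding aSn[abs_def]
      using L2_add[OF amult[OF k[of "Suc n"] cm c1] amult[OF an dm d1]] by (simp add: mult.commute)
    moreover have "strongly_measurable M \<tau>"
      unfolding \<tau>_def[abs_def]
      by (intro strongly_measurable_add strongly_measurable_scaleR strongly_measurable_const
          borel_measurable_imp_strongly_measurable \<sigma>(1)) measurable
    moreover have "norm (\<tau> t) \<le> 1" for t
      using e[of "Suc n"] \<sigma>(2)[of t] by (auto simp: \<tau>_def c_def d_def abs_sgn_eq)
    moreover have "\<Lambda> (\<lambda>t. \<psi> t *\<^sub>R \<tau> t) = (\<integral>t. \<psi> t * a (Suc n) t \<partial>M)" if p: "\<psi> \<in> L2 M" for \<psi>
    proof -
      have pc: "(\<lambda>t. \<psi> t * c t) \<in> L2 M" and pd: "(\<lambda>t. \<psi> t * d t) \<in> L2 M"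
        using amult[OF p cm c1] amult[OF p dm d1] by auto
      have s: "(\<lambda>t. (\<psi> t * d t) *\<^sub>R \<sigma> t) \<in> L2 M"
      proof (rule L2_dominated)
        show "strongly_measurable M (\<lambda>t. (\<psi> t * d t) *\<^sub>R \<sigma> t)"
          by (intro strongly_measurable_scaleR \<sigma>(1) L2D(1)[OF pd])
        show "(\<lambda>t. norm (\<psi> t * d t)) \<in> L2 M" by (rule L2_norm_in_L2[OF pd])
        show "AE t in M. norm ((\<psi> t * d t) *\<^sub>R \<sigma> t) \<le> norm (\<psi> t * d t)"
          using \<sigma>(2) by (auto simp: mult_left_le)
      qed
      have "\<Lambda> (\<lambda>t. \<psi> t *\<^sub>R \<tau> t) = \<Lambda> (\<lambda>t. (\<psi> t * c t) *\<^sub>R e (Suc n) + (\<psi> t * d t) *\<^sub>R \<sigma> t)"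
        by (simp add: \<tau>_def scaleR_right_distrib)
      also have "\<dots> = (\<integral>t. \<psi> t * c t * k (Suc n) t \<partial>M) + (\<integral>t. \<psi> t * d t * a n t \<partial>M)"
        using L2_dual_add[OF L L2_scaleR_const[OF pc] s] rep[OF pc] \<sigma>(3)[OF pd] by simp
      also have "\<dots> = (\<integral>t. \<psi> t * c t * k (Suc n) t + \<psi> t * d t * a n t \<partial>M)"
        using pc pd k an
        by (intro Bochner_Integration.integral_add[symmetric] integrable_mult_L2 L2_real_measurable L2_real_integrable)
      also have "\<dots> = (\<integral>t. \<psi> t * a (Suc n) t \<partial>M)" by (simp add: aSn algebra_simps)
      finally show ?thesis .
    qed
    ultimately show ?case by blast
  qed
  then obtain \<sigma> where an: "a n \<in> L2 M" and \<sigma>: "strongly_measurable M \<sigma>" "\<And>t. norm (\<sigma> t) \<le> 1"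
    "\<And>\<psi>. \<psi> \<in> L2 M \<Longrightarrow> \<Lambda> (\<lambda>t. \<psi> t *\<^sub>R \<sigma> t) = (\<integral>t. \<psi> t * a n t \<partial>M)" by blast
  have ns: "(\<lambda>t. norm (a n t)) \<in> L2 M" by (rule L2_norm_in_L2[OF an])
  have sm: "strongly_measurable M (\<lambda>t. a n t *\<^sub>R \<sigma> t)" by (intro strongly_measurable_scaleR \<sigma>(1) L2D(1)[OF an])
  have le: "AE t in M. norm (a n t *\<^sub>R \<sigma> t) \<le> norm (a n t)" using \<sigma>(2) by (auto simp: mult_left_le)
  \<comment> \<open>Testing with the maximum itself gives a bound by \<open>C\<close> that does not
    depend on \<open>n\<close>: the square of its norm is the value of the functional at a field
    whose pointwise norm is at most \<open>\<bar>a n t\<bar>\<close>.\<close>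
  have "(L2_norm M (a n))\<^sup>2 = \<Lambda> (\<lambda>t. a n t *\<^sub>R \<sigma> t)"
    using \<sigma>(3)[OF an] unfolding L2_norm_power2 by (simp add: power2_eq_square)
  also have "\<dots> \<le> C * L2_norm M (\<lambda>t. a n t *\<^sub>R \<sigma> t)"
    using C(1)[OF L2_dominated(1)[OF sm ns le]] by simp
  also have "\<dots> \<le> C * L2_norm M (a n)"
    using L2_dominated(2)[OF sm ns le, unfolded L2_norm_norm] C(2) by (intro mult_left_mono) simp_all
  finally have "L2_norm M (a n) * L2_norm M (a n) \<le> C * L2_norm M (a n)"
    by (simp add: power2_eq_square)
  then have "L2_norm M (a n) \<le> C"
    using C(2) by (cases "L2_norm M (a n) = 0") (auto simp: less_le)
  then show ?thesis using an by (simp add: a_def[abs_def])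
qed


text \<open>Each density \<open>h x\<close> is determined only up to a null set that depends on
  \<open>x\<close>, which is why linearity is collected over a countable \<open>P\<close>. Pointwise
  boundedness needs a bound uniform over all directions; it comes from the maxima in
  \<open>L2_dual_max\<close>. Separability of the dual, through \<open>E\<close>, enters in the
  strong measurability of the representing function.\<close>

theorem L2_dual_representation:
  fixes \<Lambda> :: "('s \<Rightarrow> 'b::real_normed_vector) \<Rightarrow> real"
    and D :: "'b set" and E :: "('b \<Rightarrow>\<^sub>L real) set"
  assumes L: "\<Lambda> \<in> L2_dual M"
    and D: "countable D" "closure D = UNIV" and E: "countable E" "closure E = UNIV"
  shows "\<exists>w\<in>L2 M. \<forall>f\<in>L2 M. \<Lambda> f = (\<integral>t. blinfun_apply (w t) (f t) \<partial>M)"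
proof -
  have "closure (span D) = UNIV"
    using D(2) closure_mono[OF span_superset[of D]] by auto
  then obtain P :: "'b set" where P: "countable P" "closure P = UNIV" "rational_subspace P"
    using countable_dense_rational_subspace D(1) by metis
  obtain C where C: "0 < C" "\<And>f. f \<in> L2 M \<Longrightarrow> \<bar>\<Lambda> f\<bar> \<le> C * L2_norm M f"
    using L2_dual_bound[OF L] by metis
  have "\<exists>h. h \<in> L2 M \<and> (\<forall>\<phi>\<in>L2 M. \<Lambda> (\<lambda>t. \<phi> t *\<^sub>R x) = (\<integral>t. \<phi> t * h t \<partial>M))" for x
  proof -
    have "(\<lambda>\<phi>. \<Lambda> (\<lambda>t. \<phi> t *\<^sub>R x)) \<in> L2_dual M"
      unfolding L2_dual_def
    proof (intro CollectI conjI ballI allI)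
      fix \<phi> \<psi> :: "'s \<Rightarrow> real" assume "\<phi> \<in> L2 M" "\<psi> \<in> L2 M"
      then show "\<Lambda> (\<lambda>t. (\<phi> t + \<psi> t) *\<^sub>R x) = \<Lambda> (\<lambda>t. \<phi> t *\<^sub>R x) + \<Lambda> (\<lambda>t. \<psi> t *\<^sub>R x)"
        using L2_dual_add[OF L L2_scaleR_const L2_scaleR_const] by (simp add: scaleR_left_distrib)
    next
      fix c and \<phi> :: "'s \<Rightarrow> real" assume "\<phi> \<in> L2 M"
      then show "\<Lambda> (\<lambda>t. (c *\<^sub>R \<phi> t) *\<^sub>R x) = c * \<Lambda> (\<lambda>t. \<phi> t *\<^sub>R x)"
        using L2_dual_scaleR[OF L L2_scaleR_const] by simp
    next
      have "\<bar>\<Lambda> (\<lambda>t. \<phi> t *\<^sub>R x)\<bar> \<le> (C * norm x) * L2_norm M \<phi>" if "\<phi> \<in> L2 M" for \<phi>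
        using C(2)[OF L2_scaleR_const[OF that, of x]] by (simp add: L2_norm_scaleR_right mult.assoc)
      then show "\<exists>C. \<forall>\<phi>\<in>L2 M. \<bar>\<Lambda> (\<lambda>t. \<phi> t *\<^sub>R x)\<bar> \<le> C * L2_norm M \<phi>" by blast
    qed
    then obtain h where "h \<in> L2 M" "\<And>\<phi>. \<phi> \<in> L2 M \<Longrightarrow> \<Lambda> (\<lambda>t. \<phi> t *\<^sub>R x) = (\<integral>t. \<phi> t * h t \<partial>M)"
      by (rule L2_riesz) blast
    then show ?thesis by blast
  qed
  then obtain h where h: "\<And>x. h x \<in> L2 M"
    and hrep: "\<And>x \<phi>. \<phi> \<in> L2 M \<Longrightarrow> \<Lambda> (\<lambda>t. \<phi> t *\<^sub>R x) = (\<integral>t. \<phi> t * h x t \<partial>M)"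
    by metis
  have int: "integrable M (\<lambda>t. \<phi> t * h x t)" if "\<phi> \<in> L2 M" for \<phi> x
    using that h by (intro integrable_mult_L2 L2_real_measurable L2_real_integrable)
  have hadd: "AE t in M. h (x + y) t = h x t + h y t" for x y
  proof -
    have "(\<integral>t. \<phi> t * (h (x + y) t - (h x t + h y t)) \<partial>M) = 0" if p: "\<phi> \<in> L2 M" for \<phi>
    proof -
      have "(\<integral>t. \<phi> t * (h (x + y) t - (h x t + h y t)) \<partial>M)
          = (\<integral>t. \<phi> t * h (x + y) t - (\<phi> t * h x t + \<phi> t * h y t) \<partial>M)"
        by (simp add: algebra_simps)
      also have "\<dots> = \<Lambda> (\<lambda>t. \<phi> t *\<^sub>R (x + y)) - (\<Lambda> (\<lambda>t. \<phi> t *\<^sub>R x) + \<Lambda> (\<lambda>t. \<phi> t *\<^sub>R y))"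
        by (simp add: hrep[OF p] int[OF p])
      also have "\<dots> = 0"
        using linear_add[OF bounded_linear.linear[OF L2_dual_bounded_linear[OF L p]], of x y] by simp
      finally show ?thesis .
    qed
    then have "AE t in M. h (x + y) t - (h x t + h y t) = 0"
      by (intro L2_orthogonal_imp_AE_zero L2_diff L2_add h)
    then show ?thesis by eventually_elim simp
  qed
  have hscale: "AE t in M. h (c *\<^sub>R x) t = c * h x t" for c x
  proof -
    have "(\<integral>t. \<phi> t * (h (c *\<^sub>R x) t - c * h x t) \<partial>M) = 0" if p: "\<phi> \<in> L2 M" for \<phi>
    proof -
      have "(\<integral>t. \<phi> t * (h (c *\<^sub>R x) t - c * h x t) \<partial>M)
          = (\<integral>t. \<phi> t * h (c *\<^sub>R x) t - c * (\<phi> t * h x t) \<partial>M)"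
        by (simp add: algebra_simps)
      also have "\<dots> = \<Lambda> (\<lambda>t. \<phi> t *\<^sub>R (c *\<^sub>R x)) - c * \<Lambda> (\<lambda>t. \<phi> t *\<^sub>R x)"
        by (simp add: hrep[OF p] int[OF p] del: scaleR_scaleR)
      also have "\<dots> = 0"
        using linear_scale[OF bounded_linear.linear[OF L2_dual_bounded_linear[OF L p]], of c x] by simp
      finally show ?thesis .
    qed
    then have "AE t in M. h (c *\<^sub>R x) t - c * h x t = 0"
      by (intro L2_orthogonal_imp_AE_zero L2_diff L2_mult h)
    then show ?thesis by eventually_elim simp
  qed
  have "P \<noteq> {}" using P(2) by auto
  define p where "p = from_nat_into P"
  have rng: "range p = P" unfolding p_def using \<open>P \<noteq> {}\<close> P(1) by (rule range_from_nat_into)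
  \<comment> \<open>If \<open>p n = 0\<close>, division by zero yields 0, so \<open>e n\<close> and
    \<open>k n\<close> both vanish and stay consistent with each other.\<close>
  define e where "e n = (1 / norm (p n)) *\<^sub>R p n" for n
  define k where "k n t = (1 / norm (p n)) * h (p n) t" for n t
  define a where "a n t = Max ((\<lambda>j. \<bar>k j t\<bar>) ` {..n})" for n t
  have a: "a n \<in> L2 M \<and> L2_norm M (a n) \<le> C" for n
    unfolding a_def[abs_def]
  proof (rule L2_dual_max[OF L _ _ _ C(2,1)])
    show "norm (e n) \<le> 1" for n by (simp add: e_def)
    show k: "k n \<in> L2 M" for n unfolding k_def[abs_def] by (rule L2_mult[OF h])
    show "\<Lambda> (\<lambda>t. \<phi> t *\<^sub>R e n) = (\<integral>t. \<phi> t * k n t \<partial>M)" if "\<phi> \<in> L2 M" for n \<phi>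
    proof -
      have "(\<integral>t. \<phi> t * k n t \<partial>M) = (\<integral>t. (1 / norm (p n)) * (\<phi> t * h (p n) t) \<partial>M)"
        by (simp add: k_def mult_ac)
      also have "\<dots> = (1 / norm (p n)) * \<Lambda> (\<lambda>t. \<phi> t *\<^sub>R p n)"
        by (simp only: integral_mult_right_zero hrep[OF that])
      also have "\<dots> = \<Lambda> (\<lambda>t. \<phi> t *\<^sub>R e n)"
        unfolding e_def
        using linear_scale[OF bounded_linear.linear[OF L2_dual_bounded_linear[OF L that]], of "1 / norm (p n)" "p n"]
        by simp
      finally show ?thesis by simp
    qed
  qed
  have am: "a n \<in> borel_measurable M" for n using a by (intro L2_real_measurable) simp
  have a_ge: "\<bar>k n t\<bar> \<le> a n t" for n t unfolding a_def by (rule Max_ge) auto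
  have a_mono: "a m t \<le> a n t" if "m \<le> n" for m n t
    unfolding a_def using that by (intro Max_mono) auto
  \<comment> \<open>Up to a null set, \<open>S t\<close> is the squared operator norm of
    \<open>x \<mapsto> h x t\<close> on \<open>P\<close>. Monotone convergence carries the bound
    \<open>C\<^sup>2\<close> from the finite maxima to the supremum.\<close>
  define S where "S t = (SUP n. ennreal ((a n t)\<^sup>2))" for t
  have am2: "(\<lambda>t. ennreal ((a n t)\<^sup>2)) \<in> borel_measurable M" for n
    by (intro measurable_compose[OF _ measurable_ennreal] borel_measurable_power am)
  have Sm: "S \<in> borel_measurable M"
    unfolding S_def[abs_def] by (rule borel_measurable_SUP[OF _ am2]) simp
  have "(\<integral>\<^sup>+t. S t \<partial>M) = (SUP n. \<integral>\<^sup>+t. ennreal ((a n t)\<^sup>2) \<partial>M)"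
    unfolding S_def
  proof (rule nn_integral_monotone_convergence_SUP)
    show "incseq (\<lambda>n t. ennreal ((a n t)\<^sup>2))"
    proof (intro incseq_SucI le_funI ennreal_leI power_mono)
      fix n t
      show "0 \<le> a n t" using a_ge[of n t] by linarith
      show "a n t \<le> a (Suc n) t" by (rule a_mono) simp
    qed
  qed (rule am2)
  also have "\<dots> \<le> ennreal (C\<^sup>2)"
  proof (rule SUP_least)
    fix n
    have "(L2_norm M (a n))\<^sup>2 \<le> C\<^sup>2" using a[of n] by (intro power_mono) auto
    then show "(\<integral>\<^sup>+t. ennreal ((a n t)\<^sup>2) \<partial>M) \<le> ennreal (C\<^sup>2)"
      using a[of n] by (simp add: nn_integral_eq_integral L2_real_integrable L2_norm_power2 ennreal_leI)
  qed
  also have "\<dots> < \<infinity>" by simp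
  finally have Sint: "(\<integral>\<^sup>+t. S t \<partial>M) < \<infinity>" .
  then have Sfin: "AE t in M. S t \<noteq> \<infinity>" by (intro nn_integral_PInf_AE Sm) auto
  \<comment> \<open>Since \<open>P\<close> and the rationals are countable, all the identities hold
    together outside one null set. There the functional on \<open>P\<close> is linear over the
    rationals and bounded by the square root of \<open>S t\<close>.\<close>
  define good where "good t \<longleftrightarrow> S t \<noteq> \<infinity> \<and> (\<forall>x\<in>P. \<forall>y\<in>P. h (x + y) t = h x t + h y t) \<and>
      (\<forall>c\<in>\<rat>. \<forall>x\<in>P. h (c *\<^sub>R x) t = c * h x t)" for t
  have "AE t in M. good t"
    unfolding good_def
    using P(1) countable_rat hadd hscale Sfin by (intro AE_conjI AE_ball_countable') auto
  have bound: "\<bar>h x t\<bar> \<le> sqrt (enn2real (S t)) * norm x" if g: "good t" and x: "x \<in> P" for x t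
  proof (cases "x = 0")
    case True
    then show ?thesis using g x P(3) unfolding good_def rational_subspace_def by force
  next
    case False
    obtain n where n: "x = p n" using rng x by auto
    have "ennreal ((a n t)\<^sup>2) \<le> S t" unfolding S_def by (rule SUP_upper) simp
    then have "(a n t)\<^sup>2 \<le> enn2real (S t)" using g unfolding good_def by (metis enn2real_ennreal enn2real_mono infinity_ennreal_def less_top zero_le_power2)
    then have "\<bar>k n t\<bar> \<le> sqrt (enn2real (S t))" using a_ge[of n t] by (meson order_trans real_le_rsqrt)
    then show ?thesis using False n by (simp add: k_def field_simps abs_mult)
  qed
  have "\<exists>l. \<forall>x\<in>P. blinfun_apply l x = h x t" if g: "good t" for t
  proof -
    have "h (x + y) t = h x t + h y t" if "x \<in> P" "y \<in> P" for x y using g that by (simp add: good_def)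
    moreover have "h (c *\<^sub>R x) t = c * h x t" if "c \<in> \<rat>" "x \<in> P" for c x using g that by (simp add: good_def)
    ultimately show ?thesis
      using extend_rational_functional[OF P(2,3), of "\<lambda>x. h x t", OF _ _ bound[OF g]] by metis
  qed
  then obtain w0 where w0: "\<And>t x. good t \<Longrightarrow> x \<in> P \<Longrightarrow> blinfun_apply (w0 t) x = h x t" by metis
  define w where "w t = (if good t then w0 t else 0)" for t
  have wAE: "AE t in M. blinfun_apply (w t) x = h x t" if "x \<in> P" for x
    using \<open>AE t in M. good t\<close> by eventually_elim (simp add: w_def w0 that)
  have wmeas: "(\<lambda>t. blinfun_apply (w t) x) \<in> borel_measurable M" if "x \<in> P" for x
  proof (rule borel_measurable_AE_eq[OF L2_real_measurable[OF h]])
    show "AE t in M. h x t = blinfun_apply (w t) x" using wAE[OF that] by eventually_elim simp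
  qed
  \<comment> \<open>Sublevel sets of the norm are countable intersections over \<open>P\<close> of
    sets cut out by the measurable scalar functions \<open>blinfun_apply (w t) x\<close>.\<close>
  have "(\<lambda>t. norm (w t - l)) \<in> borel_measurable M" for l
  proof (rule borel_measurableI_le)
    fix y :: real
    show "{t \<in> space M. norm (w t - l) \<le> y} \<in> sets M"
    proof (cases "0 \<le> y")
      case True
      have "{t \<in> space M. norm (w t - l) \<le> y}
          = (\<Inter>x\<in>P. {t \<in> space M. \<bar>blinfun_apply (w t) x - blinfun_apply l x\<bar> \<le> y * norm x})"
        using norm_blinfun_le_iff_dense[OF P(2) True] \<open>P \<noteq> {}\<close> by (auto simp: blinfun.diff_left)
      also have "\<dots> \<in> sets M"
      proof (rule sets.countable_INT'[OF P(1) \<open>P \<noteq> {}\<close>], safe)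
        fix x assume "x \<in> P"
        then have [measurable]: "(\<lambda>t. blinfun_apply (w t) x) \<in> borel_measurable M" by (rule wmeas)
        show "{t \<in> space M. \<bar>blinfun_apply (w t) x - blinfun_apply l x\<bar> \<le> y * norm x} \<in> sets M"
          by measurable
      qed
      finally show ?thesis .
    next
      case False
      then have "{t \<in> space M. norm (w t - l) \<le> y} = {}" using norm_ge_zero order_trans by blast
      then show ?thesis by (metis sets.empty_sets)
    qed
  qed
  then have wsm: "strongly_measurable M w" by (rule strongly_measurable_separableI[OF E])
  have wn: "(\<lambda>t. norm (w t)) \<in> borel_measurable M"
    by (intro strongly_measurable_imp_borel_measurable strongly_measurable_norm wsm)
  have wS: "ennreal ((norm (w t))\<^sup>2) \<le> S t" for t
  proof (cases "good t")
    case True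
    have "norm (w0 t) \<le> sqrt (enn2real (S t))"
      using norm_blinfun_le_iff_dense[OF P(2), of "sqrt (enn2real (S t))" "w0 t"] bound[OF True] w0[OF True] by simp
    then have "(norm (w0 t))\<^sup>2 \<le> (sqrt (enn2real (S t)))\<^sup>2" by (intro power_mono) auto
    then have "ennreal ((norm (w0 t))\<^sup>2) \<le> ennreal (enn2real (S t))" by (intro ennreal_leI) simp
    also have "\<dots> = S t" using True by (simp add: good_def less_top)
    finally show ?thesis using True by (simp add: w_def)
  qed (simp add: w_def)
  have "(\<integral>\<^sup>+t. ennreal ((norm (w t))\<^sup>2) \<partial>M) \<le> (\<integral>\<^sup>+t. S t \<partial>M)" by (intro nn_integral_mono wS)
  then have "integrable M (\<lambda>t. (norm (w t))\<^sup>2)"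
    using wn Sint by (intro integrableI_bounded) (auto intro: le_less_trans)
  then have wL2: "w \<in> L2 M" using wsm by (simp add: L2_def)
  have "\<Lambda> f = (\<integral>t. blinfun_apply (w t) (f t) \<partial>M)" if f: "f \<in> L2 M" for f
  proof (rule L2_dual_eqI[OF L L2_pairing_dual[OF wL2] f])
    fix A and x :: 'b assume A: "A \<in> sets M"
    let ?I = "indicator A :: 's \<Rightarrow> real"
    have I: "?I \<in> L2 M" by (rule L2_indicator[OF A])
    \<comment> \<open>The density \<open>h x\<close> is tied to \<open>w\<close> only for
      \<open>x\<close> in \<open>P\<close>. Both functionals depend continuously on
      \<open>x\<close>, so agreement spreads from \<open>P\<close> to its closure.\<close>
    have "continuous_on UNIV (\<lambda>x. \<Lambda> (\<lambda>t. ?I t *\<^sub>R x))"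
      using L2_dual_bounded_linear[OF L I] by (rule linear_continuous_on)
    moreover have "continuous_on UNIV (\<lambda>x. \<integral>t. blinfun_apply (w t) (?I t *\<^sub>R x) \<partial>M)"
      using L2_dual_bounded_linear[OF L2_pairing_dual[OF wL2] I] by (rule linear_continuous_on)
    ultimately have cl: "closed {x. \<Lambda> (\<lambda>t. ?I t *\<^sub>R x) = (\<integral>t. blinfun_apply (w t) (?I t *\<^sub>R x) \<partial>M)}"
      by (rule closed_Collect_eq)
    have "\<Lambda> (\<lambda>t. ?I t *\<^sub>R x) = (\<integral>t. blinfun_apply (w t) (?I t *\<^sub>R x) \<partial>M)" if x: "x \<in> P" for x
    proof -
      have "AE t in M. ?I t * h x t = blinfun_apply (w t) (?I t *\<^sub>R x)"
        using wAE[OF x] by eventually_elim (simp add: blinfun.scaleR_right)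
      then have "(\<integral>t. ?I t * h x t \<partial>M) = (\<integral>t. blinfun_apply (w t) (?I t *\<^sub>R x) \<partial>M)"
        by (intro integral_cong_AE borel_measurable_integrable[OF int[OF I]]
            borel_measurable_integrable[OF L2_pairing_integrable[OF wL2 L2_scaleR_const[OF I]]])
      then show ?thesis by (simp add: hrep[OF I])
    qed
    then have "closure P \<subseteq> {x. \<Lambda> (\<lambda>t. ?I t *\<^sub>R x) = (\<integral>t. blinfun_apply (w t) (?I t *\<^sub>R x) \<partial>M)}"
      using cl by (intro closure_minimal) auto
    then show "\<Lambda> (\<lambda>t. ?I t *\<^sub>R x) = (\<integral>t. blinfun_apply (w t) (?I t *\<^sub>R x) \<partial>M)"
      using P(2) by auto
  qed
  then show ?thesis using wL2 by blast
qed

end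

section \<open>Weak compactness\<close>

text \<open>Reflexivity provides some representing vector for each element of the bidual; a norming
  functional shows that its norm equals that of the functional. The chosen map is therefore
  isometric, and onto because the vector chosen for evaluation at \<open>x\<close> has distance 0
  from \<open>x\<close>.\<close>

lemma reflexive_space_isometry:
  assumes "reflexive_space TYPE('b::real_normed_vector)"
  obtains G :: "(('b::real_normed_vector \<Rightarrow>\<^sub>L real) \<Rightarrow>\<^sub>L real) \<Rightarrow> 'b" where
    "\<And>F l. blinfun_apply F l = blinfun_apply l (G F)" "\<And>F. norm (G F) = norm F" "\<And>F F'. dist (G F) (G F') = dist F F'" "surj G"
proof -
  have "\<exists>G. \<forall>F :: ('b \<Rightarrow>\<^sub>L real) \<Rightarrow>\<^sub>L real. \<forall>l. blinfun_apply F l = blinfun_apply l (G F)"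
    using assms unfolding reflexive_space_def by (intro choice) blast
  then obtain G where G: "\<And>(F :: ('b \<Rightarrow>\<^sub>L real) \<Rightarrow>\<^sub>L real) l. blinfun_apply F l = blinfun_apply l (G F)" by blast
  have iso: "norm F = norm x" if F: "\<And>l. blinfun_apply F l = blinfun_apply l x" for F :: "('b \<Rightarrow>\<^sub>L real) \<Rightarrow>\<^sub>L real" and x
  proof (rule antisym)
    show "norm F \<le> norm x"
    proof (rule norm_blinfun_bound)
      fix l :: "'b \<Rightarrow>\<^sub>L real"
      show "norm (blinfun_apply F l) \<le> norm x * norm l" unfolding F using norm_blinfun[of l x] by (simp add: mult.commute)
    qed simp
    obtain l :: "'b \<Rightarrow>\<^sub>L real" where l: "norm l \<le> 1" "blinfun_apply l x = norm x" by (rule norming_functional)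
    have "norm x \<le> norm F * norm l" using norm_blinfun[of F l] by (simp add: F l(2))
    also have "\<dots> \<le> norm F" using l(1) by (simp add: mult_left_le)
    finally show "norm x \<le> norm F" .
  qed
  have dist: "dist (G F) (G F') = dist F F'" for F F'
    unfolding dist_norm
    by (rule iso[symmetric]) (simp only: blinfun.diff_left blinfun.diff_right G[of F] G[of F'])
  have "surj G"
  proof (rule surjI)
    fix x :: 'b
    define F where "F = Blinfun (\<lambda>l :: 'b \<Rightarrow>\<^sub>L real. blinfun_apply l x)"
    have F: "blinfun_apply F l = blinfun_apply l x" for l
      unfolding F_def by (subst bounded_linear_Blinfun_apply) (auto intro: blinfun.bounded_linear_left)
    have "norm (F - F) = norm (G F - x)"
    proof (rule iso)
      fix l :: "'b \<Rightarrow>\<^sub>L real"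
      show "blinfun_apply (F - F) l = blinfun_apply l (G F - x)"
        using G[of F l] F[of l] by (simp add: blinfun.diff_right)
    qed
    then show "G (Blinfun (\<lambda>l :: 'b \<Rightarrow>\<^sub>L real. blinfun_apply l x)) = x" by (simp add: F_def)
  qed
  then show ?thesis by (intro that[OF G iso[OF G, symmetric] dist])
qed

lemma diagonal_convergent_subsequence:
  fixes a :: "'i \<Rightarrow> nat \<Rightarrow> real"
  assumes "countable I" and bd: "\<And>i. i \<in> I \<Longrightarrow> bounded (range (a i))"
  obtains r :: "nat \<Rightarrow> nat" where "strict_mono r" "\<And>i. i \<in> I \<Longrightarrow> convergent (\<lambda>n. a i (r n))"
proof (cases "I = {}")
  case True
  show ?thesis by (rule that[of id]) (auto simp: True strict_mono_def)
next
  case False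
  define e where "e = from_nat_into I"
  have rng: "range e = I" unfolding e_def using False assms(1) by (rule range_from_nat_into)
  define P where "P n s = convergent (\<lambda>k. a (e n) (s k))" for n and s :: "nat \<Rightarrow> nat"
  interpret subseqs P
  proof
    fix n and s :: "nat \<Rightarrow> nat"
    have "bounded (range (\<lambda>k. a (e n) (s k)))"
      using bd[of "e n"] rng by (auto intro: bounded_subset)
    then obtain l r where "strict_mono r" "((\<lambda>k. a (e n) (s k)) \<circ> r) \<longlonglongrightarrow> l"
      using bounded_imp_convergent_subsequence by blast
    then show "\<exists>r'. strict_mono r' \<and> P n (s \<circ> r')"
      by (intro exI[of _ r]) (auto simp: P_def convergent_def o_def)
  qed
  have "convergent (\<lambda>k. a i (diagseq k))" if "i \<in> I" for i
  proof -
    from that obtain n where n: "i = e n" unfolding rng[symmetric] by blast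
    \<comment> \<open>The diagonal sequence refines stage \<open>n\<close> only from index
      \<open>Suc n\<close> on; dropping the initial segment does not affect convergence.\<close>
    have "P n (diagseq \<circ> ((+) (Suc n)))"
    proof (rule diagseq_holds)
      fix r s :: "nat \<Rightarrow> nat" and n assume "strict_mono r" "P n s"
      then show "P n (s \<circ> r)"
        using convergent_subseq_convergent[of "\<lambda>k. a (e n) (s k)" r] by (simp add: P_def o_def)
    qed
    then have "convergent (\<lambda>k. a i (diagseq (k + Suc n)))" by (simp add: P_def n o_def add.commute)
    then show ?thesis
      using convergent_ignore_initial_segment[of "\<lambda>k. a i (diagseq k)" "Suc n"] by simp
  qed
  then show ?thesis using that subseq_diagseq by blast
qed

text \<open>Separability of the measure algebra: outer regularity replaces a measurable set by an
  open one, an open set is a countable union of basic sets, and finite subunions exhaust it in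
  measure. The countable family consists of the finite unions of basic sets, cut with
  \<open>S\<close>.\<close>

lemma lebesgue_on_countably_approximable:
  fixes S :: "'a::euclidean_space set"
  assumes S: "S \<in> lmeasurable"
  obtains \<C> where "countable \<C>" "\<C> \<subseteq> sets (lebesgue_on S)"
    "\<And>A e. A \<in> sets (lebesgue_on S) \<Longrightarrow> 0 < e \<Longrightarrow> \<exists>C\<in>\<C>. measure (lebesgue_on S) (sym_diff A C) < e"
proof -
  interpret finite_measure "lebesgue_on S" by (rule finite_measure_lebesgue_on[OF S])
  have Sl: "S \<in> sets lebesgue" using S by (rule fmeasurableD)
  obtain B :: "'a set set" where B: "countable B" "\<And>C. C \<in> B \<Longrightarrow> open C"
    "\<And>U. open U \<Longrightarrow> \<exists>F. F \<subseteq> B \<and> U = \<Union>F"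
    by (rule univ_second_countable) blast
  define \<C> where "\<C> = (\<lambda>F. S \<inter> \<Union>F) ` {F. finite F \<and> F \<subseteq> B}"
  have sets_open: "S \<inter> U \<in> sets (lebesgue_on S)" if "open U" for U
    using that Sl by (auto simp: sets_restrict_space)
  show ?thesis
  proof
    show "countable \<C>"
      unfolding \<C>_def by (intro countable_image countable_Collect_finite_subset B)
    show "\<C> \<subseteq> sets (lebesgue_on S)"
      unfolding \<C>_def using B(2) by (auto intro!: sets_open)
  next
    fix A and e :: real assume A: "A \<in> sets (lebesgue_on S)" and e: "0 < e"
    then have Al: "A \<in> sets lebesgue" and AS: "A \<subseteq> S" using Sl by (auto simp: sets_restrict_space)
    obtain U where U: "open U" "A \<subseteq> U" "U - A \<in> lmeasurable" "emeasure lebesgue (U - A) < ennreal (e / 2)"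
      using sets_lebesgue_outer_open[OF Al, of "e / 2"] e by auto
    obtain F where F: "F \<subseteq> B" "U = \<Union>F" using B(3)[OF U(1)] by blast
    \<comment> \<open>Adding the empty set keeps the enumerated family nonempty even when
      \<open>F\<close> is empty; it is removed again when \<open>H n\<close> is recognised as a
      member of \<open>\<C>\<close>.\<close>
    define H where "H n = S \<inter> \<Union>(from_nat_into (insert {} F) ` {..n})" for n :: nat
    have cF: "countable (insert {} F)" using F(1) B(1) by (auto intro: countable_subset)
    have op: "open X" if "X \<in> insert {} F" for X using that F(1) B(2) by auto
    have fromin: "from_nat_into (insert {} F) j \<in> insert {} F" for j by (rule from_nat_into) simp
    have Hs: "H n \<in> sets (lebesgue_on S)" for n
      unfolding H_def using op fromin by (intro sets_open) auto
    have "(\<lambda>n. measure (lebesgue_on S) (H n)) \<longlonglongrightarrow> measure (lebesgue_on S) (\<Union>n. H n)"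
    proof (rule finite_Lim_measure_incseq)
      show "incseq H" unfolding H_def incseq_def by (auto intro: order_trans)
    qed (use Hs in auto)
    moreover have "(\<Union>n. H n) = S \<inter> U"
    proof -
      have "(\<Union>n. H n) = S \<inter> \<Union>(range (from_nat_into (insert {} F)))" unfolding H_def by auto
      also have "\<dots> = S \<inter> U" using range_from_nat_into[OF _ cF] F(2) by auto
      finally show ?thesis .
    qed
    ultimately have "(\<lambda>n. measure (lebesgue_on S) (H n)) \<longlonglongrightarrow> measure (lebesgue_on S) (S \<inter> U)" by simp
    then have "\<forall>\<^sub>F n in sequentially. measure (lebesgue_on S) (S \<inter> U) - e / 2 < measure (lebesgue_on S) (H n)"
      using e by (intro order_tendstoD(1)) auto
    then obtain n where n: "measure (lebesgue_on S) (S \<inter> U) - e / 2 < measure (lebesgue_on S) (H n)"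
      by (auto simp: eventually_sequentially)
    have HU: "H n \<subseteq> S \<inter> U" using \<open>(\<Union>n. H n) = S \<inter> U\<close> by auto
    have "measure (lebesgue_on S) (S \<inter> U - H n) = measure (lebesgue_on S) (S \<inter> U) - measure (lebesgue_on S) (H n)"
      by (intro finite_measure_Diff sets_open U Hs HU)
    moreover have "measure (lebesgue_on S) (S \<inter> U - A) < e / 2"
    proof -
      have "measure (lebesgue_on S) (S \<inter> U - A) = measure lebesgue (S \<inter> U - A)"
        by (rule measure_restrict_space) (use Sl in auto)
      also have "\<dots> \<le> measure lebesgue (U - A)"
        using U(3) by (intro measure_mono_fmeasurable sets.Diff sets.Int Al Sl) (use U(1) in auto)
      also have "\<dots> < e / 2"
        using U(3,4) e by (simp add: emeasure_eq_measure2 ennreal_less_iff)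
      finally show ?thesis .
    qed
    moreover have "measure (lebesgue_on S) (sym_diff A (H n))
        \<le> measure (lebesgue_on S) ((S \<inter> U - H n) \<union> (S \<inter> U - A))"
    proof (rule finite_measure_mono)
      show "sym_diff A (H n) \<subseteq> (S \<inter> U - H n) \<union> (S \<inter> U - A)" using AS U(2) HU by auto
      show "(S \<inter> U - H n) \<union> (S \<inter> U - A) \<in> sets (lebesgue_on S)"
        by (intro sets.Un sets.Diff sets_open U Hs A)
    qed
    moreover have "measure (lebesgue_on S) ((S \<inter> U - H n) \<union> (S \<inter> U - A))
        \<le> measure (lebesgue_on S) (S \<inter> U - H n) + measure (lebesgue_on S) (S \<inter> U - A)"
      by (intro measure_Un_le sets.Diff sets_open U Hs A)
    ultimately have "measure (lebesgue_on S) (sym_diff A (H n)) < e" using n by linarith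
    moreover have "H n \<in> \<C>"
    proof -
      have "H n = S \<inter> \<Union>(from_nat_into (insert {} F) ` {..n} - {{}})" unfolding H_def by auto
      moreover have "from_nat_into (insert {} F) ` {..n} - {{}} \<subseteq> B" using fromin F(1) by auto
      ultimately show ?thesis unfolding \<C>_def by blast
    qed
    ultimately show "\<exists>C\<in>\<C>. measure (lebesgue_on S) (sym_diff A C) < e" by blast
  qed
qed

text \<open>\<open>L2_dual_representation\<close> is used at two levels: for functions with values
  in the dual, to represent the limit functional by a bidual-valued function, and for functions with
  values in \<open>'b\<close>, to see that the pairings \<open>p\<close> exhaust the functionals
  that define weak convergence.\<close>

theorem (in finite_complete_measure) L2_weak_compactness:
  fixes v :: "nat \<Rightarrow> 's \<Rightarrow> 'b::real_normed_vector" and E :: "('b \<Rightarrow>\<^sub>L real) set"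
  assumes refl: "reflexive_space TYPE('b)" and E: "countable E" "closure E = UNIV"
    and \<C>: "countable \<C>" "\<C> \<subseteq> sets M"
      "\<And>A e. A \<in> sets M \<Longrightarrow> 0 < e \<Longrightarrow> \<exists>C\<in>\<C>. measure M (sym_diff A C) < e"
    and v: "\<And>n. v n \<in> L2 M" and B: "\<And>n. L2_norm M (v n) \<le> B"
  obtains r l where "strict_mono r" "L2_weakly_tendsto M (\<lambda>n. v (r n)) l"
proof -
  obtain G :: "(('b \<Rightarrow>\<^sub>L real) \<Rightarrow>\<^sub>L real) \<Rightarrow> 'b" where
    G: "\<And>F l. blinfun_apply F l = blinfun_apply l (G F)" and Gn: "\<And>F. norm (G F) = norm F"
    and Gd: "\<And>F F'. dist (G F) (G F') = dist F F'" and Gs: "surj G"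
    using reflexive_space_isometry[OF refl] by metis
  obtain X :: "'b set" where X: "countable X" "closure (span X) = UNIV"
    using separable_predual[OF E] by metis
  obtain D :: "'b set" where D: "countable D" "closure D = UNIV"
    using countable_dense_rational_subspace[OF X] by metis
  have "\<exists>J. \<forall>x. G (J x) = x" using Gs by (metis surj_def)
  then obtain J where J: "\<And>x. G (J x) = x" by blast
  \<comment> \<open>\<open>J\<close> inverts the isometry \<open>G\<close>, so it carries a
    countable dense set of \<open>'b\<close> to one of the bidual. This is the separability needed
    to represent functionals on functions with values in the dual.\<close>
  have Jd: "countable (J ` D)" "closure (J ` D) = UNIV"
  proof -
    show "countable (J ` D)" using D(1) by simp
    have "F \<in> closure (J ` D)" for F
      unfolding closure_approachable
    proof (intro allI impI)
      fix e :: real assume "0 < e"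
      moreover have "G F \<in> closure D" using D(2) by simp
      ultimately obtain d where d: "d \<in> D" "dist d (G F) < e" unfolding closure_approachable by blast
      then have "dist (J d) F < e" using Gd[of "J d" F] by (simp add: J)
      then show "\<exists>y\<in>J ` D. dist y F < e" using d(1) by blast
    qed
    then show "closure (J ` D) = UNIV" by blast
  qed
  have B0: "0 \<le> B" using B[of 0] L2_norm_nonneg order_trans by blast
  define p where "p n w = (\<integral>t. blinfun_apply (w t) (v n t) \<partial>M)" for n and w :: "'s \<Rightarrow> 'b \<Rightarrow>\<^sub>L real"
  have pb: "\<bar>p n w\<bar> \<le> B * L2_norm M w" if "w \<in> L2 M" for n w
    using L2_pairing_bound[OF that v, of n] mult_left_mono[OF B[of n] L2_norm_nonneg[of M w]]
    by (simp add: p_def mult.commute)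
  have pint: "integrable M (\<lambda>t. blinfun_apply (w t) (v n t))" if "w \<in> L2 M" for n and w :: "'s \<Rightarrow> 'b \<Rightarrow>\<^sub>L real"
    by (rule L2_pairing_integrable[OF that v])
  have padd: "p n (\<lambda>t. w t + u t) = p n w + p n u" if "w \<in> L2 M" "u \<in> L2 M" for n w u
    unfolding p_def by (simp add: blinfun.add_left pint that)
  have pscale: "p n (\<lambda>t. c *\<^sub>R w t) = c * p n w" if "w \<in> L2 M" for n w c
    unfolding p_def by (simp add: blinfun.scaleR_left)
  have pdiff: "p n (\<lambda>t. w t - u t) = p n w - p n u" if "w \<in> L2 M" "u \<in> L2 M" for n w u
    unfolding p_def by (simp add: blinfun.diff_left pint that)
  define I where "I = \<C> \<times> E"
  have ind: "(\<lambda>t. indicator A t *\<^sub>R x) \<in> L2 M" if "A \<in> sets M" for A and x :: "'c::real_normed_vector"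
    by (intro L2_scaleR_const L2_indicator that)
  obtain r where r: "strict_mono r"
    "\<And>i. i \<in> I \<Longrightarrow> convergent (\<lambda>n. p (r n) (\<lambda>t. indicator (fst i) t *\<^sub>R snd i))"
  proof (rule diagonal_convergent_subsequence[of I "\<lambda>i n. p n (\<lambda>t. indicator (fst i) t *\<^sub>R snd i)"])
    show "countable I" unfolding I_def using \<C>(1) E(1) by auto
    fix i assume "i \<in> I"
    then have "fst i \<in> sets M" using \<C>(2) by (auto simp: I_def)
    from pb[OF ind[OF this]] show "bounded (range (\<lambda>n. p n (\<lambda>t. indicator (fst i) t *\<^sub>R snd i)))"
      by (intro boundedI[of _ "B * L2_norm M (\<lambda>t. indicator (fst i) t *\<^sub>R snd i)"]) auto
  qed blast
  \<comment> \<open>The pairings are Lipschitz in \<open>w\<close> with the common constant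
    \<open>B\<close>, so the weights for which they converge are closed under approximation;
    \<open>B + 1\<close> only keeps the denominator positive.\<close>
  have conv_limit: "convergent (\<lambda>n. p (r n) w)"
    if w: "w \<in> L2 M" and ex: "\<And>e. 0 < e \<Longrightarrow> \<exists>u\<in>L2 M. convergent (\<lambda>n. p (r n) u) \<and> L2_norm M (\<lambda>t. w t - u t) < e" for w
  proof (rule Cauchy_convergent, rule metric_CauchyI)
    fix e :: real assume e: "0 < e"
    define d where "d = e / (3 * (B + 1))"
    have d: "0 < d" "B * d \<le> e / 3" using e B0 by (auto simp: d_def field_simps)
    obtain u where u: "u \<in> L2 M" "convergent (\<lambda>n. p (r n) u)" "L2_norm M (\<lambda>t. w t - u t) < d"
      using ex[OF d(1)] by blast
    have near: "\<bar>p n w - p n u\<bar> \<le> e / 3" for n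
    proof -
      have "\<bar>p n w - p n u\<bar> \<le> B * L2_norm M (\<lambda>t. w t - u t)"
        using pb[OF L2_diff[OF w u(1)], of n] pdiff[OF w u(1), of n] by simp
      also have "\<dots> \<le> B * d" using u(3) B0 by (intro mult_left_mono) auto
      finally show ?thesis using d(2) by linarith
    qed
    obtain N where N: "\<And>m n. N \<le> m \<Longrightarrow> N \<le> n \<Longrightarrow> dist (p (r m) u) (p (r n) u) < e / 3"
      using metric_CauchyD[OF convergent_Cauchy[OF u(2)], of "e / 3"] e by auto
    show "\<exists>N. \<forall>m\<ge>N. \<forall>n\<ge>N. dist (p (r m) w) (p (r n) w) < e"
    proof (intro exI allI impI)
      fix m n assume "N \<le> m" "N \<le> n"
      from N[OF this] show "dist (p (r m) w) (p (r n) w) < e"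
        using near[of "r m"] near[of "r n"] unfolding dist_real_def by linarith
    qed
  qed
  have conv: "convergent (\<lambda>n. p (r n) w)" if "w \<in> L2 M" for w
    using that
  proof (induction rule: L2_induct)
    case (indicator A x)
    show ?case
    proof (rule conv_limit[OF ind[OF indicator]])
      fix e :: real assume e: "0 < e"
      \<comment> \<open>\<open>A\<close> is replaced by a set \<open>C\<close> of the countable
        family and \<open>x\<close> by a functional \<open>y\<close> in \<open>E\<close>, at a cost
        of at most \<open>e / 3\<close> each. The measure of the symmetric difference has to be
        below \<open>d\<^sup>2\<close> because the norm of an indicator is the square root of its
        measure.\<close>
      define d where "d = e / (3 * (norm x + 1))"
      have "0 < e / (3 * (c + 1)) \<and> c * (e / (3 * (c + 1))) \<le> e / 3" if "0 \<le> c" for c :: real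
        using e that by (auto simp: field_simps)
      then have d: "0 < d" "norm x * d \<le> e / 3" by (simp_all add: d_def)
      define s where "s = sqrt (measure M (space M))"
      have s: "0 \<le> s" by (simp add: s_def)
      obtain C where C: "C \<in> \<C>" "measure M (sym_diff A C) < d\<^sup>2"
        using \<C>(3)[OF indicator, of "d\<^sup>2"] d(1) by auto
      have Cs: "C \<in> sets M" using C(1) \<C>(2) by auto
      have "x \<in> closure E" using E(2) by simp
      moreover have "0 < e / (3 * (s + 1))" using e s by simp
      ultimately obtain y where y: "y \<in> E" "dist y x < e / (3 * (s + 1))" unfolding closure_approachable by blast
      have "s * dist y x \<le> s * (e / (3 * (s + 1)))" using y(2) s by (intro mult_left_mono) auto
      also have "\<dots> \<le> e / 3" using s e by (simp add: field_simps)
      finally have sy: "s * dist y x \<le> e / 3" .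
      let ?u = "\<lambda>t. indicator C t *\<^sub>R y"
      have "convergent (\<lambda>n. p (r n) ?u)" using r(2)[of "(C, y)"] C(1) y(1) by (simp add: I_def)
      moreover have "L2_norm M (\<lambda>t. indicator A t *\<^sub>R x - ?u t) < e"
      proof -
        have "L2_norm M (\<lambda>t. indicator A t *\<^sub>R x - ?u t)
            \<le> L2_norm M (\<lambda>t. indicator A t *\<^sub>R x - indicator C t *\<^sub>R x) + L2_norm M (\<lambda>t. indicator C t *\<^sub>R x - ?u t)"
          by (intro L2_norm_triangle3 ind indicator Cs)
        also have "L2_norm M (\<lambda>t. indicator A t *\<^sub>R x - indicator C t *\<^sub>R x)
            = L2_norm M (\<lambda>t. indicator (sym_diff A C) t *\<^sub>R x)"
          unfolding L2_norm_def by (intro arg_cong[where f=sqrt] Bochner_Integration.integral_cong) (auto simp: indicator_def)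
        also have "\<dots> = norm x * sqrt (measure M (sym_diff A C))"
          using indicator Cs by (simp add: L2_norm_scaleR_right L2_norm_indicator)
        also have "\<dots> \<le> norm x * d"
          using C(2) d(1) by (intro mult_left_mono real_le_lsqrt) auto
        also have "L2_norm M (\<lambda>t. indicator C t *\<^sub>R x - ?u t) = norm (x - y) * sqrt (measure M C)"
          using Cs by (simp add: L2_norm_scaleR_right L2_norm_indicator scaleR_right_diff_distrib[symmetric])
        also have "\<dots> \<le> norm (x - y) * s"
          unfolding s_def by (intro mult_left_mono real_sqrt_le_mono bounded_measure) auto
        finally show ?thesis using d(2) sy e by (simp add: dist_norm norm_minus_commute mult.commute)
      qed
      ultimately show "\<exists>u\<in>L2 M. convergent (\<lambda>n. p (r n) u) \<and> L2_norm M (\<lambda>t. indicator A t *\<^sub>R x - u t) < e"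
        using ind[OF Cs] by blast
    qed
  next
    case (add w u)
    then show ?case by (simp add: padd convergent_add)
  next
    case (approx w)
    then show ?case by (rule conv_limit)
  qed
  define \<Phi> where "\<Phi> w = lim (\<lambda>n. p (r n) w)" for w
  have lim: "(\<lambda>n. p (r n) w) \<longlonglongrightarrow> \<Phi> w" if "w \<in> L2 M" for w
    unfolding \<Phi>_def using conv[OF that] by (simp add: convergent_LIMSEQ_iff)
  have Phi: "\<Phi> \<in> L2_dual M"
    unfolding L2_dual_def
  proof (intro CollectI conjI ballI allI)
    fix w u :: "'s \<Rightarrow> 'b \<Rightarrow>\<^sub>L real" assume wu: "w \<in> L2 M" "u \<in> L2 M"
    have "(\<lambda>n. p (r n) w + p (r n) u) \<longlonglongrightarrow> \<Phi> w + \<Phi> u" by (intro tendsto_add lim wu)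
    moreover have "(\<lambda>n. p (r n) w + p (r n) u) \<longlonglongrightarrow> \<Phi> (\<lambda>t. w t + u t)"
      using lim[OF L2_add[OF wu]] by (simp add: padd wu)
    ultimately show "\<Phi> (\<lambda>t. w t + u t) = \<Phi> w + \<Phi> u" by (rule LIMSEQ_unique[symmetric])
  next
    fix c and w :: "'s \<Rightarrow> 'b \<Rightarrow>\<^sub>L real" assume w: "w \<in> L2 M"
    have "(\<lambda>n. c * p (r n) w) \<longlonglongrightarrow> c * \<Phi> w" by (intro tendsto_mult tendsto_const lim w)
    moreover have "(\<lambda>n. c * p (r n) w) \<longlonglongrightarrow> \<Phi> (\<lambda>t. c *\<^sub>R w t)"
      using lim[OF L2_scaleR[OF w]] by (simp add: pscale w)
    ultimately show "\<Phi> (\<lambda>t. c *\<^sub>R w t) = c * \<Phi> w" by (rule LIMSEQ_unique[symmetric])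
  next
    have "\<bar>\<Phi> w\<bar> \<le> B * L2_norm M w" if "w \<in> L2 M" for w
      by (rule tendsto_upperbound[OF tendsto_rabs[OF lim[OF that]]]) (auto intro!: always_eventually pb that)
    then show "\<exists>C. \<forall>w\<in>L2 M. \<bar>\<Phi> w\<bar> \<le> C * L2_norm M w" by blast
  qed
  obtain W where W: "W \<in> L2 M" "\<forall>w\<in>L2 M. \<Phi> w = (\<integral>t. blinfun_apply (W t) (w t) \<partial>M)"
    using L2_dual_representation[OF Phi E Jd] by blast
  \<comment> \<open>Being isometric, \<open>G\<close> preserves strong measurability and norms, and
    it turns pairing with \<open>W t\<close> into evaluation at \<open>l t\<close>.\<close>
  define l where "l t = G (W t)" for t
  have "strongly_measurable M l"
    unfolding l_def[abs_def]
  proof (rule strongly_measurable_compose[OF L2D(1)[OF W(1)]])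
    fix u :: "nat \<Rightarrow> ('b \<Rightarrow>\<^sub>L real) \<Rightarrow>\<^sub>L real" and x assume "u \<longlonglongrightarrow> x"
    then have "(\<lambda>n. dist (u n) x) \<longlonglongrightarrow> 0" by (subst (asm) tendsto_dist_iff)
    then show "(\<lambda>n. G (u n)) \<longlonglongrightarrow> G x" by (subst tendsto_dist_iff) (simp only: Gd)
  qed
  then have l: "l \<in> L2 M" using L2D(2)[OF W(1)] by (simp add: L2_def l_def Gn)
  have "L2_weakly_tendsto M (\<lambda>n. v (r n)) l"
    unfolding L2_weakly_tendsto_def
  proof (intro conjI ballI)
    fix \<Lambda> :: "('s \<Rightarrow> 'b) \<Rightarrow> real" assume L: "\<Lambda> \<in> L2_dual M"
    obtain u where u: "u \<in> L2 M" "\<forall>f\<in>L2 M. \<Lambda> f = (\<integral>t. blinfun_apply (u t) (f t) \<partial>M)"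
      using L2_dual_representation[OF L D E] by blast
    have "\<Lambda> l = \<Phi> u" using bspec[OF u(2) l] bspec[OF W(2) u(1)] by (simp add: l_def G)
    moreover have "\<Lambda> (v (r n)) = p (r n) u" for n using bspec[OF u(2) v] by (simp add: p_def)
    ultimately show "(\<lambda>n. \<Lambda> (v (r n))) \<longlonglongrightarrow> \<Lambda> l" using lim[OF u(1)] by simp
  qed (use v l in auto)
  then show ?thesis by (rule that[OF r(1)])
qed

section \<open>Caratheodory differential equations\<close>

text \<open>Let \<open>S\<close> be the maximum of \<open>h / \<phi>\<close>. At a maximum point the
  weight makes the integral term at most half of \<open>S * \<phi> t0\<close>, which is absorbed on
  the left; this is the origin of the factor 2. General intervals \<open>{a t..b t}\<close> allow
  the forward and the backward inequality to share the argument.\<close>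

lemma weighted_gronwall:
  fixes h \<phi> :: "real \<Rightarrow> real" and a b :: "real \<Rightarrow> real"
  assumes h: "continuous_on {0..1} h" and \<phi>: "continuous_on {0..1} \<phi>" "\<And>t. t \<in> {0..1} \<Longrightarrow> 1 \<le> \<phi> t"
    and J: "\<And>t. t \<in> {0..1} \<Longrightarrow> {a t..b t} \<subseteq> {0..1}"
    and half: "\<And>t. t \<in> {0..1} \<Longrightarrow> K * integral {a t..b t} \<phi> \<le> \<phi> t / 2"
    and c: "0 \<le> c" "0 \<le> K" and le: "\<And>t. t \<in> {0..1} \<Longrightarrow> h t \<le> c + K * integral {a t..b t} h"
    and t: "t \<in> {0..1}"
  shows "h t \<le> 2 * c * \<phi> t"
proof -
  have "continuous_on {0..1} (\<lambda>t. h t / \<phi> t)"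
    using \<phi>(2) by (intro continuous_on_divide h \<phi>(1)) force
  then obtain t0 where t0: "t0 \<in> {0..1}" "\<And>t. t \<in> {0..1} \<Longrightarrow> h t / \<phi> t \<le> h t0 / \<phi> t0"
    using continuous_attains_sup[of "{0..1::real}" "\<lambda>t. h t / \<phi> t"] by auto
  define S where "S = h t0 / \<phi> t0"
  have pos: "0 < \<phi> t" if "t \<in> {0..1}" for t using \<phi>(2)[OF that] by simp
  have hS: "h t \<le> S * \<phi> t" if "t \<in> {0..1}" for t
    using t0(2)[OF that] pos[OF that] by (simp add: S_def field_simps)
  have ht0: "h t0 = S * \<phi> t0" using pos[OF t0(1)] by (simp add: S_def)
  have "S \<le> 2 * c"
  proof (cases "0 \<le> S")
    case True
    have "integral {a t0..b t0} h \<le> integral {a t0..b t0} (\<lambda>s. S * \<phi> s)"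
      using J[OF t0(1)] hS
      by (intro integral_le integrable_continuous_real continuous_intros
          continuous_on_subset[OF h] continuous_on_subset[OF \<phi>(1)]) auto
    then have "K * integral {a t0..b t0} h \<le> K * (S * integral {a t0..b t0} \<phi>)"
      using c(2) by (intro mult_left_mono) simp_all
    also have "\<dots> = S * (K * integral {a t0..b t0} \<phi>)" by simp
    also have "\<dots> \<le> S * (\<phi> t0 / 2)" using True half[OF t0(1)] by (intro mult_left_mono)
    finally have "S * \<phi> t0 \<le> c + S * \<phi> t0 / 2" using le[OF t0(1)] ht0 by simp
    then have "S * \<phi> t0 \<le> 2 * c" by simp
    moreover have "S * 1 \<le> S * \<phi> t0" using True \<phi>(2)[OF t0(1)] by (intro mult_left_mono)
    ultimately show ?thesis by simp
  qed (use c in auto)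
  then have "S * \<phi> t \<le> 2 * c * \<phi> t" using pos[OF t] by (intro mult_right_mono) auto
  then show ?thesis using hS[OF t] by simp
qed

lemma integral_exp_le:
  fixes l :: real assumes "0 < l" "a \<le> b"
  shows "integral {a..b} (\<lambda>s. exp (l * s)) \<le> exp (l * b) / l"
    and "integral {a..b} (\<lambda>s. exp (l * (1 - s))) \<le> exp (l * (1 - a)) / l"
proof -
  have "((\<lambda>s. exp (l * s)) has_integral exp (l * b) / l - exp (l * a) / l) {a..b}"
    using assms by (intro fundamental_theorem_of_calculus)
      (auto intro!: derivative_eq_intros simp flip: has_real_derivative_iff_has_vector_derivative)
  then show "integral {a..b} (\<lambda>s. exp (l * s)) \<le> exp (l * b) / l"
    using assms by (simp add: integral_unique)
  have "((\<lambda>s. exp (l * (1 - s))) has_integral - exp (l * (1 - b)) / l - (- exp (l * (1 - a)) / l)) {a..b}"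
    using assms by (intro fundamental_theorem_of_calculus)
      (auto intro!: derivative_eq_intros simp flip: has_real_derivative_iff_has_vector_derivative)
  then show "integral {a..b} (\<lambda>s. exp (l * (1 - s))) \<le> exp (l * (1 - a)) / l"
    using assms by (simp add: integral_unique)
qed

lemma
  fixes h :: "real \<Rightarrow> real"
  assumes h: "continuous_on {0..1} h" and c: "0 \<le> c" "0 \<le> K" and t: "t \<in> {0..1}"
  shows gronwall_forward: "(\<And>t. t \<in> {0..1} \<Longrightarrow> h t \<le> c + K * integral {0..t} h) \<Longrightarrow> h t \<le> 2 * c * exp (2 * K + 1)"
    and gronwall_backward: "(\<And>t. t \<in> {0..1} \<Longrightarrow> h t \<le> c + K * integral {t..1} h) \<Longrightarrow> h t \<le> 2 * c * exp (2 * K + 1)"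
proof -
  \<comment> \<open>Integrating an exponential weight of rate \<open>?l\<close> costs a factor
    \<open>1 / ?l\<close>, and \<open>K / ?l\<close> is at most one half; the summand 1 keeps the
    rate positive for \<open>K = 0\<close>.\<close>
  let ?l = "2 * K + 1"
  have half: "K * x \<le> y / 2" if "x \<le> y / ?l" "0 \<le> y" for x y :: real
  proof -
    have "K * x \<le> K * (y / ?l)" using that c by (intro mult_left_mono)
    also have "\<dots> \<le> y / 2" using c that by (simp add: field_simps)
    finally show ?thesis .
  qed
  {
    assume *: "\<And>t. t \<in> {0..1} \<Longrightarrow> h t \<le> c + K * integral {0..t} h"
    have "h t \<le> 2 * c * exp (?l * t)"
    proof (rule weighted_gronwall[OF h _ _ _ _ c * t])
      show "K * integral {0..s} (\<lambda>s. exp (?l * s)) \<le> exp (?l * s) / 2" if "s \<in> {0..1}" for s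
        using that c by (intro half integral_exp_le(1)) auto
    qed (use c in \<open>auto intro!: continuous_intros\<close>)
    also have "\<dots> \<le> 2 * c * exp (?l * 1)"
      using c t by (intro mult_left_mono) auto
    finally show "h t \<le> 2 * c * exp ?l" by simp
  }
  {
    assume *: "\<And>t. t \<in> {0..1} \<Longrightarrow> h t \<le> c + K * integral {t..1} h"
    have "h t \<le> 2 * c * exp (?l * (1 - t))"
    proof (rule weighted_gronwall[OF h _ _ _ _ c * t])
      show "K * integral {s..1} (\<lambda>s. exp (?l * (1 - s))) \<le> exp (?l * (1 - s)) / 2" if "s \<in> {0..1}" for s
        using that c by (intro half integral_exp_le(2)) auto
    qed (use c in \<open>auto intro!: continuous_intros\<close>)
    also have "\<dots> \<le> 2 * c * exp (?l * 1)"
      using c t by (intro mult_left_mono) auto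
    finally show "h t \<le> 2 * c * exp ?l" by simp
  }
qed

text \<open>One weight \<open>m\<close> serves as supremum bound and as Lipschitz constant.
  \<open>A\<close> is a parameter instead of the exact square integral, so that different fields can
  share it. Measurability is demanded along continuous curves, the form in which the integral
  equation uses it.\<close>

locale caratheodory_field =
  fixes u :: "real \<Rightarrow> 'a::euclidean_space \<Rightarrow> 'a" and m :: "real \<Rightarrow> real" and A :: real
  assumes meas: "\<And>\<gamma>. continuous_on {0..1} \<gamma> \<Longrightarrow> (\<lambda>s. u s (\<gamma> s)) \<in> borel_measurable (lebesgue_on {0..1})"
    and m_meas: "m \<in> borel_measurable (lebesgue_on {0..1})"
    and m_int: "integrable (lebesgue_on {0..1}) (\<lambda>s. (m s)\<^sup>2)"
    and m_le: "(\<integral>s. (m s)\<^sup>2 \<partial>lebesgue_on {0..1}) \<le> A"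
    and bound: "\<And>s x. s \<in> {0..1} \<Longrightarrow> norm (u s x) \<le> m s"
    and lip: "\<And>s x y. s \<in> {0..1} \<Longrightarrow> norm (u s x - u s y) \<le> m s * norm (x - y)"
begin

lemma A_nonneg: "0 \<le> A"
proof -
  have "0 \<le> (\<integral>s. (m s)\<^sup>2 \<partial>lebesgue_on {0..1})" by (rule integral_nonneg_AE) simp
  then show ?thesis using m_le by linarith
qed

lemma m_nonneg: "s \<in> {0..1} \<Longrightarrow> 0 \<le> m s"
  using bound[of s undefined] norm_ge_zero order_trans by blast

lemma set_integrable_iff: "set_integrable lebesgue {0..1} f \<longleftrightarrow> integrable (lebesgue_on {0..1}) f"
  for f :: "real \<Rightarrow> 'c::euclidean_space"
  by (simp add: set_integrable_def integrable_restrict_space)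

text \<open>Cauchy-Schwarz on a subinterval removes the time-dependent weight \<open>m\<close> at
  the price of \<open>sqrt A\<close>. The bound is stated for \<open>integral\<close>, so the proof
  also matches this integral with the one of the restricted Lebesgue measure.\<close>

lemma mult_continuous:
  assumes w: "continuous_on {0..1} w" and ab: "{a..b} \<subseteq> {0..1}"
  shows "set_integrable lebesgue {0..1} (\<lambda>s. m s * w s)"
    and "0 \<le> integral {a..b} (\<lambda>s. (w s)\<^sup>2)"
    and "\<bar>integral {a..b} (\<lambda>s. m s * w s)\<bar> \<le> sqrt A * sqrt (integral {a..b} (\<lambda>s. (w s)\<^sup>2))"
proof -
  let ?M = "lebesgue_on {0..1::real}"
  have sub: "set_lebesgue_integral lebesgue {a..b} f = (\<integral>s. indicator {a..b} s *\<^sub>R f s \<partial>?M)" for f :: "real \<Rightarrow> real"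
  proof -
    have "indicator {0..1} s *\<^sub>R indicator {a..b} s *\<^sub>R f s = indicator {a..b} s *\<^sub>R f s" for s
      using ab by (auto simp: indicator_def)
    then have "(\<integral>s. indicator {0..1} s *\<^sub>R indicator {a..b} s *\<^sub>R f s \<partial>lebesgue) = set_lebesgue_integral lebesgue {a..b} f"
      by (simp only: set_lebesgue_integral_def)
    moreover have "(\<integral>s. indicator {a..b} s *\<^sub>R f s \<partial>?M) = (\<integral>s. indicator {0..1} s *\<^sub>R indicator {a..b} s *\<^sub>R f s \<partial>lebesgue)"
      by (rule integral_restrict_space) simp
    ultimately show ?thesis by (simp only:)
  qed
  have wm: "w \<in> borel_measurable ?M"
    using w by (intro continuous_imp_measurable_on_sets_lebesgue) auto
  have w2: "set_integrable lebesgue {0..1} (\<lambda>s. (w s)\<^sup>2)"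
    by (intro absolutely_integrable_continuous_real continuous_intros w)
  then have w2i: "integrable ?M (\<lambda>s. (w s)\<^sup>2)" by (simp add: set_integrable_iff)
  show mw: "set_integrable lebesgue {0..1} (\<lambda>s. m s * w s)"
    unfolding set_integrable_iff by (rule integrable_mult_L2[OF m_meas wm m_int w2i])
  \<comment> \<open>Cutting \<open>w\<close> off outside \<open>{a..b}\<close> lets Cauchy-Schwarz
    on the whole unit interval give the estimate on the subinterval.\<close>
  define g where "g s = indicator {a..b} s * w s" for s
  have gm: "g \<in> borel_measurable ?M"
    unfolding g_def[abs_def] using ab
    by (intro borel_measurable_times wm borel_measurable_indicator) (auto simp: sets_restrict_space)
  have g2: "(g s)\<^sup>2 = indicator {a..b} s *\<^sub>R (w s)\<^sup>2" for s by (simp add: g_def indicator_def)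
  have g2i: "integrable ?M (\<lambda>s. (g s)\<^sup>2)"
    unfolding g2 using ab
    by (intro integrable_mult_indicator w2i) (auto simp: sets_restrict_space)
  have e1: "integral {a..b} (\<lambda>s. (w s)\<^sup>2) = (\<integral>s. (g s)\<^sup>2 \<partial>?M)"
    unfolding g2 sub[symmetric]
    by (intro set_lebesgue_integral_eq_integral(2)[symmetric] set_integrable_subset[OF w2 _ ab]) auto
  have e2: "integral {a..b} (\<lambda>s. m s * w s) = (\<integral>s. m s * g s \<partial>?M)"
  proof -
    have "integral {a..b} (\<lambda>s. m s * w s) = set_lebesgue_integral lebesgue {a..b} (\<lambda>s. m s * w s)"
      by (intro set_lebesgue_integral_eq_integral(2)[symmetric] set_integrable_subset[OF mw _ ab]) auto
    also have "\<dots> = (\<integral>s. m s * g s \<partial>?M)"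
      unfolding sub by (simp add: g_def mult_ac)
    finally show ?thesis .
  qed
  show "0 \<le> integral {a..b} (\<lambda>s. (w s)\<^sup>2)" unfolding e1 by (rule integral_nonneg_AE) simp
  have "\<bar>\<integral>s. m s * g s \<partial>?M\<bar> \<le> sqrt (\<integral>s. (m s)\<^sup>2 \<partial>?M) * sqrt (\<integral>s. (g s)\<^sup>2 \<partial>?M)"
    by (rule Cauchy_Schwarz_integral[OF m_meas gm m_int g2i])
  also have "\<dots> \<le> sqrt A * sqrt (\<integral>s. (g s)\<^sup>2 \<partial>?M)"
    using m_le by (intro mult_right_mono) auto
  finally show "\<bar>integral {a..b} (\<lambda>s. m s * w s)\<bar> \<le> sqrt A * sqrt (integral {a..b} (\<lambda>s. (w s)\<^sup>2))"
    unfolding e1 e2 .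
qed

lemma m_set_integrable: "set_integrable lebesgue {0..1} m"
  using mult_continuous(1)[of "\<lambda>_. 1" 0 1] by simp

lemma integrand:
  assumes "continuous_on {0..1} \<gamma>"
  shows "set_integrable lebesgue {0..1} (\<lambda>s. u s (\<gamma> s))"
proof -
  have "integrable (lebesgue_on {0..1}) (\<lambda>s. u s (\<gamma> s))"
    by (rule Bochner_Integration.integrable_bound[OF m_set_integrable[unfolded set_integrable_iff] meas[OF assms]])
      (use bound m_nonneg in \<open>auto simp: space_restrict_space intro!: AE_I2\<close>)
  then show ?thesis by (simp add: set_integrable_iff)
qed

lemma integrand_sub:
  assumes "continuous_on {0..1} \<gamma>" "{a..b} \<subseteq> {0..1}"
  shows "set_integrable lebesgue {a..b} (\<lambda>s. u s (\<gamma> s))"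
    and "(LINT s:{a..b}|lebesgue. u s (\<gamma> s)) = integral {a..b} (\<lambda>s. u s (\<gamma> s))"
    and "(\<lambda>s. u s (\<gamma> s)) integrable_on {a..b}"
proof -
  show 1: "set_integrable lebesgue {a..b} (\<lambda>s. u s (\<gamma> s))"
    by (rule set_integrable_subset[OF integrand[OF assms(1)] _ assms(2)]) auto
  show "(LINT s:{a..b}|lebesgue. u s (\<gamma> s)) = integral {a..b} (\<lambda>s. u s (\<gamma> s))"
    "(\<lambda>s. u s (\<gamma> s)) integrable_on {a..b}"
    using set_lebesgue_integral_eq_integral[OF 1] by auto
qed

text \<open>Along a continuous curve \<open>m\<close> dominates the integrand, so integrability is
  automatic and the set integral may be replaced by \<open>integral\<close>.\<close>

lemma is_trajectory_iff:
  "is_trajectory u x \<gamma> \<longleftrightarrow> continuous_on {0..1} \<gamma> \<and> (\<forall>t\<in>{0..1}. \<gamma> t = x + integral {0..t} (\<lambda>s. u s (\<gamma> s)))"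
  unfolding is_trajectory_def using integrand_sub[of \<gamma> 0] by auto

lemma integral_diff_le:
  assumes g: "continuous_on {0..1} \<gamma>" and d: "continuous_on {0..1} \<delta>" and ab: "{a..b} \<subseteq> {0..1}"
  shows "norm (integral {a..b} (\<lambda>s. u s (\<gamma> s)) - integral {a..b} (\<lambda>s. u s (\<delta> s)))
      \<le> integral {a..b} (\<lambda>s. m s * norm (\<gamma> s - \<delta> s))"
    and "(integral {a..b} (\<lambda>s. m s * norm (\<gamma> s - \<delta> s)))\<^sup>2 \<le> A * integral {a..b} (\<lambda>s. (norm (\<gamma> s - \<delta> s))\<^sup>2)"
proof -
  have w: "continuous_on {0..1} (\<lambda>s. norm (\<gamma> s - \<delta> s))" by (intro continuous_intros g d)
  have "norm (integral {a..b} (\<lambda>s. u s (\<gamma> s) - u s (\<delta> s))) \<le> integral {a..b} (\<lambda>s. m s * norm (\<gamma> s - \<delta> s))"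
  proof (rule integral_norm_bound_integral)
    show "(\<lambda>s. u s (\<gamma> s) - u s (\<delta> s)) integrable_on {a..b}"
      by (intro integrable_diff integrand_sub(3) g d ab)
    show "(\<lambda>s. m s * norm (\<gamma> s - \<delta> s)) integrable_on {a..b}"
      by (rule set_lebesgue_integral_eq_integral(1)[OF set_integrable_subset[OF mult_continuous(1)[OF w ab] _ ab]]) auto
  qed (use ab lip in auto)
  then show "norm (integral {a..b} (\<lambda>s. u s (\<gamma> s)) - integral {a..b} (\<lambda>s. u s (\<delta> s)))
      \<le> integral {a..b} (\<lambda>s. m s * norm (\<gamma> s - \<delta> s))"
    by (simp add: Henstock_Kurzweil_Integration.integral_diff integrand_sub(3)[OF g ab] integrand_sub(3)[OF d ab])
  have "\<bar>integral {a..b} (\<lambda>s. m s * norm (\<gamma> s - \<delta> s))\<bar>\<^sup>2 \<le> (sqrt A * sqrt (integral {a..b} (\<lambda>s. (norm (\<gamma> s - \<delta> s))\<^sup>2)))\<^sup>2"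
    by (intro power_mono mult_continuous(3)[OF w ab]) auto
  then show "(integral {a..b} (\<lambda>s. m s * norm (\<gamma> s - \<delta> s)))\<^sup>2 \<le> A * integral {a..b} (\<lambda>s. (norm (\<gamma> s - \<delta> s))\<^sup>2)"
    using mult_continuous(2)[OF w ab] A_nonneg by (simp add: power_mult_distrib)
qed

lemma sum_square_le: "(p + q)\<^sup>2 \<le> 2 * p\<^sup>2 + 2 * q\<^sup>2" for p q :: real
  using sum_squares_bound[of p q] by (simp add: power2_sum)

text \<open>The squared distance \<open>h\<close> satisfies a Gronwall inequality with kernel
  \<open>2 * A\<close>. Started at time 0 it bounds the flow and gives uniqueness; run back from
  time 1 it bounds the inverse.\<close>

lemma trajectory_diff:
  assumes g: "is_trajectory u x \<gamma>" and d: "is_trajectory u y \<delta>"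
  shows "norm (\<gamma> 1 - \<delta> 1) \<le> 2 * exp (2 * A + 1) * norm (x - y)"
    and "norm (x - y) \<le> 2 * exp (2 * A + 1) * norm (\<gamma> 1 - \<delta> 1)"
    and "x = y \<Longrightarrow> t \<in> {0..1} \<Longrightarrow> \<gamma> t = \<delta> t"
proof -
  have gc: "continuous_on {0..1} \<gamma>" and dc: "continuous_on {0..1} \<delta>"
    and ge: "\<And>t. t \<in> {0..1} \<Longrightarrow> \<gamma> t = x + integral {0..t} (\<lambda>s. u s (\<gamma> s))"
    and de: "\<And>t. t \<in> {0..1} \<Longrightarrow> \<delta> t = y + integral {0..t} (\<lambda>s. u s (\<delta> s))"
    using g d by (auto simp: is_trajectory_iff)
  define h where "h t = (norm (\<gamma> t - \<delta> t))\<^sup>2" for t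
  have h: "continuous_on {0..1} h" unfolding h_def by (intro continuous_intros gc dc)
  have est: "(norm p)\<^sup>2 \<le> 2 * (norm q)\<^sup>2 + 2 * A * integral {a..b} h"
    if p: "norm p \<le> norm q + norm (integral {a..b} (\<lambda>s. u s (\<gamma> s)) - integral {a..b} (\<lambda>s. u s (\<delta> s)))"
      and ab: "{a..b} \<subseteq> {0..1}" for p q :: 'a and a b
  proof -
    have "norm p \<le> norm q + integral {a..b} (\<lambda>s. m s * norm (\<gamma> s - \<delta> s))"
      using p integral_diff_le(1)[OF gc dc ab] by linarith
    then have "(norm p)\<^sup>2 \<le> (norm q + integral {a..b} (\<lambda>s. m s * norm (\<gamma> s - \<delta> s)))\<^sup>2"
      by (intro power_mono) auto
    also have "\<dots> \<le> 2 * (norm q)\<^sup>2 + 2 * (integral {a..b} (\<lambda>s. m s * norm (\<gamma> s - \<delta> s)))\<^sup>2"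
      by (rule sum_square_le)
    finally show ?thesis using integral_diff_le(2)[OF gc dc ab] by (simp add: h_def[abs_def])
  qed
  have fwd: "h t \<le> 2 * (2 * (norm (x - y))\<^sup>2) * exp (2 * (2 * A) + 1)" if t: "t \<in> {0..1}" for t
  proof (rule gronwall_forward[OF h _ _ t])
    fix t :: real assume t: "t \<in> {0..1}"
    have "\<gamma> t - \<delta> t = (x - y) + (integral {0..t} (\<lambda>s. u s (\<gamma> s)) - integral {0..t} (\<lambda>s. u s (\<delta> s)))"
      using ge[OF t] de[OF t] by simp
    then have "norm (\<gamma> t - \<delta> t) \<le> norm (x - y) + norm (integral {0..t} (\<lambda>s. u s (\<gamma> s)) - integral {0..t} (\<lambda>s. u s (\<delta> s)))"
      by (metis norm_triangle_ineq)
    from est[OF this] t show "h t \<le> 2 * (norm (x - y))\<^sup>2 + 2 * A * integral {0..t} h" by (simp add: h_def)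
  qed (use A_nonneg in auto)
  have bwd: "h t \<le> 2 * (2 * (norm (\<gamma> 1 - \<delta> 1))\<^sup>2) * exp (2 * (2 * A) + 1)" if t: "t \<in> {0..1}" for t
  proof (rule gronwall_backward[OF h _ _ t])
    fix t :: real assume t: "t \<in> {0..1}"
    have comb: "integral {0..1} (\<lambda>s. u s (\<eta> s)) = integral {0..t} (\<lambda>s. u s (\<eta> s)) + integral {t..1} (\<lambda>s. u s (\<eta> s))"
      if "continuous_on {0..1} \<eta>" for \<eta>
      using t that by (intro Henstock_Kurzweil_Integration.integral_combine[symmetric] integrand_sub(3)) auto
    have "\<gamma> t - \<delta> t = (\<gamma> 1 - \<delta> 1) - (integral {t..1} (\<lambda>s. u s (\<gamma> s)) - integral {t..1} (\<lambda>s. u s (\<delta> s)))"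
      using ge[OF t] de[OF t] ge[of 1] de[of 1] comb[OF gc] comb[OF dc] by simp
    then have "norm (\<gamma> t - \<delta> t) \<le> norm (\<gamma> 1 - \<delta> 1) + norm (integral {t..1} (\<lambda>s. u s (\<gamma> s)) - integral {t..1} (\<lambda>s. u s (\<delta> s)))"
      by (metis norm_triangle_ineq4)
    from est[OF this] t show "h t \<le> 2 * (norm (\<gamma> 1 - \<delta> 1))\<^sup>2 + 2 * A * integral {t..1} h" by (simp add: h_def)
  qed (use A_nonneg in auto)
  \<comment> \<open>Gronwall gives the factor \<open>4 * exp (4 * A + 1)\<close> for squares, which
    is at most the square of \<open>2 * exp (2 * A + 1)\<close>.\<close>
  have root: "p \<le> 2 * exp (2 * A + 1) * q" if "p\<^sup>2 \<le> 2 * (2 * q\<^sup>2) * exp (2 * (2 * A) + 1)" "0 \<le> q" for p q :: real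
  proof (rule power2_le_imp_le)
    have "(2 * exp (2 * A + 1) * q)\<^sup>2 = 2 * (2 * q\<^sup>2) * exp (2 * (2 * A + 1))"
      by (simp add: power_mult_distrib exp_double[symmetric])
    moreover have "2 * (2 * q\<^sup>2) * exp (2 * (2 * A) + 1) \<le> 2 * (2 * q\<^sup>2) * exp (2 * (2 * A + 1))"
      by (intro mult_left_mono) auto
    ultimately show "p\<^sup>2 \<le> (2 * exp (2 * A + 1) * q)\<^sup>2" using that(1) by linarith
  qed (use that(2) in simp)
  show "norm (\<gamma> 1 - \<delta> 1) \<le> 2 * exp (2 * A + 1) * norm (x - y)"
    by (rule root) (use fwd[of 1] in \<open>auto simp: h_def\<close>)
  have "h 0 = (norm (x - y))\<^sup>2" using ge[of 0] de[of 0] by (simp add: h_def)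
  then show "norm (x - y) \<le> 2 * exp (2 * A + 1) * norm (\<gamma> 1 - \<delta> 1)"
    by (intro root) (use bwd[of 0] in auto)
  show "\<gamma> t = \<delta> t" if "x = y" "t \<in> {0..1}"
    using fwd[OF that(2)] that(1) by (simp add: h_def)
qed

end

text \<open>The constant of \<open>trajectory_diff\<close>; it bounds the time-one flow and its
  inverse alike and depends only on \<open>A\<close>.\<close>

definition flow_lip :: "real \<Rightarrow> real" where "flow_lip A = 2 * exp (2 * A + 1)"

lemma flow_lip_pos: "0 < flow_lip A"
  by (simp add: flow_lip_def)

section \<open>Existence of trajectories, bijectivity and stability of the flow\<close>

context caratheodory_field
begin

lemma integral_u_le:
  assumes "continuous_on {0..1} \<gamma>" "t \<in> {0..1}"
  shows "norm (integral {0..t} (\<lambda>s. u s (\<gamma> s))) \<le> sqrt A"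
proof -
  have sub: "{0..t} \<subseteq> {0..1}" using assms(2) by auto
  have one: "continuous_on {0..1} (\<lambda>_::real. 1::real)" by simp
  note mc = mult_continuous[OF one sub]
  have "norm (integral {0..t} (\<lambda>s. u s (\<gamma> s))) \<le> integral {0..t} (\<lambda>s. m s * 1)"
  proof (rule integral_norm_bound_integral)
    show "(\<lambda>s. u s (\<gamma> s)) integrable_on {0..t}" by (rule integrand_sub(3)[OF assms(1) sub])
    show "(\<lambda>s. m s * 1) integrable_on {0..t}"
      by (rule set_lebesgue_integral_eq_integral(1)[OF set_integrable_subset[OF mc(1) _ sub]]) auto
  qed (use sub bound in auto)
  also have "\<dots> \<le> sqrt A * sqrt (integral {0..t} (\<lambda>s. 1\<^sup>2))" using mc(3) by linarith
  also have "\<dots> \<le> sqrt A * 1" using assms(2) A_nonneg by (intro mult_left_mono) auto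
  finally show ?thesis by simp
qed

text \<open>Rescaling by \<open>exp (- l t)\<close> makes the Picard map a contraction on the whole of \<open>[0, 1]\<close>.\<close>

lemma trajectory_exists: "\<exists>\<gamma>. is_trajectory u x \<gamma>"
proof -
  \<comment> \<open>The squared contraction factor of the rescaled Picard map comes out as
    \<open>A / (2 * l)\<close>; this choice makes it at most a quarter, and the summand 1 keeps
    \<open>l\<close> positive for \<open>A = 0\<close>.\<close>
  define l where "l = 2 * A + 1"
  have l: "0 < l" "A / (2 * l) \<le> (1/2)\<^sup>2" using A_nonneg by (auto simp: l_def field_simps power2_eq_square)
  \<comment> \<open>Clamping time to the unit interval turns a continuous function on it into a
    bounded continuous function on the real line, so the fixed point can be sought in the complete
    space of such functions.\<close>
  define c where "c t = max 0 (min 1 t)" for t :: real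
  have c01: "c t \<in> {0..1}" for t by (auto simp: c_def)
  have cc: "continuous_on UNIV c" unfolding c_def by (intro continuous_intros)
  \<comment> \<open>\<open>X\<close> undoes the rescaling: a fixed point \<open>\<eta>\<close> of
    the rescaled map corresponds to the trajectory \<open>X \<eta>\<close>.\<close>
  define X where "X \<eta> s = exp (l * s) *\<^sub>R apply_bcontfun \<eta> s" for \<eta> :: "real \<Rightarrow>\<^sub>C 'a" and s
  have Xc: "continuous_on S (X \<eta>)" for S \<eta>
    unfolding X_def[abs_def] by (intro continuous_intros continuous_on_subset[OF continuous_on_apply_bcontfun]) auto
  define Q where "Q \<eta> t = exp (- l * t) *\<^sub>R (x + integral {0..t} (\<lambda>s. u s (X \<eta> s)))" for \<eta> t
  have Qc: "continuous_on {0..1} (Q \<eta>)" for \<eta>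
    unfolding Q_def[abs_def]
    by (intro continuous_intros indefinite_integral_continuous_1 integrand_sub(3)[OF Xc]) auto
  have Pb: "(\<lambda>t. Q \<eta> (c t)) \<in> bcontfun" for \<eta>
  proof -
    have "compact (Q \<eta> ` {0..1})" by (rule compact_continuous_image[OF Qc]) simp
    then obtain B where B: "\<And>y. y \<in> Q \<eta> ` {0..1} \<Longrightarrow> norm y \<le> B"
      using compact_imp_bounded bounded_iff by metis
    show ?thesis
    proof (rule bcontfun_normI)
      show "continuous_on UNIV (\<lambda>t. Q \<eta> (c t))"
        by (rule continuous_on_compose2[OF Qc cc]) (use c01 in auto)
      show "norm (Q \<eta> (c t)) \<le> B" for t using c01 by (intro B) blast
    qed
  qed
  define P where "P \<eta> = Bcontfun (\<lambda>t. Q \<eta> (c t))" for \<eta>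
  have P: "apply_bcontfun (P \<eta>) t = Q \<eta> (c t)" for \<eta> t
    unfolding P_def by (simp add: Bcontfun_inverse Pb)
  have "dist (P \<eta>) (P \<eta>') \<le> (1/2) * dist \<eta> \<eta>'" for \<eta> \<eta>'
  proof (rule dist_bound)
    fix t0
    define t where "t = c t0"
    have t: "t \<in> {0..1}" unfolding t_def by (rule c01)
    then have sub: "{0..t} \<subseteq> {0..1}" by auto
    define d where "d = dist \<eta> \<eta>'"
    define N where "N = norm (integral {0..t} (\<lambda>s. u s (X \<eta> s)) - integral {0..t} (\<lambda>s. u s (X \<eta>' s)))"
    have "N\<^sup>2 \<le> (integral {0..t} (\<lambda>s. m s * norm (X \<eta> s - X \<eta>' s)))\<^sup>2"
      unfolding N_def by (intro power_mono integral_diff_le(1) Xc sub) auto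
    also have "\<dots> \<le> A * integral {0..t} (\<lambda>s. (norm (X \<eta> s - X \<eta>' s))\<^sup>2)"
      by (intro integral_diff_le(2) Xc sub)
    also have "integral {0..t} (\<lambda>s. (norm (X \<eta> s - X \<eta>' s))\<^sup>2) \<le> integral {0..t} (\<lambda>s. d\<^sup>2 * exp ((2 * l) * s))"
    proof (rule integral_le)
      show "(norm (X \<eta> s - X \<eta>' s))\<^sup>2 \<le> d\<^sup>2 * exp ((2 * l) * s)" for s
      proof -
        have "norm (X \<eta> s - X \<eta>' s) = exp (l * s) * dist (apply_bcontfun \<eta> s) (apply_bcontfun \<eta>' s)"
          by (simp add: X_def dist_norm scaleR_right_diff_distrib[symmetric])
        also have "\<dots> \<le> exp (l * s) * d" unfolding d_def by (intro mult_left_mono dist_bounded) auto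
        finally have "(norm (X \<eta> s - X \<eta>' s))\<^sup>2 \<le> (exp (l * s) * d)\<^sup>2" by (intro power_mono) auto
        also have "\<dots> = d\<^sup>2 * exp ((2 * l) * s)"
          by (simp add: power_mult_distrib exp_double[symmetric] mult_ac)
        finally show ?thesis .
      qed
    qed (intro integrable_continuous_real continuous_intros Xc)+
    also have "integral {0..t} (\<lambda>s. d\<^sup>2 * exp ((2 * l) * s)) \<le> d\<^sup>2 * (exp ((2 * l) * t) / (2 * l))"
      using mult_left_mono[OF integral_exp_le(1)[of "2 * l" 0 t], of "d\<^sup>2"] l t by simp
    finally have N2: "N\<^sup>2 \<le> A * (d\<^sup>2 * (exp ((2 * l) * t) / (2 * l)))"
      using A_nonneg by (simp add: mult_left_mono)
    have "dist (Q \<eta> t) (Q \<eta>' t) = exp (- l * t) * N"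
      by (simp add: Q_def N_def dist_norm scaleR_right_diff_distrib[symmetric])
    then have "(dist (Q \<eta> t) (Q \<eta>' t))\<^sup>2 = (exp (- l * t))\<^sup>2 * N\<^sup>2" by (simp add: power_mult_distrib)
    also have "\<dots> \<le> (exp (- l * t))\<^sup>2 * (A * (d\<^sup>2 * (exp ((2 * l) * t) / (2 * l))))"
      by (intro mult_left_mono N2) auto
    also have "\<dots> = ((exp (- l * t))\<^sup>2 * exp ((2 * l) * t)) * (d\<^sup>2 * (A / (2 * l)))" by simp
    also have "(exp (- l * t))\<^sup>2 * exp ((2 * l) * t) = 1"
      by (simp add: exp_double[symmetric] exp_add[symmetric])
    also have "1 * (d\<^sup>2 * (A / (2 * l))) \<le> d\<^sup>2 * (1/2)\<^sup>2"
      using mult_left_mono[OF l(2), of "d\<^sup>2"] by simp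
    also have "\<dots> = ((1/2) * d)\<^sup>2" by (simp add: power2_eq_square)
    finally have "dist (Q \<eta> t) (Q \<eta>' t) \<le> (1/2) * d"
      by (rule power2_le_imp_le) (simp add: d_def)
    then show "dist (apply_bcontfun (P \<eta>) t0) (apply_bcontfun (P \<eta>') t0) \<le> (1/2) * dist \<eta> \<eta>'"
      by (simp add: P t_def d_def)
  qed
  then have "\<exists>!\<eta>. P \<eta> = \<eta>" by (intro banach_fix_type[of "1/2"]) auto
  then obtain \<eta> where \<eta>: "P \<eta> = \<eta>" by blast
  have "X \<eta> t = x + integral {0..t} (\<lambda>s. u s (X \<eta> s))" if "t \<in> {0..1}" for t
  proof -
    have "c t = t" using that by (auto simp: c_def)
    then have "apply_bcontfun \<eta> t = Q \<eta> t" using P[of \<eta> t] \<eta> by simp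
    then have "X \<eta> t = exp (l * t) *\<^sub>R exp (- l * t) *\<^sub>R (x + integral {0..t} (\<lambda>s. u s (X \<eta> s)))"
      by (simp add: X_def[of \<eta> t] Q_def)
    then show ?thesis by (simp add: exp_minus_inverse[symmetric] exp_add[symmetric])
  qed
  then show ?thesis unfolding is_trajectory_iff using Xc by (intro exI[of _ "X \<eta>"]) blast
qed

lemma flow_eq:
  assumes "is_trajectory u x \<gamma>" "t \<in> {0..1}"
  shows "flow u t x = \<gamma> t"
  unfolding flow_def
  by (rule the_equality) (use assms trajectory_diff(3) in blast)+

lemma flow_lipschitz: "norm (flow u 1 x - flow u 1 y) \<le> flow_lip A * norm (x - y)"
  and flow_inverse_lipschitz: "norm (x - y) \<le> flow_lip A * norm (flow u 1 x - flow u 1 y)"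
proof -
  obtain \<gamma> \<delta> where "is_trajectory u x \<gamma>" "is_trajectory u y \<delta>" using trajectory_exists by metis
  then show "norm (flow u 1 x - flow u 1 y) \<le> flow_lip A * norm (x - y)"
    "norm (x - y) \<le> flow_lip A * norm (flow u 1 x - flow u 1 y)"
    using trajectory_diff(1,2)[of x \<gamma> y \<delta>] flow_eq[of x \<gamma> 1] flow_eq[of y \<delta> 1] by (simp_all add: flow_lip_def)
qed

text \<open>Surjectivity is topological: the range is open by invariance of domain, and closed
  because the inverse Lipschitz bound makes preimages of a convergent sequence Cauchy; the space is
  connected. No time-reversed equation has to be solved.\<close>

lemma bij_flow: "bij (flow u 1)"
proof -
  let ?f = "flow u 1"
  have inj: "inj ?f"
  proof (rule injI)
    fix x y assume "?f x = ?f y"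
    then show "x = y" using flow_inverse_lipschitz[of x y] by simp
  qed
  have "(flow_lip A)-lipschitz_on UNIV ?f"
    using flow_lipschitz flow_lip_pos[of A] by (intro lipschitz_onI) (auto simp: dist_norm)
  then have cont: "continuous_on UNIV ?f" by (rule lipschitz_on_continuous_on)
  have "open (range ?f)" by (rule invariance_of_domain[OF cont open_UNIV inj])
  moreover have "closed (range ?f)"
    unfolding closed_sequential_limits
  proof (intro allI impI, elim conjE)
    fix s y assume s: "\<forall>n. s n \<in> range ?f" "s \<longlonglongrightarrow> y"
    then have "\<forall>n. \<exists>z. s n = ?f z" by blast
    then obtain x where x: "\<And>n. s n = ?f (x n)" by (auto dest: choice)
    have "Cauchy x"
    proof (rule metric_CauchyI)
      fix e :: real assume "0 < e"
      then have "0 < e / flow_lip A" using flow_lip_pos[of A] by simp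
      then obtain N where N: "\<And>m n. N \<le> m \<Longrightarrow> N \<le> n \<Longrightarrow> dist (s m) (s n) < e / flow_lip A"
        using metric_CauchyD[OF LIMSEQ_imp_Cauchy[OF s(2)]] by metis
      show "\<exists>N. \<forall>m\<ge>N. \<forall>n\<ge>N. dist (x m) (x n) < e"
      proof (intro exI allI impI)
        fix m n assume "N \<le> m" "N \<le> n"
        from N[OF this] have "flow_lip A * dist (s m) (s n) < e"
          using flow_lip_pos[of A] by (simp add: pos_less_divide_eq mult.commute)
        then show "dist (x m) (x n) < e"
          using flow_inverse_lipschitz[of "x m" "x n"] by (simp add: x dist_norm)
      qed
    qed
    then obtain z where "x \<longlonglongrightarrow> z" using Cauchy_convergent_iff convergent_def by blast
    then have "(\<lambda>n. ?f (x n)) \<longlonglongrightarrow> ?f z" by (rule continuous_on_tendsto_compose[OF cont]) auto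
    moreover have "s = (\<lambda>n. ?f (x n))" using x by (rule ext)
    ultimately have "s \<longlonglongrightarrow> ?f z" by (simp only:)
    then have "?f z = y" using s(2) by (rule LIMSEQ_unique)
    then show "y \<in> range ?f" by blast
  qed
  ultimately have "range ?f = UNIV" using clopen[of "range ?f"] by auto
  then show ?thesis using inj by (simp add: bij_def)
qed

lemma flow_fixed:
  assumes "\<And>s. s \<in> {0..1} \<Longrightarrow> u s x = 0"
  shows "flow u 1 x = x"
proof -
  have "is_trajectory u x (\<lambda>_. x)"
    unfolding is_trajectory_iff
  proof (intro conjI ballI continuous_on_const)
    fix t :: real assume "t \<in> {0..1}"
    then have "integral {0..t} (\<lambda>s. u s x) = integral {0..t} (\<lambda>s. 0)"
      using assms by (intro Henstock_Kurzweil_Integration.integral_cong) auto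
    then show "x = x + integral {0..t} (\<lambda>s. u s x)" by simp
  qed
  then show ?thesis using flow_eq[of x "\<lambda>_. x" 1] by simp
qed

text \<open>Points outside \<Omega> are stationary, so the global bijection is the identity on the
  complement and must map \<Omega> onto itself.\<close>

lemma bij_betw_flow:
  assumes "\<And>s x. s \<in> {0..1} \<Longrightarrow> x \<notin> \<Omega> \<Longrightarrow> u s x = 0"
  shows "bij_betw (flow u 1) \<Omega> \<Omega>"
proof -
  have fixed: "flow u 1 x = x" if "x \<notin> \<Omega>" for x using assms that by (intro flow_fixed)
  have inj: "flow u 1 x = flow u 1 y \<Longrightarrow> x = y" for x y
    using bij_is_inj[OF bij_flow] by (rule injD)
  have "flow u 1 ` \<Omega> = \<Omega>"
  proof (intro equalityI subsetI)
    fix y assume "y \<in> flow u 1 ` \<Omega>"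
    then obtain x where "x \<in> \<Omega>" "y = flow u 1 x" by blast
    then show "y \<in> \<Omega>" using fixed[of y] inj[of y x] by metis
  next
    fix y assume "y \<in> \<Omega>"
    obtain x where "y = flow u 1 x" using bij_is_surj[OF bij_flow] by (rule surjE)
    then show "y \<in> flow u 1 ` \<Omega>" using fixed[of x] \<open>y \<in> \<Omega>\<close> by (cases "x \<in> \<Omega>") auto
  qed
  then show ?thesis using inj by (auto simp: bij_betw_def inj_on_def)
qed

text \<open>Both fields are compared along the single curve \<open>\<gamma>\<close>: the difference
  of the trajectories is \<open>r\<close>, the error of the driving integrals on
  \<open>\<gamma>\<close>, plus a term that the Lipschitz property of \<open>u'\<close> controls.
  The bound involves only \<open>r 1\<close> and the square integral of \<open>r\<close>, so
  pointwise convergence of \<open>r\<close> can be exploited without uniformity in time.\<close>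

lemma flow_stability:
  assumes u': "caratheodory_field u' m' A" and g: "is_trajectory u x \<gamma>"
  defines "r \<equiv> \<lambda>t. integral {0..t} (\<lambda>s. u' s (\<gamma> s)) - integral {0..t} (\<lambda>s. u s (\<gamma> s))"
  shows "(norm (flow u' 1 x - flow u 1 x))\<^sup>2
    \<le> 2 * (norm (r 1))\<^sup>2 + 2 * A * (2 * (2 * integral {0..1} (\<lambda>t. (norm (r t))\<^sup>2)) * exp (2 * (2 * A) + 1))"
proof -
  interpret u': caratheodory_field u' m' A by fact
  obtain \<delta> where d: "is_trajectory u' x \<delta>" using u'.trajectory_exists by blast
  have gc: "continuous_on {0..1} \<gamma>" and dc: "continuous_on {0..1} \<delta>"
    and ge: "\<And>t. t \<in> {0..1} \<Longrightarrow> \<gamma> t = x + integral {0..t} (\<lambda>s. u s (\<gamma> s))"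
    and de: "\<And>t. t \<in> {0..1} \<Longrightarrow> \<delta> t = x + integral {0..t} (\<lambda>s. u' s (\<delta> s))"
    using g d by (auto simp: is_trajectory_iff u'.is_trajectory_iff)
  define h where "h t = (norm (\<delta> t - \<gamma> t))\<^sup>2" for t
  have hc: "continuous_on {0..1} h" unfolding h_def by (intro continuous_intros gc dc)
  have rc: "continuous_on {0..1} r"
    unfolding r_def
    by (intro continuous_intros indefinite_integral_continuous_1 integrand_sub(3)[OF gc] u'.integrand_sub(3)[OF gc]) auto
  have est: "h t \<le> 2 * (norm (r t))\<^sup>2 + 2 * A * integral {0..t} h" if t: "t \<in> {0..1}" for t
  proof -
    have ab: "{0..t} \<subseteq> {0..1}" using t by auto
    let ?N = "integral {0..t} (\<lambda>s. m' s * norm (\<delta> s - \<gamma> s))"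
    have "\<delta> t - \<gamma> t = r t + (integral {0..t} (\<lambda>s. u' s (\<delta> s)) - integral {0..t} (\<lambda>s. u' s (\<gamma> s)))"
      unfolding ge[OF t] de[OF t] r_def by (simp only: algebra_simps add_diff_cancel_left)
    then have "norm (\<delta> t - \<gamma> t)
        \<le> norm (r t) + norm (integral {0..t} (\<lambda>s. u' s (\<delta> s)) - integral {0..t} (\<lambda>s. u' s (\<gamma> s)))"
      by (metis norm_triangle_ineq)
    also have "\<dots> \<le> norm (r t) + ?N"
      by (intro add_left_mono u'.integral_diff_le(1)[OF dc gc ab])
    finally have "norm (\<delta> t - \<gamma> t) \<le> norm (r t) + ?N" .
    then have "h t \<le> (norm (r t) + ?N)\<^sup>2" unfolding h_def by (intro power_mono) auto
    also have "\<dots> \<le> 2 * (norm (r t))\<^sup>2 + 2 * ?N\<^sup>2" by (rule sum_square_le)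
    finally show ?thesis using u'.integral_diff_le(2)[OF dc gc ab] by (simp add: h_def[abs_def])
  qed
  \<comment> \<open>The forcing term in the inequality for \<open>h\<close> varies with time.
    Integrating once bounds it by the constant \<open>c\<close>, so Gronwall applies to the
    primitive \<open>W\<close>; \<open>W 1\<close> is then inserted into the estimate for
    \<open>h 1\<close>.\<close>
  define W where "W t = integral {0..t} h" for t
  have Wc: "continuous_on {0..1} W"
    unfolding W_def by (intro indefinite_integral_continuous_1 integrable_continuous_real hc)
  define c where "c = 2 * integral {0..1} (\<lambda>t. (norm (r t))\<^sup>2)"
  have r2: "continuous_on {0..1} (\<lambda>t. (norm (r t))\<^sup>2)" by (intro continuous_intros rc)
  have c: "0 \<le> c" unfolding c_def by (simp add: integral_nonneg integrable_continuous_real r2)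
  have "W 1 \<le> 2 * c * exp (2 * (2 * A) + 1)"
  proof (rule gronwall_forward[OF Wc c])
    fix t :: real assume t: "t \<in> {0..1}"
    have sub: "{0..t} \<subseteq> {0..1}" using t by auto
    note on = integrable_continuous_real continuous_intros continuous_on_subset[OF hc sub]
      continuous_on_subset[OF r2 sub] continuous_on_subset[OF Wc sub]
    have "W t \<le> integral {0..t} (\<lambda>s. 2 * (norm (r s))\<^sup>2 + 2 * A * W s)"
      unfolding W_def[of t]
    proof (rule integral_le)
      show "h s \<le> 2 * (norm (r s))\<^sup>2 + 2 * A * W s" if "s \<in> {0..t}" for s
        using est[of s] that t by (auto simp: W_def)
    qed (intro on)+
    also have "\<dots> = 2 * integral {0..t} (\<lambda>s. (norm (r s))\<^sup>2) + 2 * A * integral {0..t} W"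
      by (subst Henstock_Kurzweil_Integration.integral_add) (intro on | simp)+
    also have "integral {0..t} (\<lambda>s. (norm (r s))\<^sup>2) \<le> integral {0..1} (\<lambda>s. (norm (r s))\<^sup>2)"
      by (intro integral_subset_le sub integrable_continuous_real r2 continuous_on_subset[OF r2 sub]) auto
    finally show "W t \<le> c + 2 * A * integral {0..t} W" by (simp add: c_def)
  qed (use A_nonneg in auto)
  then have "2 * A * W 1 \<le> 2 * A * (2 * c * exp (2 * (2 * A) + 1))" using A_nonneg by (intro mult_left_mono) auto
  then have "h 1 \<le> 2 * (norm (r 1))\<^sup>2 + 2 * A * (2 * c * exp (2 * (2 * A) + 1))"
    using est[of 1] by (simp add: W_def)
  then show ?thesis using flow_eq[OF g, of 1] u'.flow_eq[OF d, of 1] by (simp add: h_def c_def)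
qed

text \<open>The errors \<open>r n t\<close> tend to 0 for each \<open>t\<close> and are bounded by
  \<open>2 * sqrt A\<close>, since each driving integral is bounded by \<open>sqrt A\<close>;
  dominated convergence makes the right-hand side of \<open>flow_stability\<close> vanish.\<close>

lemma flow_tendsto:
  assumes un: "\<And>n. caratheodory_field (un n) (mn n) A" and g: "is_trajectory u x \<gamma>"
    and lim: "\<And>t. t \<in> {0..1} \<Longrightarrow> (\<lambda>n. integral {0..t} (\<lambda>s. un n s (\<gamma> s))) \<longlonglongrightarrow> integral {0..t} (\<lambda>s. u s (\<gamma> s))"
  shows "(\<lambda>n. flow (un n) 1 x) \<longlonglongrightarrow> flow u 1 x"
proof -
  define r where "r n t = integral {0..t} (\<lambda>s. un n s (\<gamma> s)) - integral {0..t} (\<lambda>s. u s (\<gamma> s))" for n t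
  have gc: "continuous_on {0..1} \<gamma>" using g by (simp add: is_trajectory_iff)
  have r0: "(\<lambda>n. (norm (r n t))\<^sup>2) \<longlonglongrightarrow> 0" if "t \<in> {0..1}" for t
  proof -
    have "(\<lambda>n. r n t) \<longlonglongrightarrow> 0" unfolding r_def by (rule LIM_zero[OF lim[OF that]])
    then have "(\<lambda>n. (norm (r n t))\<^sup>2) \<longlonglongrightarrow> (norm (0::'a))\<^sup>2" by (intro tendsto_power tendsto_norm)
    then show ?thesis by simp
  qed
  have rc: "continuous_on {0..1} (r n)" for n
    unfolding r_def[abs_def]
    by (intro continuous_intros indefinite_integral_continuous_1 integrand_sub(3)[OF gc]
        caratheodory_field.integrand_sub(3)[OF un gc]) auto
  have "(\<lambda>n. integral {0..1} (\<lambda>t. (norm (r n t))\<^sup>2)) \<longlonglongrightarrow> integral {0..1} (\<lambda>t::real. 0)"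
  proof (rule dominated_convergence(2)[where h="\<lambda>_::real. (2 * sqrt A)\<^sup>2"])
    show "(\<lambda>t. (norm (r n t))\<^sup>2) integrable_on {0..1}" for n
      by (intro integrable_continuous_real continuous_intros rc)
    show "norm ((norm (r n t))\<^sup>2) \<le> (2 * sqrt A)\<^sup>2" if "t \<in> {0..1}" for n t
    proof -
      have "norm (r n t) \<le> 2 * sqrt A"
        using norm_triangle_ineq4[of "integral {0..t} (\<lambda>s. un n s (\<gamma> s))" "integral {0..t} (\<lambda>s. u s (\<gamma> s))"]
          integral_u_le[OF gc that] caratheodory_field.integral_u_le[OF un gc that, of n]
        unfolding r_def by linarith
      then have "(norm (r n t))\<^sup>2 \<le> (2 * sqrt A)\<^sup>2" by (intro power_mono) auto
      then show ?thesis by simp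
    qed
  qed (use r0 in auto)
  then have I: "(\<lambda>n. integral {0..1} (\<lambda>t. (norm (r n t))\<^sup>2)) \<longlonglongrightarrow> 0" by simp
  have "(\<lambda>n. 2 * (norm (r n 1))\<^sup>2 + 2 * A * (2 * (2 * integral {0..1} (\<lambda>t. (norm (r n t))\<^sup>2)) * exp (2 * (2 * A) + 1)))
      \<longlonglongrightarrow> 2 * 0 + 2 * A * (2 * (2 * 0) * exp (2 * (2 * A) + 1))"
    by (intro tendsto_intros r0 I) simp
  then have "(\<lambda>n. 2 * (norm (r n 1))\<^sup>2 + 2 * A * (2 * (2 * integral {0..1} (\<lambda>t. (norm (r n t))\<^sup>2)) * exp (2 * (2 * A) + 1)))
      \<longlonglongrightarrow> 0" by simp
  moreover have "norm ((norm (flow (un n) 1 x - flow u 1 x))\<^sup>2)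
      \<le> 2 * (norm (r n 1))\<^sup>2 + 2 * A * (2 * (2 * integral {0..1} (\<lambda>t. (norm (r n t))\<^sup>2)) * exp (2 * (2 * A) + 1))" for n
    using flow_stability[OF un[of n] g] by (simp add: r_def)
  ultimately have "(\<lambda>n. (norm (flow (un n) 1 x - flow u 1 x))\<^sup>2) \<longlonglongrightarrow> 0"
    by (rule Lim_null_comparison[OF always_eventually, rotated, OF _ allI])
  then have "(\<lambda>n. sqrt ((norm (flow (un n) 1 x - flow u 1 x))\<^sup>2)) \<longlonglongrightarrow> sqrt 0" by (rule tendsto_real_sqrt)
  then have "(\<lambda>n. norm (flow (un n) 1 x - flow u 1 x)) \<longlonglongrightarrow> 0" by simp
  then show ?thesis by (rule LIM_zero_cancel[OF tendsto_norm_zero_cancel])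
qed

end

section \<open>Composition with inverses of Lipschitz maps\<close>

lemma negligible_lipschitz_image:
  fixes f :: "'a::euclidean_space \<Rightarrow> 'a"
  assumes "\<And>x y. norm (f x - f y) \<le> L * norm (x - y)" "negligible N"
  shows "negligible (f ` N)"
  by (rule negligible_locally_Lipschitz_image[OF _ assms(2)])
    (use assms(1) in \<open>auto intro!: exI[of _ UNIV] exI[of _ L]\<close>)

text \<open>
  Vitali's theorem covers an open set up to a null set by disjoint balls, and a ball of radius
  \<open>r\<close> is mapped into a ball of radius \<open>L r\<close>.
\<close>

lemma emeasure_lipschitz_image_open:
  fixes f :: "'a::euclidean_space \<Rightarrow> 'a"
  assumes f: "\<And>x y. norm (f x - f y) \<le> L * norm (x - y)" and L: "0 < L" and U: "open U"
  shows "\<exists>G\<in>sets lebesgue. f ` U \<subseteq> G \<and> emeasure lebesgue G \<le> ennreal (L ^ DIM('a)) * emeasure lebesgue U"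
proof -
  define K where "K = {(x :: 'a, r :: real). 0 < r \<and> ball x r \<subseteq> U}"
  have V: "\<exists>i. i \<in> K \<and> x \<in> ball (fst i) (snd i) \<and> snd i < d" if x: "x \<in> U" and d: "0 < d" for x d
  proof -
    obtain e where e: "0 < e" "ball x e \<subseteq> U" using U x openE by blast
    have "ball x (min e (d / 2)) \<subseteq> ball x e" by (rule subset_ball) simp
    then have "ball x (min e (d / 2)) \<subseteq> U" using e(2) by (rule order_trans)
    then show ?thesis
      using e d by (intro exI[of _ "(x, min e (d / 2))"]) (auto simp: K_def)
  qed
  obtain C where C: "countable C" "C \<subseteq> K"
    "pairwise (\<lambda>i j. disjnt (ball (fst i) (snd i)) (ball (fst j) (snd j))) C"
    "negligible (U - (\<Union>i\<in>C. ball (fst i) (snd i)))"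
  proof (rule Vitali_covering_theorem_balls[of U K fst snd, OF V])
    fix C assume "countable C" "C \<subseteq> K"
      "pairwise (\<lambda>i j. disjnt (ball (fst i) (snd i)) (ball (fst j) (snd j))) C"
      "negligible (U - (\<Union>i\<in>C. ball (fst i) (snd i)))"
    then show thesis by (rule that)
  qed
  \<comment> \<open>The remainder left by the covering is null, and so is its image, since Lipschitz
    maps of the space into itself preserve null sets.\<close>
  define N where "N = U - (\<Union>i\<in>C. ball (fst i) (snd i))"
  define H where "H = (\<Union>i\<in>C. ball (f (fst i)) (L * snd i))"
  have neg: "negligible (f ` N)"
    using C(4) unfolding N_def by (rule negligible_lipschitz_image[OF f])
  have "open H" unfolding H_def by auto
  then have Hl: "H \<in> sets lebesgue" by auto
  have cover: "f ` U \<subseteq> H \<union> f ` N"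
  proof
    fix y assume "y \<in> f ` U"
    then obtain x where x: "x \<in> U" "y = f x" by blast
    show "y \<in> H \<union> f ` N"
    proof (cases "x \<in> N")
      case False
      then obtain i where i: "i \<in> C" "x \<in> ball (fst i) (snd i)" using x by (auto simp: N_def)
      have "norm (f (fst i) - f x) \<le> L * norm (fst i - x)" by (rule f)
      also have "\<dots> < L * snd i" using i(2) L by (simp add: dist_norm)
      finally show ?thesis using i(1) x(2) by (auto simp: H_def dist_norm)
    qed (use x in auto)
  qed
  define I where "I = to_nat_on C ` C"
  define c where "c = inv_into C (to_nat_on C)"
  have c: "c n \<in> C" "to_nat_on C (c n) = n" if "n \<in> I" for n
    using that by (auto simp: I_def c_def inv_into_into f_inv_into_f)
  have cI: "\<exists>n\<in>I. c n = i" if "i \<in> C" for i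
    using that inv_into_f_f[OF inj_on_to_nat_on[OF C(1)] that] by (auto simp: I_def c_def)
  define B where "B n = (if n \<in> I then ball (fst (c n)) (snd (c n)) else {})" for n
  define B' where "B' n = (if n \<in> I then ball (f (fst (c n))) (L * snd (c n)) else {})" for n
  have open_sets: "S \<in> sets lebesgue" if "open S" for S :: "'a set" using that by auto
  have Bl: "B n \<in> sets lebesgue" "B' n \<in> sets lebesgue" for n by (auto simp: B_def B'_def open_sets)
  have eB: "emeasure lebesgue (B' n) = ennreal (L ^ DIM('a)) * emeasure lebesgue (B n)" for n
  proof (cases "n \<in> I")
    case True
    have "0 < snd (c n)" using c(1)[OF True] C(2) by (auto simp: K_def)
    then show ?thesis
      using True L by (simp add: B_def B'_def emeasure_ball power_mult_distrib ennreal_mult'[symmetric] mult_ac)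
  qed (simp add: B_def B'_def)
  have disj: "disjoint_family B"
    unfolding disjoint_family_on_def
  proof (intro ballI impI)
    fix i j :: nat assume "i \<noteq> j"
    show "B i \<inter> B j = {}"
    proof (cases "i \<in> I \<and> j \<in> I")
      case True
      then have "c i \<noteq> c j" using c(2) \<open>i \<noteq> j\<close> by metis
      then have "disjnt (ball (fst (c i)) (snd (c i))) (ball (fst (c j)) (snd (c j)))"
        using C(3) c(1) True by (auto simp: pairwise_def)
      then show ?thesis using True by (simp add: B_def disjnt_def)
    qed (auto simp: B_def)
  qed
  have HB: "H = (\<Union>n. B' n)"
  proof -
    have "c ` I = C" using c(1) cI by blast
    then have "H = (\<Union>i\<in>c ` I. ball (f (fst i)) (L * snd i))" by (simp only: H_def)
    then show ?thesis by (auto simp: B'_def split: if_splits)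
  qed
  have "emeasure lebesgue H \<le> (\<Sum>n. emeasure lebesgue (B' n))"
    unfolding HB using Bl by (intro emeasure_subadditive_countably) auto
  also have "\<dots> = ennreal (L ^ DIM('a)) * (\<Sum>n. emeasure lebesgue (B n))"
    unfolding eB by simp
  also have "(\<Sum>n. emeasure lebesgue (B n)) = emeasure lebesgue (\<Union>n. B n)"
    using Bl disj by (intro suminf_emeasure) auto
  also have "\<dots> \<le> emeasure lebesgue U"
  proof (rule emeasure_mono)
    have "B n \<subseteq> U" for n
    proof (cases "n \<in> I")
      case True
      then have "c n \<in> K" using c(1) C(2) by blast
      then show ?thesis by (auto simp: B_def K_def)
    qed (simp add: B_def)
    then show "(\<Union>n. B n) \<subseteq> U" by (rule UN_least)
  qed (rule open_sets[OF U])
  finally have "emeasure lebesgue H \<le> ennreal (L ^ DIM('a)) * emeasure lebesgue U"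
    by (simp add: mult_left_mono)
  moreover have "f ` N \<in> null_sets lebesgue" using neg by (simp add: negligible_iff_null_sets)
  ultimately show ?thesis
    using cover Hl by (intro bexI[of _ "H \<union> f ` N"]) (auto simp: emeasure_Un_null_set null_setsD2)
qed

text \<open>Outer regularity reduces the estimate to open sets. The excess of the open set is kept
  below \<open>e / L ^ DIM('a)\<close>, so that it contributes at most \<open>e\<close> after
  scaling.\<close>

lemma
  fixes f :: "'a::euclidean_space \<Rightarrow> 'a"
  assumes f: "\<And>x y. norm (f x - f y) \<le> L * norm (x - y)" and L: "0 < L" and S: "S \<in> sets lebesgue"
  shows sets_lebesgue_lipschitz_image: "f ` S \<in> sets lebesgue"
    and emeasure_lipschitz_image: "emeasure lebesgue (f ` S) \<le> ennreal (L ^ DIM('a)) * emeasure lebesgue S"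
proof -
  have "L-lipschitz_on S f" using f L by (intro lipschitz_onI) (auto simp: dist_norm)
  then have cont: "continuous_on S f" by (rule lipschitz_on_continuous_on)
  show "f ` S \<in> sets lebesgue"
    by (rule sets_lebesgue_continuous_image[OF S cont]) (auto intro: negligible_lipschitz_image[OF f])
  have Ld: "0 < L ^ DIM('a)" using L by simp
  show "emeasure lebesgue (f ` S) \<le> ennreal (L ^ DIM('a)) * emeasure lebesgue S"
  proof (rule ennreal_le_epsilon)
    fix e :: real assume e: "0 < e"
    obtain U where U: "open U" "S \<subseteq> U" "U - S \<in> lmeasurable" "emeasure lebesgue (U - S) < ennreal (e / L ^ DIM('a))"
      using sets_lebesgue_outer_open[OF S, of "e / L ^ DIM('a)"] e Ld by auto
    obtain G where G: "G \<in> sets lebesgue" "f ` U \<subseteq> G" "emeasure lebesgue G \<le> ennreal (L ^ DIM('a)) * emeasure lebesgue U"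
      using emeasure_lipschitz_image_open[OF f L U(1)] by metis
    have "emeasure lebesgue (f ` S) \<le> emeasure lebesgue G" using G U(2) by (intro emeasure_mono) auto
    also note G(3)
    also have "emeasure lebesgue U \<le> emeasure lebesgue S + emeasure lebesgue (U - S)"
      using emeasure_subadditive[OF S fmeasurableD[OF U(3)]] U(2) by (simp add: Un_absorb1)
    also have "\<dots> \<le> emeasure lebesgue S + ennreal (e / L ^ DIM('a))"
      using U(4) by (intro add_left_mono) simp
    also have "ennreal (L ^ DIM('a)) * (emeasure lebesgue S + ennreal (e / L ^ DIM('a)))
        = ennreal (L ^ DIM('a)) * emeasure lebesgue S + ennreal e"
      using L Ld e by (simp add: distrib_left ennreal_mult'[symmetric])
    finally show "emeasure lebesgue (f ` S) \<le> ennreal (L ^ DIM('a)) * emeasure lebesgue S + ennreal e"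
      by (simp add: mult_left_mono)
  qed
qed


text \<open>The preimage of \<open>A\<close> under the inverse is the image of \<open>A\<close>
  under \<open>\<phi>\<close>. Hence the pushforward of Lebesgue measure by the inverse is at most
  \<open>L ^ DIM('a)\<close> times Lebesgue measure, which replaces the change of variables
  formula.\<close>

lemma
  fixes \<phi> :: "'a::euclidean_space \<Rightarrow> 'a"
  assumes \<phi>: "\<And>x y. norm (\<phi> x - \<phi> y) \<le> L * norm (x - y)" and L: "0 < L"
    and \<Omega>: "\<Omega> \<in> sets lebesgue" and bij: "bij_betw \<phi> \<Omega> \<Omega>"
  shows measurable_inv_into_lipschitz: "inv_into \<Omega> \<phi> \<in> lebesgue_on \<Omega> \<rightarrow>\<^sub>M lebesgue_on \<Omega>"
    and nn_integral_inv_into_lipschitz: "f \<in> borel_measurable (lebesgue_on \<Omega>) \<Longrightarrow>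
      (\<integral>\<^sup>+x. f (inv_into \<Omega> \<phi> x) \<partial>lebesgue_on \<Omega>) \<le> ennreal (L ^ DIM('a)) * (\<integral>\<^sup>+x. f x \<partial>lebesgue_on \<Omega>)"
proof -
  let ?M = "lebesgue_on \<Omega>"
  have img: "\<phi> ` \<Omega> = \<Omega>" and inj: "inj_on \<phi> \<Omega>" using bij by (auto simp: bij_betw_def)
  have pre: "inv_into \<Omega> \<phi> -` A \<inter> \<Omega> = \<phi> ` A" if "A \<subseteq> \<Omega>" for A
  proof (intro equalityI subsetI)
    fix x assume "x \<in> inv_into \<Omega> \<phi> -` A \<inter> \<Omega>"
    then show "x \<in> \<phi> ` A" using f_inv_into_f[of x \<phi> \<Omega>] img by (metis IntD1 IntD2 image_eqI vimageD)
  next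
    fix x assume "x \<in> \<phi> ` A"
    then obtain y where "y \<in> A" "x = \<phi> y" by blast
    then show "x \<in> inv_into \<Omega> \<phi> -` A \<inter> \<Omega>" using that img inv_into_f_f[OF inj, of y] by auto
  qed
  have setsM: "A \<in> sets ?M \<longleftrightarrow> A \<in> sets lebesgue \<and> A \<subseteq> \<Omega>" for A
    using \<Omega> by (auto simp: sets_restrict_space)
  show m: "inv_into \<Omega> \<phi> \<in> ?M \<rightarrow>\<^sub>M ?M"
  proof (rule measurableI)
    show "inv_into \<Omega> \<phi> x \<in> space ?M" if "x \<in> space ?M" for x
      using inv_into_into[of x \<phi> \<Omega>] img that by (simp add: space_restrict_space)
    show "inv_into \<Omega> \<phi> -` A \<inter> space ?M \<in> sets ?M" if "A \<in> sets ?M" for A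
    proof -
      have A: "A \<in> sets lebesgue" "A \<subseteq> \<Omega>" using that by (auto simp: setsM)
      have "\<phi> ` A \<in> sets lebesgue" by (rule sets_lebesgue_lipschitz_image[OF \<phi> L A(1)])
      moreover have "\<phi> ` A \<subseteq> \<Omega>" using A(2) img by blast
      ultimately show ?thesis using pre[OF A(2)] by (simp add: space_restrict_space setsM)
    qed
  qed
  have le: "distr ?M ?M (inv_into \<Omega> \<phi>) \<le> scale_measure (ennreal (L ^ DIM('a))) ?M"
  proof (subst le_measure)
    show "\<forall>A\<in>sets (distr ?M ?M (inv_into \<Omega> \<phi>)). emeasure (distr ?M ?M (inv_into \<Omega> \<phi>)) A
        \<le> emeasure (scale_measure (ennreal (L ^ DIM('a))) ?M) A"
    proof
      fix A assume "A \<in> sets (distr ?M ?M (inv_into \<Omega> \<phi>))"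
      then have AM: "A \<in> sets ?M" by simp
      then have A: "A \<in> sets lebesgue" "A \<subseteq> \<Omega>" by (auto simp: setsM)
      have "\<phi> ` A \<subseteq> \<Omega>" using A(2) img by blast
      then have "emeasure (distr ?M ?M (inv_into \<Omega> \<phi>)) A = emeasure lebesgue (\<phi> ` A)"
        using \<Omega> by (simp add: emeasure_distr[OF m AM] pre[OF A(2)] space_restrict_space emeasure_restrict_space)
      also have "\<dots> \<le> ennreal (L ^ DIM('a)) * emeasure lebesgue A"
        by (rule emeasure_lipschitz_image[OF \<phi> L A(1)])
      also have "\<dots> = emeasure (scale_measure (ennreal (L ^ DIM('a))) ?M) A"
        using \<Omega> A by (simp add: emeasure_restrict_space)
      finally show "emeasure (distr ?M ?M (inv_into \<Omega> \<phi>)) A \<le> emeasure (scale_measure (ennreal (L ^ DIM('a))) ?M) A" .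
    qed
  qed simp
  assume f: "f \<in> borel_measurable ?M"
  have "(\<integral>\<^sup>+x. f (inv_into \<Omega> \<phi> x) \<partial>?M) = (\<integral>\<^sup>+x. f x \<partial>distr ?M ?M (inv_into \<Omega> \<phi>))"
    by (rule nn_integral_distr[OF m, symmetric]) (use f in simp)
  also have "\<dots> \<le> (\<integral>\<^sup>+x. f x \<partial>scale_measure (ennreal (L ^ DIM('a))) ?M)"
    by (rule nn_integral_mono_measure[OF _ le]) simp
  also have "\<dots> = ennreal (L ^ DIM('a)) * (\<integral>\<^sup>+x. f x \<partial>?M)"
    by (rule nn_integral_scale_measure[OF f])
  finally show "(\<integral>\<^sup>+x. f (inv_into \<Omega> \<phi> x) \<partial>?M) \<le> ennreal (L ^ DIM('a)) * (\<integral>\<^sup>+x. f x \<partial>?M)" .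
qed

section \<open>Composition operators on square-integrable functions\<close>

lemma
  fixes \<phi> :: "'a::euclidean_space \<Rightarrow> 'a" and T :: "'a \<Rightarrow> real"
  assumes \<phi>: "\<And>x y. norm (\<phi> x - \<phi> y) \<le> L * norm (x - y)" and L: "0 < L"
    and \<Omega>: "\<Omega> \<in> lmeasurable" and bij: "bij_betw \<phi> \<Omega> \<Omega>" and T: "T \<in> L2 (lebesgue_on \<Omega>)"
  shows L2_compose: "(\<lambda>x. T (inv_into \<Omega> \<phi> x)) \<in> L2 (lebesgue_on \<Omega>)"
    and L2_norm_compose: "L2_norm (lebesgue_on \<Omega>) (\<lambda>x. T (inv_into \<Omega> \<phi> x)) \<le> sqrt (L ^ DIM('a)) * L2_norm (lebesgue_on \<Omega>) T"
proof -
  let ?M = "lebesgue_on \<Omega>" and ?\<psi> = "inv_into \<Omega> \<phi>"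
  interpret finite_complete_measure ?M by (rule finite_complete_measure_lebesgue_on[OF \<Omega>])
  have Tm: "T \<in> borel_measurable ?M" by (rule L2_real_measurable[OF T])
  have m: "?\<psi> \<in> ?M \<rightarrow>\<^sub>M ?M" by (rule measurable_inv_into_lipschitz[OF \<phi> L fmeasurableD[OF \<Omega>] bij])
  have Tc: "(\<lambda>x. T (?\<psi> x)) \<in> borel_measurable ?M" by (rule measurable_compose[OF m Tm])
  have "(\<integral>\<^sup>+x. ennreal ((T (?\<psi> x))\<^sup>2) \<partial>?M) \<le> ennreal (L ^ DIM('a)) * (\<integral>\<^sup>+x. ennreal ((T x)\<^sup>2) \<partial>?M)"
    using Tm by (intro nn_integral_inv_into_lipschitz[OF \<phi> L fmeasurableD[OF \<Omega>] bij]) simp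
  also have "\<dots> = ennreal (L ^ DIM('a) * (L2_norm ?M T)\<^sup>2)"
    using L by (simp add: nn_integral_eq_integral L2_real_integrable[OF T] L2_norm_power2 ennreal_mult')
  finally have le: "(\<integral>\<^sup>+x. ennreal ((T (?\<psi> x))\<^sup>2) \<partial>?M) \<le> ennreal (L ^ DIM('a) * (L2_norm ?M T)\<^sup>2)" .
  then have "integrable ?M (\<lambda>x. (T (?\<psi> x))\<^sup>2)"
    using Tc by (intro integrableI_bounded) (auto intro: le_less_trans)
  then show L2c: "(\<lambda>x. T (?\<psi> x)) \<in> L2 ?M" by (rule L2_realI[OF Tc])
  have "(L2_norm ?M (\<lambda>x. T (?\<psi> x)))\<^sup>2 \<le> L ^ DIM('a) * (L2_norm ?M T)\<^sup>2"
    using le L by (simp add: nn_integral_eq_integral L2_real_integrable[OF L2c] L2_norm_power2)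
  then have "sqrt ((L2_norm ?M (\<lambda>x. T (?\<psi> x)))\<^sup>2) \<le> sqrt (L ^ DIM('a) * (L2_norm ?M T)\<^sup>2)"
    by (rule real_sqrt_le_mono)
  then show "L2_norm ?M (\<lambda>x. T (?\<psi> x)) \<le> sqrt (L ^ DIM('a)) * L2_norm ?M T"
    by (simp add: real_sqrt_mult)
qed

text \<open>\<open>T\<close> is clamped at a height \<open>k\<close> that loses little in norm.
  Continuous functions converging to \<open>T\<close> almost everywhere are clamped at the same
  height, so the constant \<open>2 * k\<close> dominates and pointwise convergence becomes
  convergence in norm.\<close>

lemma L2_approx_bounded_continuous:
  fixes T :: "'a::euclidean_space \<Rightarrow> real"
  assumes \<Omega>: "\<Omega> \<in> lmeasurable" and T: "T \<in> L2 (lebesgue_on \<Omega>)" and e: "0 < e"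
  obtains S B where "continuous_on UNIV S" "\<And>x. \<bar>S x\<bar> \<le> B" "S \<in> L2 (lebesgue_on \<Omega>)"
    "L2_norm (lebesgue_on \<Omega>) (\<lambda>x. T x - S x) < e"
proof -
  let ?M = "lebesgue_on \<Omega>"
  interpret finite_complete_measure ?M by (rule finite_complete_measure_lebesgue_on[OF \<Omega>])
  have \<Omega>l: "\<Omega> \<in> sets lebesgue" by (rule fmeasurableD[OF \<Omega>])
  have Tm: "T \<in> borel_measurable ?M" by (rule L2_real_measurable[OF T])
  define cl where "cl k y = max (- real k) (min (real k) y)" for k y
  have clb: "\<bar>cl k y\<bar> \<le> real k" for k y by (auto simp: cl_def)
  have cldiff: "\<bar>cl k y - y\<bar> \<le> \<bar>y\<bar>" for k y by (auto simp: cl_def)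
  have clm: "(\<lambda>x. cl k (T x)) \<in> borel_measurable ?M" for k unfolding cl_def using Tm by measurable
  have "(\<lambda>k. L2_norm ?M (\<lambda>x. cl k (T x) - T x)) \<longlonglongrightarrow> 0"
  proof (rule L2_dominated_convergence[OF _ L2D(1)[OF T] L2_norm_in_L2[OF T]])
    show "strongly_measurable ?M (\<lambda>x. cl k (T x))" for k
      by (rule borel_measurable_imp_strongly_measurable[OF clm])
    show "AE x in ?M. (\<lambda>k. cl k (T x)) \<longlonglongrightarrow> T x"
    proof (rule AE_I2)
      fix x
      obtain K where K: "\<bar>T x\<bar> \<le> real K" using real_arch_simple by blast
      have "\<forall>\<^sub>F k in sequentially. cl k (T x) = T x"
        using K by (intro eventually_sequentiallyI[of K]) (auto simp: cl_def)
      then show "(\<lambda>k. cl k (T x)) \<longlonglongrightarrow> T x" by (rule tendsto_eventually)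
    qed
  qed (use cldiff in auto)
  then obtain k where k: "L2_norm ?M (\<lambda>x. cl k (T x) - T x) < e / 2"
    using order_tendstoD(2)[of _ 0 sequentially "e / 2"] e by (auto simp: eventually_sequentially)
  have "T measurable_on \<Omega>" using Tm \<Omega>l by (simp add: measurable_on_iff_borel_measurable)
  then obtain N g where N: "negligible N" and g: "\<And>n. continuous_on UNIV (g n)"
    and lim: "\<And>x. x \<notin> N \<Longrightarrow> (\<lambda>n. g n x) \<longlonglongrightarrow> (if x \<in> \<Omega> then T x else 0)"
    unfolding measurable_on_def by blast
  have clc: "continuous_on UNIV (cl k)" unfolding cl_def by (intro continuous_intros)
  have gc: "continuous_on UNIV (\<lambda>x. cl k (g n x))" for n
    by (rule continuous_on_compose2[OF clc g]) auto
  have gm: "strongly_measurable ?M (\<lambda>x. cl k (g n x))" for n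
    using continuous_on_subset[OF gc] \<Omega>l
    by (intro borel_measurable_imp_strongly_measurable continuous_imp_measurable_on_sets_lebesgue) auto
  have "(\<lambda>n. L2_norm ?M (\<lambda>x. cl k (g n x) - cl k (T x))) \<longlonglongrightarrow> 0"
  proof (rule L2_dominated_convergence[OF gm borel_measurable_imp_strongly_measurable[OF clm]])
    show "(\<lambda>_. 2 * real k) \<in> L2 ?M" by (intro L2_bounded[of _ "2 * real k"] strongly_measurable_const) auto
    have "N \<inter> \<Omega> \<in> null_sets ?M"
      using N \<Omega>l by (auto simp: null_sets_restrict_space negligible_iff_null_sets[symmetric] negligible_Int)
    then show "AE x in ?M. (\<lambda>n. cl k (g n x)) \<longlonglongrightarrow> cl k (T x)"
    proof (rule AE_I', safe)
      fix x assume x: "x \<in> space ?M" and "\<not> (\<lambda>n. cl k (g n x)) \<longlonglongrightarrow> cl k (T x)"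
      then have "\<not> (\<lambda>n. g n x) \<longlonglongrightarrow> T x" using continuous_on_tendsto_compose[OF clc] by auto
      then show "x \<in> N" "x \<in> \<Omega>" using x lim[of x] by (auto simp: space_restrict_space)
    qed
    show "AE x in ?M. norm (cl k (g n x) - cl k (T x)) \<le> 2 * real k" for n
    proof (rule AE_I2)
      fix x show "norm (cl k (g n x) - cl k (T x)) \<le> 2 * real k"
        using clb[of k "g n x"] clb[of k "T x"] by simp
    qed
  qed
  then obtain n where n: "L2_norm ?M (\<lambda>x. cl k (g n x) - cl k (T x)) < e / 2"
    using order_tendstoD(2)[of _ 0 sequentially "e / 2"] e by (auto simp: eventually_sequentially)
  have L2g: "(\<lambda>x. cl k (g n x)) \<in> L2 ?M" using clb by (intro L2_bounded[OF gm]) auto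
  have L2T: "(\<lambda>x. cl k (T x)) \<in> L2 ?M"
    using clb by (intro L2_bounded[OF borel_measurable_imp_strongly_measurable[OF clm]]) auto
  have "L2_norm ?M (\<lambda>x. T x - cl k (g n x)) \<le> L2_norm ?M (\<lambda>x. T x - cl k (T x)) + L2_norm ?M (\<lambda>x. cl k (T x) - cl k (g n x))"
    by (rule L2_norm_triangle3[OF T L2T L2g])
  also have "\<dots> < e" using n k L2_norm_diff_commute[of ?M T "\<lambda>x. cl k (T x)"]
      L2_norm_diff_commute[of ?M "\<lambda>x. cl k (T x)" "\<lambda>x. cl k (g n x)"] by linarith
  finally show ?thesis by (rule that[OF gc clb L2g])
qed

theorem L2_compose_tendsto:
  fixes \<phi> :: "nat \<Rightarrow> 'a::euclidean_space \<Rightarrow> 'a" and T :: "'a \<Rightarrow> real"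
  assumes \<phi>: "\<And>n x y. norm (\<phi> n x - \<phi> n y) \<le> L * norm (x - y)" "\<And>n. bij_betw (\<phi> n) \<Omega> \<Omega>"
    and \<phi>': "\<And>x y. norm (\<phi>' x - \<phi>' y) \<le> L * norm (x - y)" "bij_betw \<phi>' \<Omega> \<Omega>"
    and L: "0 < L" and \<Omega>: "\<Omega> \<in> lmeasurable" and T: "T \<in> L2 (lebesgue_on \<Omega>)"
    and lim: "\<And>x. x \<in> \<Omega> \<Longrightarrow> (\<lambda>n. inv_into \<Omega> (\<phi> n) x) \<longlonglongrightarrow> inv_into \<Omega> \<phi>' x"
  shows "(\<lambda>n. L2_norm (lebesgue_on \<Omega>) (\<lambda>x. T (inv_into \<Omega> (\<phi> n) x) - T (inv_into \<Omega> \<phi>' x))) \<longlonglongrightarrow> 0"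
proof (rule LIMSEQ_I)
  fix e :: real assume e: "0 < e"
  let ?M = "lebesgue_on \<Omega>"
  interpret finite_complete_measure ?M by (rule finite_complete_measure_lebesgue_on[OF \<Omega>])
  \<comment> \<open>\<open>R\<close> bounds the norm of composition with the inverse of any of the
    maps involved. Approximating \<open>T\<close> within \<open>e / (3 * R)\<close> therefore costs
    at most \<open>e / 3\<close> before and after the passage to the limit.\<close>
  define R where "R = sqrt (L ^ DIM('a))"
  have R: "0 < R" using L by (simp add: R_def)
  obtain S B where S: "continuous_on UNIV S" "\<And>x. \<bar>S x\<bar> \<le> B" "S \<in> L2 ?M" "L2_norm ?M (\<lambda>x. T x - S x) < e / (3 * R)"
    using L2_approx_bounded_continuous[OF \<Omega> T, of "e / (3 * R)"] e R by auto
  note D = L2_diff[OF T S(3)]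
  have small: "L2_norm ?M (\<lambda>x. T (inv_into \<Omega> f x) - S (inv_into \<Omega> f x)) < e / 3"
    if f: "\<And>x y. norm (f x - f y) \<le> L * norm (x - y)" "bij_betw f \<Omega> \<Omega>" for f
  proof -
    have "L2_norm ?M (\<lambda>x. T (inv_into \<Omega> f x) - S (inv_into \<Omega> f x)) \<le> R * L2_norm ?M (\<lambda>x. T x - S x)"
      using L2_norm_compose[OF f(1) L \<Omega> f(2) D] by (simp add: R_def)
    also have "\<dots> < R * (e / (3 * R))" using S(4) R by (intro mult_strict_left_mono)
    finally show ?thesis using R by simp
  qed
  have Tn: "(\<lambda>x. T (inv_into \<Omega> (\<phi> n) x)) \<in> L2 ?M" and Sn: "(\<lambda>x. S (inv_into \<Omega> (\<phi> n) x)) \<in> L2 ?M" for n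
    using L2_compose[OF \<phi>(1) L \<Omega> \<phi>(2)] T S(3) by auto
  have T0: "(\<lambda>x. T (inv_into \<Omega> \<phi>' x)) \<in> L2 ?M" and S0: "(\<lambda>x. S (inv_into \<Omega> \<phi>' x)) \<in> L2 ?M"
    using L2_compose[OF \<phi>'(1) L \<Omega> \<phi>'(2)] T S(3) by auto
  have "(\<lambda>n. L2_norm ?M (\<lambda>x. S (inv_into \<Omega> (\<phi> n) x) - S (inv_into \<Omega> \<phi>' x))) \<longlonglongrightarrow> 0"
  proof (rule L2_dominated_convergence[OF L2D(1)[OF Sn] L2D(1)[OF S0]])
    show "(\<lambda>_. 2 * B) \<in> L2 ?M" by (rule L2_bounded[of _ "\<bar>2 * B\<bar>"]) (auto intro: strongly_measurable_const)
    show "AE x in ?M. (\<lambda>n. S (inv_into \<Omega> (\<phi> n) x)) \<longlonglongrightarrow> S (inv_into \<Omega> \<phi>' x)"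
      by (rule AE_I2) (auto simp: space_restrict_space intro!: continuous_on_tendsto_compose[OF S(1)] lim)
    show "AE x in ?M. norm (S (inv_into \<Omega> (\<phi> n) x) - S (inv_into \<Omega> \<phi>' x)) \<le> 2 * B" for n
    proof (rule AE_I2)
      fix x show "norm (S (inv_into \<Omega> (\<phi> n) x) - S (inv_into \<Omega> \<phi>' x)) \<le> 2 * B"
        using S(2)[of "inv_into \<Omega> (\<phi> n) x"] S(2)[of "inv_into \<Omega> \<phi>' x"] by simp
    qed
  qed
  then obtain N where N: "\<And>n. N \<le> n \<Longrightarrow> L2_norm ?M (\<lambda>x. S (inv_into \<Omega> (\<phi> n) x) - S (inv_into \<Omega> \<phi>' x)) < e / 3"
    using order_tendstoD(2)[of _ 0 sequentially "e / 3"] e by (auto simp: eventually_sequentially)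
  show "\<exists>no. \<forall>n\<ge>no. norm (L2_norm ?M (\<lambda>x. T (inv_into \<Omega> (\<phi> n) x) - T (inv_into \<Omega> \<phi>' x)) - 0) < e"
  proof (intro exI allI impI)
    fix n assume "N \<le> n"
    have "L2_norm ?M (\<lambda>x. T (inv_into \<Omega> (\<phi> n) x) - T (inv_into \<Omega> \<phi>' x))
        \<le> L2_norm ?M (\<lambda>x. T (inv_into \<Omega> (\<phi> n) x) - S (inv_into \<Omega> (\<phi> n) x))
          + L2_norm ?M (\<lambda>x. S (inv_into \<Omega> (\<phi> n) x) - T (inv_into \<Omega> \<phi>' x))"
      by (rule L2_norm_triangle3[OF Tn Sn T0])
    moreover have "L2_norm ?M (\<lambda>x. S (inv_into \<Omega> (\<phi> n) x) - T (inv_into \<Omega> \<phi>' x))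
        \<le> L2_norm ?M (\<lambda>x. S (inv_into \<Omega> (\<phi> n) x) - S (inv_into \<Omega> \<phi>' x))
          + L2_norm ?M (\<lambda>x. S (inv_into \<Omega> \<phi>' x) - T (inv_into \<Omega> \<phi>' x))"
      by (rule L2_norm_triangle3[OF Sn S0 T0])
    moreover have "L2_norm ?M (\<lambda>x. S (inv_into \<Omega> \<phi>' x) - T (inv_into \<Omega> \<phi>' x)) < e / 3"
      using small[OF \<phi>'] L2_norm_diff_commute[of ?M "\<lambda>x. S (inv_into \<Omega> \<phi>' x)"] by simp
    ultimately have "L2_norm ?M (\<lambda>x. T (inv_into \<Omega> (\<phi> n) x) - T (inv_into \<Omega> \<phi>' x)) < e"
      using small[OF \<phi>(1) \<phi>(2), of n] N[OF \<open>N \<le> n\<close>] by linarith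
    then show "norm (L2_norm ?M (\<lambda>x. T (inv_into \<Omega> (\<phi> n) x) - T (inv_into \<Omega> \<phi>' x)) - 0) < e" by simp
  qed
qed

section \<open>Velocity fields in an admissible space\<close>

text \<open>As \<Omega> need not be convex, a derivative bound on \<Omega> alone gives no global
  Lipschitz estimate. A test function is differentiable on the whole space and vanishes near every
  point outside \<Omega>, so the mean value inequality holds for it between any two points; the
  estimate then passes to the limit \<open>f\<close>.\<close>

lemma C0_holder_bounds:
  fixes f :: "'a::euclidean_space \<Rightarrow> 'a"
  assumes f: "f \<in> C0_holder \<Omega> \<alpha>" and le: "holder_norm \<Omega> \<alpha> f \<le> ennreal C" and C: "0 \<le> C"
  shows C0_holder_zero: "x \<notin> \<Omega> \<Longrightarrow> f x = 0"
    and C0_holder_bounded: "norm (f x) \<le> C"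
    and C0_holder_lipschitz: "norm (f x - f y) \<le> C * norm (x - y)"
proof -
  have zero: "f x = 0" if "x \<notin> \<Omega>" for x using f that by (simp add: C0_holder_def)
  then show "x \<notin> \<Omega> \<Longrightarrow> f x = 0" .
  have sups: "ennreal (norm (h x)) \<le> holder_norm \<Omega> \<alpha> h"
    "ennreal (onorm (frechet_derivative h (at x))) \<le> holder_norm \<Omega> \<alpha> h" if x: "x \<in> \<Omega>" for h :: "'a \<Rightarrow> 'a" and x
  proof -
    let ?a = "SUP x\<in>\<Omega>. ennreal (norm (h x))"
    let ?b = "SUP x\<in>\<Omega>. ennreal (onorm (frechet_derivative h (at x)))"
    have "?a \<le> holder_norm \<Omega> \<alpha> h" "?b \<le> holder_norm \<Omega> \<alpha> h"
      unfolding holder_norm_def by (auto intro: add_increasing2 add_increasing)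
    moreover have "ennreal (norm (h x)) \<le> ?a" "ennreal (onorm (frechet_derivative h (at x))) \<le> ?b"
      using x by (auto intro: SUP_upper)
    ultimately show "ennreal (norm (h x)) \<le> holder_norm \<Omega> \<alpha> h"
      "ennreal (onorm (frechet_derivative h (at x))) \<le> holder_norm \<Omega> \<alpha> h" by (auto intro: order_trans)
  qed
  have "norm (f x) \<le> C" if "x \<in> \<Omega>" for x
    using order_trans[OF sups(1)[OF that] le] C by (simp add: ennreal_le_iff)
  then show "norm (f x) \<le> C" using zero C by (cases "x \<in> \<Omega>") auto
  have fD: "onorm (frechet_derivative f (at x)) \<le> C" if "x \<in> \<Omega>" for x
    using order_trans[OF sups(2)[OF that] le] C by (simp add: ennreal_le_iff)
  have approx: "norm (f x - f y) \<le> (C + \<epsilon>) * norm (x - y) + 2 * \<epsilon>" if e: "0 < \<epsilon>" for \<epsilon> x y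
  proof -
    obtain \<phi> where \<phi>: "\<phi> \<in> test_functions \<Omega>" and near: "holder_norm \<Omega> \<alpha> (\<lambda>x. f x - \<phi> x) < ennreal \<epsilon>"
      using f e unfolding C0_holder_def by blast
    have supp: "closure {x. \<phi> x \<noteq> 0} \<subseteq> \<Omega>" and "Ck (Suc 0) \<phi>" using \<phi> unfolding test_functions_def by blast+
    then have diff: "\<phi> differentiable (at x)" for x by simp
    have near0: "norm (f x - \<phi> x) \<le> \<epsilon>" for x
    proof (cases "x \<in> \<Omega>")
      case True
      then have "ennreal (norm (f x - \<phi> x)) < ennreal \<epsilon>" using sups(1)[of x "\<lambda>x. f x - \<phi> x"] near by (auto intro: le_less_trans)
      then show ?thesis by (simp add: ennreal_less_iff)
    next
      case False
      then have "\<phi> x = 0" using supp closure_subset[of "{x. \<phi> x \<noteq> 0}"] by blast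
      then show ?thesis using zero[OF False] e by simp
    qed
    have "onorm (frechet_derivative \<phi> (at x)) \<le> C + \<epsilon>" for x
    proof (cases "x \<in> \<Omega>")
      case True
      have df: "f differentiable (at x)" using f True by (simp add: C0_holder_def)
      note Df = frechet_derivative_works[THEN iffD1, OF df] and Dp = frechet_derivative_works[THEN iffD1, OF diff[of x]]
      have D: "frechet_derivative (\<lambda>x. f x - \<phi> x) (at x) = (\<lambda>h. frechet_derivative f (at x) h - frechet_derivative \<phi> (at x) h)"
        by (rule frechet_derivative_at[symmetric]) (rule has_derivative_diff[OF Df Dp])
      have "ennreal (onorm (frechet_derivative (\<lambda>x. f x - \<phi> x) (at x))) < ennreal \<epsilon>"
        using sups(2)[OF True, of "\<lambda>x. f x - \<phi> x"] near by (rule le_less_trans)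
      then have small: "onorm (\<lambda>h. frechet_derivative f (at x) h - frechet_derivative \<phi> (at x) h) \<le> \<epsilon>"
        unfolding D using e by (simp add: ennreal_less_iff onorm_pos_le has_derivative_bounded_linear[OF Df]
            has_derivative_bounded_linear[OF Dp] bounded_linear_sub)
      have bl: "bounded_linear (\<lambda>h. frechet_derivative f (at x) h - frechet_derivative \<phi> (at x) h)"
        by (intro bounded_linear_sub has_derivative_bounded_linear[OF Df] has_derivative_bounded_linear[OF Dp])
      have "frechet_derivative \<phi> (at x) = (\<lambda>h. frechet_derivative f (at x) h
          + - (frechet_derivative f (at x) h - frechet_derivative \<phi> (at x) h))" by simp
      then have "onorm (frechet_derivative \<phi> (at x)) \<le> onorm (frechet_derivative f (at x))
          + onorm (\<lambda>h. - (frechet_derivative f (at x) h - frechet_derivative \<phi> (at x) h))"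
        using onorm_triangle[OF has_derivative_bounded_linear[OF Df] bounded_linear_minus[OF bl]] by simp
      then show ?thesis
        using fD[OF True] small onorm_neg[of "\<lambda>h. frechet_derivative f (at x) h - frechet_derivative \<phi> (at x) h"]
        by linarith
    next
      case False
      \<comment> \<open>The complement of the closed support is an open neighbourhood of
        \<open>x\<close> on which \<open>\<phi>\<close> is zero, so its derivative at
        \<open>x\<close> vanishes.\<close>
      then have "x \<in> - closure {x. \<phi> x \<noteq> 0}" using supp by blast
      then have "(\<phi> has_derivative (\<lambda>h. 0)) (at x)"
        by (intro has_derivative_transform_within_open[of "\<lambda>_. 0" "\<lambda>h. 0" x UNIV "- closure {x. \<phi> x \<noteq> 0}" \<phi>])
          (use closure_subset[of "{x. \<phi> x \<noteq> 0}"] in auto)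
      then have "frechet_derivative \<phi> (at x) = (\<lambda>h. 0)" using frechet_derivative_at by metis
      then show ?thesis using C e by (simp add: onorm_zero)
    qed
    then have "norm (\<phi> x - \<phi> y) \<le> (C + \<epsilon>) * norm (x - y)"
      using diff by (intro differentiable_bound[of UNIV \<phi> "\<lambda>x. frechet_derivative \<phi> (at x)"])
        (auto simp: frechet_derivative_works)
    moreover have "f x - f y = (f x - \<phi> x) + (\<phi> x - \<phi> y) + (\<phi> y - f y)" by simp
    then have "norm (f x - f y) \<le> norm (f x - \<phi> x) + norm (\<phi> x - \<phi> y) + norm (\<phi> y - f y)"
      by (metis norm_triangle_ineq norm_triangle_mono order_refl)
    ultimately show ?thesis using near0[of x] near0[of y] by (simp add: norm_minus_commute)
  qed
  show "norm (f x - f y) \<le> C * norm (x - y)"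
  proof (rule field_le_epsilon)
    fix e :: real assume e: "0 < e"
    have p: "0 < norm (x - y) + 2" by (simp add: add_nonneg_pos)
    \<comment> \<open>Chosen so that the whole error in \<open>approx\<close>, namely
      \<open>k * (norm (x - y) + 2)\<close>, equals \<open>e\<close>.\<close>
    define k where "k = e / (norm (x - y) + 2)"
    have k: "0 < k" "k * (norm (x - y) + 2) = e" using e p by (simp_all add: k_def)
    have "norm (f x - f y) \<le> (C + k) * norm (x - y) + 2 * k" by (rule approx[OF k(1)])
    also have "\<dots> = C * norm (x - y) + k * (norm (x - y) + 2)" by (simp add: algebra_simps)
    also have "\<dots> = C * norm (x - y) + e" by (simp only: k(2))
    finally show "norm (f x - f y) \<le> C * norm (x - y) + e" .
  qed
qed

text \<open>What the flow theory takes from admissibility: a linear injective embedding into fields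
  vanishing outside \<Omega>, with one constant for the supremum and Lipschitz bounds on the whole
  space.\<close>

locale vector_fields =
  fixes \<Omega> :: "'a::euclidean_space set" and \<iota> :: "'v::real_normed_vector \<Rightarrow> 'a \<Rightarrow> 'a" and C :: real
  assumes add: "\<iota> (u + w) x = \<iota> u x + \<iota> w x"
    and scaleR: "\<iota> (c *\<^sub>R u) x = c *\<^sub>R \<iota> u x"
    and inj: "inj \<iota>"
    and C_pos: "0 < C"
    and zero: "x \<notin> \<Omega> \<Longrightarrow> \<iota> u x = 0"
    and bounded: "norm (\<iota> u x) \<le> C * norm u"
    and lipschitz: "norm (\<iota> u x - \<iota> u y) \<le> C * norm u * norm (x - y)"

lemma admissible_imp_vector_fields:
  assumes "admissible \<Omega> \<iota>"
  obtains C where "vector_fields \<Omega> \<iota> C"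
proof -
  obtain \<alpha> C where C: "0 \<le> C" "\<And>u. \<iota> u \<in> C0_holder \<Omega> \<alpha>" "\<And>u. holder_norm \<Omega> \<alpha> (\<iota> u) \<le> ennreal (C * norm u)"
    using assms unfolding admissible_def by blast
  \<comment> \<open>Passing to \<open>C + 1\<close> makes the constant strictly positive.\<close>
  have le: "holder_norm \<Omega> \<alpha> (\<iota> u) \<le> ennreal ((C + 1) * norm u)" for u
    by (rule order_trans[OF C(3)]) (intro ennreal_leI mult_right_mono, auto)
  have nn: "0 \<le> (C + 1) * norm u" for u :: 'b using C(1) by simp
  note bounds = C0_holder_bounds[OF C(2) le nn]
  have "vector_fields \<Omega> \<iota> (C + 1)"
    using assms C(1) bounds unfolding admissible_def by unfold_locales auto
  then show ?thesis by (rule that)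
qed

context vector_fields
begin

lemma diff: "\<iota> (u - w) x = \<iota> u x - \<iota> w x"
  using add[of "u - w" w x] by simp

lemma \<iota>_0: "\<iota> 0 x = 0"
  using scaleR[of 0 0 x] by simp

lemma evaluation_bounded_linear: "bounded_linear (\<lambda>u. \<iota> u x \<bullet> b)"
proof (rule bounded_linear_intro)
  show "\<iota> (u + w) x \<bullet> b = \<iota> u x \<bullet> b + \<iota> w x \<bullet> b" for u w by (simp add: add inner_add_left)
  show "\<iota> (c *\<^sub>R u) x \<bullet> b = c *\<^sub>R (\<iota> u x \<bullet> b)" for c u by (simp add: scaleR)
  show "norm (\<iota> u x \<bullet> b) \<le> norm u * (C * norm b)" for u
    using Cauchy_Schwarz_ineq2[of "\<iota> u x" b] mult_right_mono[OF bounded[of u x], of "norm b"] by (simp add: mult_ac)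
qed

lemma evaluation_tendsto: "f \<longlonglongrightarrow> u \<Longrightarrow> (\<lambda>n. \<iota> (f n) x) \<longlonglongrightarrow> \<iota> u x"
proof (rule LIM_zero_cancel, rule Lim_null_comparison)
  assume "f \<longlonglongrightarrow> u"
  then have "(\<lambda>n. C * norm (f n - u)) \<longlonglongrightarrow> C * norm (u - u)" by (intro tendsto_intros)
  then show "(\<lambda>n. C * norm (f n - u)) \<longlonglongrightarrow> 0" by simp
qed (auto simp: diff[symmetric] bounded)

lemma continuous: "continuous_on S (\<iota> u)"
proof -
  have "(C * norm u)-lipschitz_on S (\<iota> u)"
    using lipschitz C_pos by (intro lipschitz_onI) (auto simp: dist_norm)
  then show ?thesis by (rule lipschitz_on_continuous_on)
qed

text \<open>
  The evaluations at a countable dense set of points separate the points of \<open>V\<close>, so by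
  reflexivity no nonzero element of the bidual annihilates them.
\<close>

lemma separable_dual:
  assumes refl: "reflexive_space TYPE('v)"
  obtains E :: "('v \<Rightarrow>\<^sub>L real) set" where "countable E" "closure E = UNIV"
proof -
  obtain Q :: "'a set" where Q: "countable Q" "\<And>X. open X \<Longrightarrow> X \<noteq> {} \<Longrightarrow> \<exists>q\<in>Q. q \<in> X"
    by (rule countable_dense_setE) blast
  define e where "e q b = Blinfun (\<lambda>u. \<iota> u q \<bullet> b)" for q b
  have e: "blinfun_apply (e q b) u = \<iota> u q \<bullet> b" for q b u
    unfolding e_def by (simp add: bounded_linear_Blinfun_apply evaluation_bounded_linear)
  define B where "B = (\<lambda>(q, b). e q b) ` (Q \<times> Basis)"
  have cB: "countable B" unfolding B_def using Q(1) by (intro countable_image countable_SIGMA) (auto intro: countable_finite)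
  have "closure (span B) = UNIV"
  proof (rule ccontr)
    assume "closure (span B) \<noteq> UNIV"
    then obtain F :: "('v \<Rightarrow>\<^sub>L real) \<Rightarrow>\<^sub>L real" where F: "F \<noteq> 0" "\<And>l. l \<in> B \<Longrightarrow> blinfun_apply F l = 0"
      using annihilating_functional by blast
    obtain u where u: "\<And>l. blinfun_apply F l = blinfun_apply l u"
      using refl unfolding reflexive_space_def by blast
    have zeroQ: "\<iota> u q = 0" if q: "q \<in> Q" for q
    proof (rule euclidean_eqI)
      fix b :: 'a assume "b \<in> Basis"
      then have "e q b \<in> B" using q by (auto simp: B_def)
      then show "\<iota> u q \<bullet> b = 0 \<bullet> b" using F(2) u[of "e q b"] e by simp
    qed
    have "\<iota> u x = 0" for x
    proof (rule ccontr)
      assume "\<iota> u x \<noteq> 0"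
      moreover have "open {y. \<iota> u y \<noteq> 0}" by (intro open_Collect_neq continuous continuous_on_const)
      ultimately obtain q where "q \<in> Q" "\<iota> u q \<noteq> 0" using Q(2)[of "{y. \<iota> u y \<noteq> 0}"] by auto
      then show False using zeroQ by simp
    qed
    then have "\<iota> u = \<iota> 0" by (auto simp: \<iota>_0)
    then have "u = 0" using inj by (simp add: inj_eq)
    then have "F = 0" using u by (intro blinfun_eqI) simp
    then show False using F(1) by simp
  qed
  then show ?thesis using countable_dense_rational_subspace[OF cB] that by metis
qed

text \<open>The weight is \<open>C * norm (v t)\<close>. Along a curve, a simple approximant of
  \<open>v\<close> gives a finite sum of indicators times continuous functions, hence a measurable
  function; continuity of the evaluations passes measurability to \<open>v\<close> itself, without
  any joint measurability in time and space.\<close>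

lemma caratheodory_field:
  assumes v: "v \<in> velocity_fields" and A: "(C * L2_norm (lebesgue_on {0..1}) v)\<^sup>2 \<le> A"
  shows "caratheodory_field (\<lambda>t. \<iota> (v t)) (\<lambda>t. C * norm (v t)) A"
proof -
  let ?M = "lebesgue_on {0..1::real}"
  interpret finite_complete_measure ?M by (rule finite_complete_measure_lebesgue_on) simp
  show ?thesis
  proof
    fix \<gamma> :: "real \<Rightarrow> 'a" assume g: "continuous_on {0..1} \<gamma>"
    obtain s where s: "\<And>i. simple_function ?M (s i)" "AE t in ?M. (\<lambda>i::nat. s i t) \<longlonglongrightarrow> v t"
      using L2D(1)[OF v] by (auto simp: strongly_measurable_def)
    show "(\<lambda>t. \<iota> (v t) (\<gamma> t)) \<in> borel_measurable ?M"
    proof (rule borel_measurable_AE_LIMSEQ)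
      fix i
      have "(\<lambda>t. \<Sum>y\<in>s i ` space ?M. indicator (s i -` {y} \<inter> space ?M) t *\<^sub>R \<iota> y (\<gamma> t)) \<in> borel_measurable ?M"
      proof (intro borel_measurable_sum borel_measurable_scaleR borel_measurable_indicator simple_functionD(2) s)
        fix y
        have "continuous_on {0..1} (\<lambda>t. \<iota> y (\<gamma> t))"
          by (rule continuous_on_compose2[OF continuous g]) auto
        then show "(\<lambda>t. \<iota> y (\<gamma> t)) \<in> borel_measurable ?M"
          by (intro continuous_imp_measurable_on_sets_lebesgue) auto
      qed
      also have "?this \<longleftrightarrow> (\<lambda>t. \<iota> (s i t) (\<gamma> t)) \<in> borel_measurable ?M"
      proof (rule measurable_cong)
        fix t assume t: "t \<in> space ?M"
        have "(\<Sum>y\<in>s i ` space ?M. indicator (s i -` {y} \<inter> space ?M) t *\<^sub>R \<iota> y (\<gamma> t))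
            = (\<Sum>y\<in>s i ` space ?M. if y = s i t then \<iota> y (\<gamma> t) else 0)"
          using t by (intro sum.cong) (auto simp: indicator_def)
        also have "\<dots> = \<iota> (s i t) (\<gamma> t)" using t simple_functionD(1)[OF s(1)] by simp
        finally show "(\<Sum>y\<in>s i ` space ?M. indicator (s i -` {y} \<inter> space ?M) t *\<^sub>R \<iota> y (\<gamma> t)) = \<iota> (s i t) (\<gamma> t)" .
      qed
      finally show "(\<lambda>t. \<iota> (s i t) (\<gamma> t)) \<in> borel_measurable ?M" .
    next
      show "AE t in ?M. (\<lambda>i. \<iota> (s i t) (\<gamma> t)) \<longlonglongrightarrow> \<iota> (v t) (\<gamma> t)"
        using s(2) by eventually_elim (rule evaluation_tendsto)
    qed
  next
    show "(\<lambda>t. C * norm (v t)) \<in> borel_measurable ?M"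
      by (intro borel_measurable_times borel_measurable_const L2_norm_measurable v)
    show "integrable ?M (\<lambda>s. (C * norm (v s))\<^sup>2)"
      using L2D(2)[OF v] by (simp add: power_mult_distrib)
    show "(\<integral>s. (C * norm (v s))\<^sup>2 \<partial>?M) \<le> A"
      using A by (simp add: power_mult_distrib L2_norm_power2)
  qed (use bounded lipschitz in auto)
qed

text \<open>The curve \<open>\<gamma>\<close> does not depend on \<open>v\<close>, so the driving
  integral is linear in \<open>v\<close>; the bound is the estimate by \<open>sqrt A\<close> with
  \<open>A\<close> the exact square integral of \<open>C * norm (v t)\<close>.\<close>

lemma integral_in_dual:
  fixes \<gamma> :: "real \<Rightarrow> 'a" and t :: real
  assumes g: "continuous_on {0..1} \<gamma>" and t: "t \<in> {0..1}"
  shows "(\<lambda>v. integral {0..t} (\<lambda>s. \<iota> (v s) (\<gamma> s)) \<bullet> b) \<in> L2_dual (lebesgue_on {0..1})"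
proof -
  let ?M = "lebesgue_on {0..1::real}"
  have sub: "{0..t} \<subseteq> {0..1}" using t by auto
  have int: "(\<lambda>s. \<iota> (v s) (\<gamma> s)) integrable_on {0..t}" if "v \<in> L2 ?M" for v
    by (rule caratheodory_field.integrand_sub(3)[OF caratheodory_field[OF that order_refl] g sub])
  show ?thesis
    unfolding L2_dual_def
  proof (intro CollectI conjI ballI allI)
    fix v w :: "real \<Rightarrow> 'v" assume v: "v \<in> L2 ?M" and w: "w \<in> L2 ?M"
    show "integral {0..t} (\<lambda>s. \<iota> (v s + w s) (\<gamma> s)) \<bullet> b
        = integral {0..t} (\<lambda>s. \<iota> (v s) (\<gamma> s)) \<bullet> b + integral {0..t} (\<lambda>s. \<iota> (w s) (\<gamma> s)) \<bullet> b"
      by (simp add: add Henstock_Kurzweil_Integration.integral_add[OF int[OF v] int[OF w]] inner_add_left)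
  next
    fix c and v :: "real \<Rightarrow> 'v"
    show "integral {0..t} (\<lambda>s. \<iota> (c *\<^sub>R v s) (\<gamma> s)) \<bullet> b = c * (integral {0..t} (\<lambda>s. \<iota> (v s) (\<gamma> s)) \<bullet> b)"
      by (simp add: scaleR)
  next
    have "\<bar>integral {0..t} (\<lambda>s. \<iota> (v s) (\<gamma> s)) \<bullet> b\<bar> \<le> (C * norm b) * L2_norm ?M v" if v: "v \<in> L2 ?M" for v
    proof -
      have "norm (integral {0..t} (\<lambda>s. \<iota> (v s) (\<gamma> s))) \<le> sqrt ((C * L2_norm ?M v)\<^sup>2)"
        by (rule caratheodory_field.integral_u_le[OF caratheodory_field[OF v order_refl] g t])
      also have "\<dots> = C * L2_norm ?M v" using C_pos by simp
      finally have "norm (integral {0..t} (\<lambda>s. \<iota> (v s) (\<gamma> s))) * norm b \<le> (C * L2_norm ?M v) * norm b"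
        by (rule mult_right_mono) simp
      then show ?thesis
        using Cauchy_Schwarz_ineq2[of "integral {0..t} (\<lambda>s. \<iota> (v s) (\<gamma> s))" b] by (simp add: mult_ac)
    qed
    then show "\<exists>K. \<forall>v\<in>L2 ?M. \<bar>integral {0..t} (\<lambda>s. \<iota> (v s) (\<gamma> s)) \<bullet> b\<bar> \<le> K * L2_norm ?M v" by blast
  qed
qed

section \<open>Time-one maps of velocity fields and their weak stability\<close>

definition deformation :: "(real \<Rightarrow> 'v) \<Rightarrow> 'a \<Rightarrow> 'a" where
  "deformation v = flow (\<lambda>t. \<iota> (v t)) 1"

lemma
  fixes A :: real
  assumes v: "v \<in> velocity_fields" and A: "(C * L2_norm (lebesgue_on {0..1}) v)\<^sup>2 \<le> A"
  shows deformation_lipschitz: "norm (deformation v x - deformation v y) \<le> flow_lip A * norm (x - y)"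
    and deformation_inverse_lipschitz: "norm (x - y) \<le> flow_lip A * norm (deformation v x - deformation v y)"
    and deformation_bij: "bij_betw (deformation v) \<Omega> \<Omega>"
proof -
  interpret caratheodory_field "\<lambda>t. \<iota> (v t)" "\<lambda>t. C * norm (v t)" A
    by (rule caratheodory_field[OF v A])
  show "norm (deformation v x - deformation v y) \<le> flow_lip A * norm (x - y)"
    unfolding deformation_def by (rule flow_lipschitz)
  show "norm (x - y) \<le> flow_lip A * norm (deformation v x - deformation v y)"
    unfolding deformation_def by (rule flow_inverse_lipschitz)
  show "bij_betw (deformation v) \<Omega> \<Omega>"
    unfolding deformation_def by (rule bij_betw_flow) (rule zero)
qed

text \<open>With \<open>y\<close> the preimage of \<open>x\<close> under the limit map, the inverse
  Lipschitz bound gives a distance from \<open>y\<close> of at most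
  \<open>flow_lip A * norm (x - deformation (vs n) y)\<close>. Convergence of the inverses at
  \<open>x\<close> thus reduces to convergence of the forward maps at the one point
  \<open>y\<close>.\<close>

lemma inverse_deformation_tendsto:
  assumes w: "L2_weakly_tendsto (lebesgue_on {0..1}) vs v"
    and A: "\<And>n. (C * L2_norm (lebesgue_on {0..1}) (vs n))\<^sup>2 \<le> A" "(C * L2_norm (lebesgue_on {0..1}) v)\<^sup>2 \<le> A"
    and x: "x \<in> \<Omega>"
  shows "(\<lambda>n. inv_into \<Omega> (deformation (vs n)) x) \<longlonglongrightarrow> inv_into \<Omega> (deformation v) x"
proof -
  have vs: "vs n \<in> velocity_fields" for n using w by (auto simp: L2_weakly_tendsto_def)
  have v: "v \<in> velocity_fields" using w by (simp add: L2_weakly_tendsto_def)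
  have weak: "\<forall>\<Lambda>\<in>L2_dual (lebesgue_on {0..1}). (\<lambda>n. \<Lambda> (vs n)) \<longlonglongrightarrow> \<Lambda> v"
    using w by (simp add: L2_weakly_tendsto_def)
  interpret caratheodory_field "\<lambda>t. \<iota> (v t)" "\<lambda>t. C * norm (v t)" A
    by (rule caratheodory_field[OF v A(2)])
  define y where "y = inv_into \<Omega> (deformation v) x"
  have y: "deformation v y = x"
    unfolding y_def by (rule bij_betw_inv_into_right[OF deformation_bij[OF v A(2)] x])
  obtain \<gamma> where g: "is_trajectory (\<lambda>t. \<iota> (v t)) y \<gamma>" using trajectory_exists[of y] by blast
  then have gc: "continuous_on {0..1} \<gamma>" unfolding is_trajectory_def by blast
  have un: "caratheodory_field (\<lambda>t. \<iota> (vs n t)) (\<lambda>t. C * norm (vs n t)) A" for n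
    by (rule caratheodory_field[OF vs A(1)])
  have "(\<lambda>n. deformation (vs n) y) \<longlonglongrightarrow> deformation v y"
    unfolding deformation_def
  proof (rule flow_tendsto[where un="\<lambda>n t. \<iota> (vs n t)" and mn="\<lambda>n t. C * norm (vs n t)", OF un g])
    fix t :: real assume t: "t \<in> {0..1}"
    show "(\<lambda>n. integral {0..t} (\<lambda>s. \<iota> (vs n s) (\<gamma> s))) \<longlonglongrightarrow> integral {0..t} (\<lambda>s. \<iota> (v s) (\<gamma> s))"
    proof (subst tendsto_componentwise_iff, intro ballI)
      fix b :: 'a
      show "(\<lambda>n. integral {0..t} (\<lambda>s. \<iota> (vs n s) (\<gamma> s)) \<bullet> b) \<longlonglongrightarrow> integral {0..t} (\<lambda>s. \<iota> (v s) (\<gamma> s)) \<bullet> b"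
        using bspec[OF weak integral_in_dual[OF gc t]] .
    qed
  qed
  then have "(\<lambda>n. flow_lip A * norm (x - deformation (vs n) y)) \<longlonglongrightarrow> flow_lip A * norm (x - x)"
    unfolding y by (intro tendsto_intros)
  then have lim: "(\<lambda>n. flow_lip A * norm (x - deformation (vs n) y)) \<longlonglongrightarrow> 0" by simp
  have "norm (inv_into \<Omega> (deformation (vs n)) x - y) \<le> flow_lip A * norm (x - deformation (vs n) y)" for n
    using deformation_inverse_lipschitz[OF vs[of n] A(1)[of n], of "inv_into \<Omega> (deformation (vs n)) x" y]
    unfolding bij_betw_inv_into_right[OF deformation_bij[OF vs[of n] A(1)[of n]] x] .
  then have "(\<lambda>n. inv_into \<Omega> (deformation (vs n)) x - y) \<longlonglongrightarrow> 0"
    by (intro Lim_null_comparison[OF _ lim]) auto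
  then show ?thesis unfolding y_def by (rule LIM_zero_cancel)
qed

end

section \<open>Existence of minimizers\<close>

lemma (in finite_complete_measure) L2_weakly_tendsto_normI:
  fixes f :: "nat \<Rightarrow> 's \<Rightarrow> 'b::real_normed_vector"
  assumes f: "\<And>n. f n \<in> L2 M" "l \<in> L2 M" and lim: "(\<lambda>n. L2_norm M (\<lambda>x. f n x - l x)) \<longlonglongrightarrow> 0"
  shows "L2_weakly_tendsto M f l"
  unfolding L2_weakly_tendsto_def
proof (intro conjI ballI)
  fix \<Lambda> :: "('s \<Rightarrow> 'b) \<Rightarrow> real" assume L: "\<Lambda> \<in> L2_dual M"
  obtain C where C: "0 < C" "\<And>f. f \<in> L2 M \<Longrightarrow> \<bar>\<Lambda> f\<bar> \<le> C * L2_norm M f"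
    using L2_dual_bound[OF L] by metis
  have "norm (\<Lambda> (f n) - \<Lambda> l) \<le> C * L2_norm M (\<lambda>x. f n x - l x)" for n
    using C(2)[OF L2_diff[OF f(1)[of n] f(2)]] L2_dual_diff[OF L f(1)[of n] f(2)] by simp
  then have "(\<lambda>n. \<Lambda> (f n) - \<Lambda> l) \<longlonglongrightarrow> 0"
    by (intro Lim_null_comparison[OF _ tendsto_mult_right_zero[OF lim, of C]]) auto
  then show "(\<lambda>n. \<Lambda> (f n)) \<longlonglongrightarrow> \<Lambda> l" by (rule LIM_zero_cancel)
qed (use f in auto)

lemma (in finite_complete_measure) L2_weakly_tendsto_add:
  fixes f :: "nat \<Rightarrow> 's \<Rightarrow> 'b::real_normed_vector"
  assumes f: "L2_weakly_tendsto M f l" and g: "L2_weakly_tendsto M g k"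
  shows "L2_weakly_tendsto M (\<lambda>n x. f n x + g n x) (\<lambda>x. l x + k x)"
proof -
  have L2: "f n \<in> L2 M" "l \<in> L2 M" "g n \<in> L2 M" "k \<in> L2 M" for n
    using f g by (auto simp: L2_weakly_tendsto_def)
  show ?thesis
    unfolding L2_weakly_tendsto_def
  proof (intro conjI ballI)
    fix \<Lambda> :: "('s \<Rightarrow> 'b) \<Rightarrow> real" assume L: "\<Lambda> \<in> L2_dual M"
    have "(\<lambda>n. \<Lambda> (f n) + \<Lambda> (g n)) \<longlonglongrightarrow> \<Lambda> l + \<Lambda> k"
      using f g L by (intro tendsto_add) (simp_all add: L2_weakly_tendsto_def)
    then show "(\<lambda>n. \<Lambda> (\<lambda>x. f n x + g n x)) \<longlonglongrightarrow> \<Lambda> (\<lambda>x. l x + k x)"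
      by (simp add: L2_dual_add[OF L] L2)
  qed (use L2_add L2 in auto)
qed

lemma L2_weakly_tendsto_subseq:
  assumes f: "L2_weakly_tendsto M f l" and r: "strict_mono r"
  shows "L2_weakly_tendsto M (\<lambda>n. f (r n)) l"
proof -
  have "(\<lambda>n. \<Lambda> (f (r n))) \<longlonglongrightarrow> \<Lambda> l" if "\<Lambda> \<in> L2_dual M" for \<Lambda>
    using LIMSEQ_subseq_LIMSEQ[OF _ r, of "\<lambda>n. \<Lambda> (f n)"] f that by (simp add: L2_weakly_tendsto_def o_def)
  then show ?thesis using f by (auto simp: L2_weakly_tendsto_def)
qed

lemma blinfun_real_eq: "l = blinfun_apply l 1 *\<^sub>R id_blinfun" for l :: "real \<Rightarrow>\<^sub>L real"
proof (rule blinfun_eqI)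
  fix x show "blinfun_apply l x = blinfun_apply (blinfun_apply l 1 *\<^sub>R id_blinfun) x"
    using blinfun.scaleR_right[of l x 1] by (simp add: blinfun.scaleR_left)
qed

text \<open>Together with separability of the dual of the reals, this makes the compactness theorem
  available for the image component \<open>z\<close>.\<close>

lemma reflexive_space_real: "reflexive_space TYPE(real)"
  unfolding reflexive_space_def
proof (intro allI)
  fix F :: "(real \<Rightarrow>\<^sub>L real) \<Rightarrow>\<^sub>L real"
  have "blinfun_apply F l = blinfun_apply l (blinfun_apply F id_blinfun)" for l
  proof -
    have "blinfun_apply F l = blinfun_apply l 1 * blinfun_apply F id_blinfun"
      by (metis blinfun_real_eq blinfun.scaleR_right real_scaleR_def)
    also have "\<dots> = blinfun_apply l (blinfun_apply F id_blinfun)"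
      using blinfun.scaleR_right[of l "blinfun_apply F id_blinfun" 1] by simp
    finally show ?thesis .
  qed
  then show "\<exists>x. \<forall>l. blinfun_apply F l = blinfun_apply l x" by blast
qed

lemma separable_dual_real:
  obtains E :: "(real \<Rightarrow>\<^sub>L real) set" where "countable E" "closure E = UNIV"
proof -
  have "l \<in> span {id_blinfun}" for l :: "real \<Rightarrow>\<^sub>L real"
  proof -
    show ?thesis by (metis blinfun_real_eq insertI1 span_base span_scale)
  qed
  then have "closure (span {id_blinfun :: real \<Rightarrow>\<^sub>L real}) = UNIV"
    by (metis UNIV_eq_I closure_UNIV)
  from countable_dense_rational_subspace[OF _ this] show ?thesis using that by (metis countable_insert countable_empty)
qed

text \<open>The coercivity hypotheses speak about sequences whose norms tend to infinity. An
  unbounded sequence yields one by reselection of indices; \<open>r\<close> is not claimed to be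
  increasing, which the argument by contradiction does not require.\<close>

lemma not_bounded_imp_divergent_subsequence:
  fixes a :: "nat \<Rightarrow> real"
  assumes "\<nexists>B. \<forall>n. a n \<le> B"
  obtains r where "filterlim (\<lambda>k. a (r k)) at_top sequentially"
proof -
  have "\<forall>k. \<exists>n. real k < a n" using assms by (meson not_le)
  then obtain r where r: "\<And>k. real k < a (r k)" by metis
  have "filterlim (\<lambda>k. a (r k)) at_top sequentially"
    by (rule filterlim_at_top_mono[OF filterlim_real_sequentially]) (auto intro!: always_eventually less_imp_le r)
  then show ?thesis by (rule that)
qed

lemma not_divergent_bounded:
  fixes b :: "nat \<Rightarrow> real"
  assumes "filterlim b at_top sequentially" "\<And>n. b n \<le> B" shows False
  using assms by (auto simp: filterlim_at_top_dense eventually_sequentially not_less dest!: spec[of _ B]) (meson le_refl not_less)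

lemma liminf_ge_imp_eventually:
  fixes a :: "nat \<Rightarrow> real"
  assumes "ereal x \<le> liminf (\<lambda>n. ereal (a n))" "0 < e"
  shows "\<forall>\<^sub>F n in sequentially. x - e < a n"
proof -
  have "ereal (x - e) < ereal x" using assms(2) by simp
  also note assms(1)
  finally have "\<forall>\<^sub>F n in sequentially. ereal (x - e) < ereal (a n)" by (rule less_LiminfD)
  then show ?thesis by simp
qed

theorem theorem3p2:
  fixes \<Omega> :: "(real ^ 'd) set"
    and T :: "real ^ 'd \<Rightarrow> real"
    and \<iota> :: "'v::banach \<Rightarrow> real ^ 'd \<Rightarrow> real ^ 'd"
    and K :: "(real ^ 'd \<Rightarrow> real) \<Rightarrow> 'y::banach"
    and D :: "'y \<Rightarrow> 'y \<Rightarrow> real"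
    and E1 :: "(real \<Rightarrow> 'v) \<Rightarrow> real"
    and E2 :: "(real ^ 'd \<Rightarrow> real) \<Rightarrow> real"
    and lam1 lam2 :: real
    and g :: 'y
  assumes domain: "open \<Omega>" "connected \<Omega>" "\<Omega> \<noteq> {}" "bounded \<Omega>"
    and template: "T \<in> L2 (lebesgue_on \<Omega>)"
    and V_reflexive: "reflexive_space TYPE('v)"
    and V_admissible: "admissible \<Omega> \<iota>"
    and D_nonneg: "\<And>f h. 0 \<le> D f h"
    and E1_nonneg: "\<And>v. v \<in> velocity_fields \<Longrightarrow> 0 \<le> E1 v"
    and E2_nonneg: "\<And>z. z \<in> L2 (lebesgue_on \<Omega>) \<Longrightarrow> 0 \<le> E2 z"
    and A1_cont: "L2_continuous (lebesgue_on \<Omega>) K"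
    and A1_weak: "\<And>xs x. L2_weakly_tendsto (lebesgue_on \<Omega>) xs x \<Longrightarrow>
                    weakly_tendsto (\<lambda>n. K (xs n)) (K x)"
    and A2_lsc: "\<And>h. weakly_lsc (\<lambda>f. D f h)"
    and A2_cont: "\<And>f. continuous_on UNIV (D f)"
    and A3: "\<And>f h. D f h = 0 \<Longrightarrow> f = h"
    and A4: "\<exists>C>0. \<forall>f h k. \<bar>D f k - D f h\<bar> \<le> C * D h k"
    and A5_image: "\<And>h fs zs.
          range fs \<subseteq> L2 (lebesgue_on \<Omega>) \<Longrightarrow>
          \<exists>B. \<forall>n. L2_norm (lebesgue_on \<Omega>) (fs n) \<le> B \<Longrightarrow>
          range zs \<subseteq> L2 (lebesgue_on \<Omega>) \<Longrightarrow>
          filterlim (\<lambda>n. L2_norm (lebesgue_on \<Omega>) (zs n)) at_top sequentially \<Longrightarrow>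
          filterlim (\<lambda>n. D (K (\<lambda>x. fs n x + zs n x)) h + E2 (zs n)) at_top sequentially"
    and A5_velocity: "\<And>vs.
          range vs \<subseteq> velocity_fields \<Longrightarrow>
          filterlim (\<lambda>n. L2_norm (lebesgue_on {0..1}) (vs n)) at_top sequentially \<Longrightarrow>
          filterlim (\<lambda>n. E1 (vs n)) at_top sequentially"
    and A6_E1: "L2_weakly_lsc (lebesgue_on {0..1}) E1"
    and A6_E2: "L2_weakly_lsc (lebesgue_on \<Omega>) E2"
    and weights: "0 < lam1" "0 < lam2"
  shows "\<exists>v \<in> velocity_fields. \<exists>z \<in> L2 (lebesgue_on \<Omega>).
           \<forall>v' \<in> velocity_fields. \<forall>z' \<in> L2 (lebesgue_on \<Omega>).
             objective \<Omega> T \<iota> K D E1 E2 lam1 lam2 g v z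
               \<le> objective \<Omega> T \<iota> K D E1 E2 lam1 lam2 g v' z'"
proof -
  let ?I = "lebesgue_on {0..1::real}" and ?M = "lebesgue_on \<Omega>"
  let ?J = "objective \<Omega> T \<iota> K D E1 E2 lam1 lam2 g"
  have I: "{0..1::real} \<in> lmeasurable" by simp
  have \<Omega>: "\<Omega> \<in> lmeasurable" using domain by (intro lmeasurable_open)
  interpret I: finite_complete_measure ?I by (rule finite_complete_measure_lebesgue_on[OF I])
  interpret M: finite_complete_measure ?M by (rule finite_complete_measure_lebesgue_on[OF \<Omega>])
  obtain C where "vector_fields \<Omega> \<iota> C" using V_admissible by (rule admissible_imp_vector_fields)
  then interpret vector_fields \<Omega> \<iota> C .
  \<comment> \<open>The deformed template is separated from \<open>z\<close> because the two parts
    converge in different senses: \<open>W v\<close> in norm, \<open>z\<close> only weakly.\<close>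
  define W where "W v = (\<lambda>x. T (inv_into \<Omega> (deformation v) x))" for v
  have rec: "reconstruction \<Omega> T \<iota> v z = (\<lambda>x. W v x + z x)" for v z
    by (simp add: reconstruction_def W_def deformation_def)
  have W: "W v \<in> L2 ?M" "L2_norm ?M (W v) \<le> sqrt (flow_lip A ^ DIM(real ^ 'd)) * L2_norm ?M T"
    if v: "v \<in> velocity_fields" and A: "(C * L2_norm ?I v)\<^sup>2 \<le> A" for v A
    unfolding W_def
    using L2_compose[OF deformation_lipschitz[OF v A] flow_lip_pos \<Omega> deformation_bij[OF v A] template]
      L2_norm_compose[OF deformation_lipschitz[OF v A] flow_lip_pos \<Omega> deformation_bij[OF v A] template] by auto
  define S :: "((real \<Rightarrow> 'v) \<times> (real ^ 'd \<Rightarrow> real)) set" where "S = {(v, z). v \<in> velocity_fields \<and> z \<in> L2 ?M}"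
  define J where "J p = ?J (fst p) (snd p)" for p :: "(real \<Rightarrow> 'v) \<times> (real ^ 'd \<Rightarrow> real)"
  have parts: "D (K (reconstruction \<Omega> T \<iota> (fst p) (snd p))) g \<le> J p" "lam1 * E1 (fst p) \<le> J p"
    "lam2 * E2 (snd p) \<le> J p" "0 \<le> J p" if "p \<in> S" for p :: "(real \<Rightarrow> 'v) \<times> (real ^ 'd \<Rightarrow> real)"
  proof -
    have "0 \<le> lam1 * E1 (fst p)" "0 \<le> lam2 * E2 (snd p)"
      using that weights E1_nonneg E2_nonneg by (auto simp: S_def)
    then show "D (K (reconstruction \<Omega> T \<iota> (fst p) (snd p))) g \<le> J p" "lam1 * E1 (fst p) \<le> J p"
      "lam2 * E2 (snd p) \<le> J p" "0 \<le> J p"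
      using D_nonneg[of "K (reconstruction \<Omega> T \<iota> (fst p) (snd p))" g] by (simp_all add: J_def objective_def)
  qed
  have "((\<lambda>_. 0), (\<lambda>_. 0)) \<in> S" by (simp add: S_def)
  then have Sne: "S \<noteq> {}" by blast
  have bdd: "bdd_below (J ` S)" using parts(4) by (intro bdd_belowI2)
  define J0 where "J0 = (INF p\<in>S. J p)"
  have J0: "J0 \<le> J p" if "p \<in> S" for p unfolding J0_def by (rule cINF_lower[OF bdd that])
  have "\<exists>p\<in>S. J p < J0 + 1 / real (Suc n)" for n
  proof -
    have "(INF p\<in>S. J p) < J0 + 1 / real (Suc n)" by (simp add: J0_def[symmetric])
    then show ?thesis by (simp add: cINF_less_iff[OF Sne bdd])
  qed
  then obtain p where pS: "\<And>n. p n \<in> S" and pJ: "\<And>n. J (p n) < J0 + 1 / real (Suc n)" by metis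
  define v where "v n = fst (p n)" for n
  define z where "z n = snd (p n)" for n
  have v: "v n \<in> velocity_fields" and z: "z n \<in> L2 ?M" for n
    using pS[of n] by (auto simp: S_def v_def z_def)
  have J1: "J (p n) \<le> J0 + 1" for n
  proof -
    have "1 / real (Suc n) \<le> 1" by simp
    then show ?thesis using pJ[of n] by linarith
  qed
  \<comment> \<open>The velocities have to be bounded before the residuals: the coercivity condition
    on \<open>z\<close> presupposes bounded deformed templates, and their bound depends on the
    velocities. Divergent velocities would send \<open>E1\<close> to infinity, while
    \<open>lam1 * E1\<close> stays below \<open>J0 + 1\<close>.\<close>
  obtain Bv where Bv: "\<And>n. L2_norm ?I (v n) \<le> Bv"
  proof (cases "\<exists>B. \<forall>n. L2_norm ?I (v n) \<le> B")
    case False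
    then obtain r where r: "filterlim (\<lambda>k. L2_norm ?I (v (r k))) at_top sequentially"
      by (rule not_bounded_imp_divergent_subsequence)
    have "filterlim (\<lambda>k. E1 (v (r k))) at_top sequentially" by (rule A5_velocity[OF _ r]) (use v in auto)
    moreover have "E1 (v (r k)) \<le> (J0 + 1) / lam1" for k
    proof -
      have "lam1 * E1 (v (r k)) \<le> J0 + 1" using parts(2)[OF pS[of "r k"]] J1[of "r k"] by (simp add: v_def)
      then show ?thesis using weights by (simp add: pos_le_divide_eq mult.commute)
    qed
    ultimately show thesis by (rule not_divergent_bounded[THEN FalseE])
  qed (use that in blast)
  have Bv0: "0 \<le> Bv" using Bv[of 0] L2_norm_nonneg order_trans by blast
  define A where "A = (C * Bv)\<^sup>2"
  have "\<exists>B. \<forall>n. L2_norm ?M (z n) \<le> B"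
  proof (rule ccontr)
    assume "\<not> ?thesis"
    then obtain r where r: "filterlim (\<lambda>k. L2_norm ?M (z (r k))) at_top sequentially"
      by (rule not_bounded_imp_divergent_subsequence)
    have A: "(C * L2_norm ?I (v n))\<^sup>2 \<le> A" for n
      unfolding A_def using C_pos Bv by (intro power_mono mult_left_mono) auto
    have "filterlim (\<lambda>k. D (K (\<lambda>x. W (v (r k)) x + z (r k) x)) g + E2 (z (r k))) at_top sequentially"
    proof (rule A5_image[OF _ _ _ r])
      show "range (\<lambda>k. W (v (r k))) \<subseteq> L2 ?M" using W(1)[OF v A] by blast
      show "\<exists>B. \<forall>n. L2_norm ?M (W (v (r n))) \<le> B" using W(2)[OF v A] by blast
      show "range (\<lambda>k. z (r k)) \<subseteq> L2 ?M" using z by blast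
    qed
    moreover have "D (K (\<lambda>x. W (v (r k)) x + z (r k) x)) g + E2 (z (r k)) \<le> (J0 + 1) + (J0 + 1) / lam2" for k
    proof (rule add_mono)
      show "D (K (\<lambda>x. W (v (r k)) x + z (r k) x)) g \<le> J0 + 1"
        using parts(1)[OF pS[of "r k"]] J1[of "r k"] by (simp add: v_def z_def rec)
      have "lam2 * E2 (z (r k)) \<le> J0 + 1" using parts(3)[OF pS[of "r k"]] J1[of "r k"] by (simp add: z_def)
      then show "E2 (z (r k)) \<le> (J0 + 1) / lam2" using weights by (simp add: pos_le_divide_eq mult.commute)
    qed
    ultimately show False by (rule not_divergent_bounded)
  qed
  then obtain Bz where Bz: "\<And>n. L2_norm ?M (z n) \<le> Bz" by blast
  obtain E :: "('v \<Rightarrow>\<^sub>L real) set" where E: "countable E" "closure E = UNIV"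
    using V_reflexive by (rule separable_dual)
  obtain \<C> where \<C>: "countable \<C>" "\<C> \<subseteq> sets ?I"
    "\<And>A e. A \<in> sets ?I \<Longrightarrow> 0 < e \<Longrightarrow> \<exists>C\<in>\<C>. measure ?I (sym_diff A C) < e"
    using lebesgue_on_countably_approximable[OF I] by metis
  obtain r1 v0 where r1: "strict_mono r1" and w1: "L2_weakly_tendsto ?I (\<lambda>n. v (r1 n)) v0"
    using I.L2_weak_compactness[OF V_reflexive E \<C>, of v, OF _ _ v Bv] by metis
  obtain E' :: "(real \<Rightarrow>\<^sub>L real) set" where E': "countable E'" "closure E' = UNIV"
    by (rule separable_dual_real)
  obtain \<C>' where \<C>': "countable \<C>'" "\<C>' \<subseteq> sets ?M"
    "\<And>A e. A \<in> sets ?M \<Longrightarrow> 0 < e \<Longrightarrow> \<exists>C\<in>\<C>'. measure ?M (sym_diff A C) < e"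
    using lebesgue_on_countably_approximable[OF \<Omega>] by metis
  \<comment> \<open>The second extraction runs inside the first, so that both components converge
    weakly along the common subsequence \<open>r1 (r2 n)\<close>.\<close>
  obtain r2 z0 where r2: "strict_mono r2" and w2: "L2_weakly_tendsto ?M (\<lambda>n. z (r1 (r2 n))) z0"
    using M.L2_weak_compactness[OF reflexive_space_real E' \<C>', of "\<lambda>n. z (r1 n)", OF _ _ z Bz] by metis
  define r where "r n = r1 (r2 n)" for n
  have wv: "L2_weakly_tendsto ?I (\<lambda>n. v (r n)) v0"
    unfolding r_def by (rule L2_weakly_tendsto_subseq[OF w1 r2])
  have wz: "L2_weakly_tendsto ?M (\<lambda>n. z (r n)) z0" using w2 by (simp add: r_def)
  have v0: "v0 \<in> velocity_fields" and z0: "z0 \<in> L2 ?M"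
    using wv wz by (simp_all add: L2_weakly_tendsto_def)
  \<comment> \<open>The maximum gives one constant for the sequence and its weak limit, without
    appeal to lower semicontinuity of the norm.\<close>
  define A' where "A' = max A ((C * L2_norm ?I v0)\<^sup>2)"
  have A: "(C * L2_norm ?I (v n))\<^sup>2 \<le> A'" for n
  proof -
    have "(C * L2_norm ?I (v n))\<^sup>2 \<le> A"
      unfolding A_def using C_pos Bv by (intro power_mono mult_left_mono) auto
    then show ?thesis by (simp add: A'_def)
  qed
  have A0: "(C * L2_norm ?I v0)\<^sup>2 \<le> A'" by (simp add: A'_def)
  have "(\<lambda>n. L2_norm ?M (\<lambda>x. W (v (r n)) x - W v0 x)) \<longlonglongrightarrow> 0"
    unfolding W_def
    by (rule L2_compose_tendsto[OF deformation_lipschitz[OF v A] deformation_bij[OF v A]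
          deformation_lipschitz[OF v0 A0] deformation_bij[OF v0 A0] flow_lip_pos \<Omega> template
          inverse_deformation_tendsto[OF wv A A0]])
  then have "L2_weakly_tendsto ?M (\<lambda>n. W (v (r n))) (W v0)"
    using W(1)[OF v A] W(1)[OF v0 A0] by (intro M.L2_weakly_tendsto_normI)
  then have "L2_weakly_tendsto ?M (\<lambda>n x. W (v (r n)) x + z (r n) x) (\<lambda>x. W v0 x + z0 x)"
    using wz by (rule M.L2_weakly_tendsto_add)
  then have "weakly_tendsto (\<lambda>n. K (\<lambda>x. W (v (r n)) x + z (r n) x)) (K (\<lambda>x. W v0 x + z0 x))"
    by (rule A1_weak)
  then have lD: "ereal (D (K (\<lambda>x. W v0 x + z0 x)) g) \<le> liminf (\<lambda>n. ereal (D (K (\<lambda>x. W (v (r n)) x + z (r n) x)) g))"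
    using A2_lsc[of g] by (simp add: weakly_lsc_def)
  have l1: "ereal (E1 v0) \<le> liminf (\<lambda>n. ereal (E1 (v (r n))))"
    using A6_E1 wv by (simp add: L2_weakly_lsc_def)
  have l2: "ereal (E2 z0) \<le> liminf (\<lambda>n. ereal (E2 (z (r n))))"
    using A6_E2 wz by (simp add: L2_weakly_lsc_def)
  have "?J v0 z0 \<le> J0"
  proof (rule field_le_epsilon)
    fix e :: real assume e: "0 < e"
    \<comment> \<open>Four errors are budgeted: \<open>d\<close> for the data term,
      \<open>lam1 * d\<close> and \<open>lam2 * d\<close> for the regularisers, and \<open>d\<close>
      for the distance of the minimising sequence from the infimum. Their sum is
      \<open>e\<close>.\<close>
    define d where "d = e / (2 + lam1 + lam2)"
    have d: "0 < d" "d * (2 + lam1 + lam2) = e" using e weights by (simp_all add: d_def)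
    have "(\<lambda>n. 1 / real (Suc n)) \<longlonglongrightarrow> 0" using LIMSEQ_inverse_real_of_nat by (simp add: inverse_eq_divide)
    then have "\<forall>\<^sub>F n in sequentially. 1 / real (Suc n) < d" using d(1) by (rule order_tendstoD(2))
    with liminf_ge_imp_eventually[OF lD d(1)] liminf_ge_imp_eventually[OF l1 d(1)] liminf_ge_imp_eventually[OF l2 d(1)]
    have "\<forall>\<^sub>F n in sequentially. ?J v0 z0 \<le> J0 + e"
    proof eventually_elim
      fix n
      assume D: "D (K (\<lambda>x. W v0 x + z0 x)) g - d < D (K (\<lambda>x. W (v (r n)) x + z (r n) x)) g"
        and 1: "E1 v0 - d < E1 (v (r n))" and 2: "E2 z0 - d < E2 (z (r n))" and n: "1 / real (Suc n) < d"
      \<comment> \<open>A strictly increasing \<open>r\<close> satisfies \<open>n \<le> r n\<close>,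
        so the rate \<open>1 / real (Suc n)\<close> of the minimising sequence persists along the
        subsequence.\<close>
      have "strict_mono r" using r1 r2 by (simp add: r_def strict_mono_def)
      then have "1 / real (Suc (r n)) \<le> 1 / real (Suc n)"
        by (intro frac_le) (auto intro: strict_mono_imp_increasing)
      then have "J (p (r n)) \<le> J0 + d" using pJ[of "r n"] n by linarith
      moreover have "J (p (r n)) = D (K (\<lambda>x. W (v (r n)) x + z (r n) x)) g + lam1 * E1 (v (r n)) + lam2 * E2 (z (r n))"
        by (simp add: J_def objective_def rec v_def z_def)
      moreover have "lam1 * (E1 v0 - d) \<le> lam1 * E1 (v (r n))" "lam2 * (E2 z0 - d) \<le> lam2 * E2 (z (r n))"
        using 1 2 weights by (auto intro!: mult_left_mono)
      ultimately show "?J v0 z0 \<le> J0 + e"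
        using D d(2) by (simp add: objective_def rec algebra_simps)
    qed
    then show "?J v0 z0 \<le> J0 + e" by simp
  qed
  moreover have "J0 \<le> ?J v' z'" if "v' \<in> velocity_fields" "z' \<in> L2 ?M" for v' z'
    using J0[of "(v', z')"] that by (simp add: S_def J_def)
  ultimately show ?thesis using v0 z0 by (meson order_trans)
qed

end
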